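(* Let $\Gamma = (V,E)$ be a graph and $\mathfrak{p}: V \to \{p^n : p \text{ prime},\ n \geq 1\} \cup \{\infty\}$ a function, and let $G = G(\Gamma,\mathfrak{p})$. Then $G$ admits a Polish group topology if and only if $(\Gamma,\mathfrak{p})$ satisfies the following four conditions: (a) there exists a countable $A \subseteq V$ such that for every $a \in V$ and every $b \in V \setminus A$ with $a \neq b$, $a$ is adjacent to $b$; (b) there are only finitely many colors $c$ (elements of the range of $\mathfrak{p}$) such that the set $\{v \in V : \mathfrak{p}(v) = c\}$ is uncountable; (c) the set $\{v \in V : \mathfrak{p}(v) = \infty\}$ is countable; (d) for every color $c$, if $\{v \in V : \mathfrak{p}(v) = c\}$ is uncountable then it has cardinality $2^{\aleph_0}$. Furthermore, if $(\Gamma,\mathfrak{p})$ satisfies conditions (a)–(d), then $G$ is isomorphic to the automorphism group of some countable (first-order) structure.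
   Context: Graphs are simple and undirected. For a graph $\Gamma=(V,E)$ and a function $\mathfrak{p}: V \to \{p^n : p \text{ prime},\ n \geq 1\} \cup \{\infty\}$ (called a colouring; its values are called colors), $G(\Gamma,\mathfrak{p})$ is the group with presentation $\langle V \mid a^{\mathfrak{p}(a)} = 1 \text{ for } a \in V \text{ with } \mathfrak{p}(a) \neq \infty;\ bc = cb \text{ for } b,c \in V \text{ with } b E c\rangle$ (the graph product of the cyclic groups $C_{\mathfrak{p}(v)}$). A Polish group topology on a group is a group topology that is separable and completely metrizable. *)

theory Defs
  imports
    "HOL-Analysis.Abstract_Metric_Spaces"
    "HOL-Algebra.Bij"
    "HOL-Computational_Algebra.Primes"
    "HOL-Library.Extended_Nat"
    "HOL-Library.Equipollence"
    "HOL-Library.Countable_Set"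
begin

section \<open>Groups given by presentations\<close>

text \<open>
  The letter \<open>(x, True)\<close> stands for the generator \<open>x\<close> and \<open>(x, False)\<close> for its formal inverse.
\<close>

type_synonym 'a word = "('a \<times> bool) list"

definition words :: "'a set \<Rightarrow> 'a word set" where
  "words S = lists (S \<times> UNIV)"

text \<open>
  Two words are related iff they represent the same element of the group with generators \<open>S\<close>
  and defining relations \<open>u = v\<close> for \<open>(u, v) \<in> R\<close>: the least congruence on the monoid of words that
  contains the free cancellations and the defining relations.
\<close>

inductive_set pres_rel :: "'a set \<Rightarrow> ('a word \<times> 'a word) set \<Rightarrow> ('a word \<times> 'a word) set"
  for S :: "'a set" and R :: "('a word \<times> 'a word) set"
where
  refl: "w \<in> words S \<Longrightarrow> (w, w) \<in> pres_rel S R"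
| sym: "(u, v) \<in> pres_rel S R \<Longrightarrow> (v, u) \<in> pres_rel S R"
| trans: "(u, v) \<in> pres_rel S R \<Longrightarrow> (v, w) \<in> pres_rel S R \<Longrightarrow> (u, w) \<in> pres_rel S R"
| append: "(u, u') \<in> pres_rel S R \<Longrightarrow> (v, v') \<in> pres_rel S R \<Longrightarrow> (u @ v, u' @ v') \<in> pres_rel S R"
| cancel: "x \<in> S \<Longrightarrow> ([(x, b), (x, \<not> b)], []) \<in> pres_rel S R"
| defining: "(u, v) \<in> R \<Longrightarrow> u \<in> words S \<Longrightarrow> v \<in> words S \<Longrightarrow> (u, v) \<in> pres_rel S R"

definition presented_group :: "'a set \<Rightarrow> ('a word \<times> 'a word) set \<Rightarrow> 'a word set monoid" where
  "presented_group S R =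
    \<lparr>carrier = words S // pres_rel S R,
     monoid.mult = (\<lambda>A B. \<Union>u\<in>A. \<Union>v\<in>B. pres_rel S R `` {u @ v}),
     monoid.one = pres_rel S R `` {[]}\<rparr>"

lemma pres_rel_words:
  assumes "(u, v) \<in> pres_rel S R"
  shows "u \<in> words S" "v \<in> words S"
  using assms by (induction rule: pres_rel.induct) (auto simp: words_def)

lemma equiv_pres_rel: "equiv (words S) (pres_rel S R)"
proof (rule equivI)
  show "pres_rel S R \<subseteq> words S \<times> words S"
    by (auto dest: pres_rel_words)
  show "refl_on (words S) (pres_rel S R)"
    by (rule refl_onI) (rule pres_rel.refl)
  show "sym (pres_rel S R)"
    by (rule symI) (rule pres_rel.sym)
  show "trans (pres_rel S R)"
    by (rule transI) (rule pres_rel.trans)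
qed

lemma presented_group_mult_class:
  assumes "u \<in> words S" "v \<in> words S"
  shows "(pres_rel S R `` {u}) \<otimes>\<^bsub>presented_group S R\<^esub> (pres_rel S R `` {v})
    = pres_rel S R `` {u @ v}"
proof -
  let ?A = "pres_rel S R `` {u}" and ?B = "pres_rel S R `` {v}"
  have "pres_rel S R `` {u' @ v'} = pres_rel S R `` {u @ v}" if "u' \<in> ?A" "v' \<in> ?B" for u' v'
    using that equiv_class_eq[OF equiv_pres_rel] pres_rel.append by (metis Image_singleton_iff)
  then have "(\<Union>u'\<in>?A. \<Union>v'\<in>?B. pres_rel S R `` {u' @ v'}) = (\<Union>u'\<in>?A. \<Union>v'\<in>?B. pres_rel S R `` {u @ v})"
    by (intro SUP_cong HOL.refl)
  also have "\<dots> = pres_rel S R `` {u @ v}"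
    using assms by (blast intro: pres_rel.refl)
  finally show ?thesis
    by (simp only: presented_group_def monoid.simps partial_object.simps)
qed

lemma words_inverse:
  assumes "u \<in> words S"
  shows "rev (map (apsnd Not) u) \<in> words S
    \<and> (rev (map (apsnd Not) u) @ u, []) \<in> pres_rel S R"
  using assms unfolding words_def
proof (induction u rule: lists.induct)
  case Nil
  then show ?case by (auto intro: pres_rel.refl simp: words_def)
next
  case (Cons a l)
  obtain x b where a: "a = (x, b)" "x \<in> S" using Cons.hyps by (cases a) auto
  have w: "rev (map (apsnd Not) l) \<in> words S" "l \<in> words S"
    using Cons by (auto simp: words_def)
  have "([(x, \<not> b), (x, b)] @ l, [] @ l) \<in> pres_rel S R"
    using pres_rel.append[OF pres_rel.cancel[OF a(2), of "\<not> b"] pres_rel.refl[OF w(2)]] by simp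
  then have "(rev (map (apsnd Not) l) @ [(x, \<not> b), (x, b)] @ l, rev (map (apsnd Not) l) @ l)
      \<in> pres_rel S R"
    using pres_rel.append[OF pres_rel.refl[OF w(1)]] by fastforce
  then show ?case using Cons a by (auto intro: pres_rel.trans)
qed

lemma group_presented_group: "group (presented_group S R)"
proof (rule groupI)
  let ?G = "presented_group S R" and ?c = "\<lambda>w. pres_rel S R `` {w}"
  have car: "carrier ?G = ?c ` words S"
    by (auto simp: presented_group_def quotient_def)
  have one: "\<one>\<^bsub>?G\<^esub> = ?c []" by (simp add: presented_group_def)
  have app: "u @ v \<in> words S" if "u \<in> words S" "v \<in> words S" for u v :: "'a word"
    using that by (auto simp: words_def)
  have nil: "[] \<in> words S" by (simp add: words_def)
  show "x \<otimes>\<^bsub>?G\<^esub> y \<in> carrier ?G" if "x \<in> carrier ?G" "y \<in> carrier ?G" for x y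
    using that app by (auto simp: car presented_group_mult_class)
  show "\<one>\<^bsub>?G\<^esub> \<in> carrier ?G" using nil by (auto simp: car one)
  show "x \<otimes>\<^bsub>?G\<^esub> y \<otimes>\<^bsub>?G\<^esub> z = x \<otimes>\<^bsub>?G\<^esub> (y \<otimes>\<^bsub>?G\<^esub> z)"
    if "x \<in> carrier ?G" "y \<in> carrier ?G" "z \<in> carrier ?G" for x y z
    using that app by (auto simp: car presented_group_mult_class)
  show "\<one>\<^bsub>?G\<^esub> \<otimes>\<^bsub>?G\<^esub> x = x" if "x \<in> carrier ?G" for x
    using that nil by (auto simp: car one presented_group_mult_class)
  show "\<exists>y\<in>carrier ?G. y \<otimes>\<^bsub>?G\<^esub> x = \<one>\<^bsub>?G\<^esub>" if x: "x \<in> carrier ?G" for x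
  proof -
    obtain u where u: "u \<in> words S" "x = ?c u" using x by (auto simp: car)
    let ?v = "rev (map (apsnd Not) u)"
    have v: "?v \<in> words S" "(?v @ u, []) \<in> pres_rel S R"
      using words_inverse[OF u(1)] by blast+
    have "?c ?v \<otimes>\<^bsub>?G\<^esub> x = ?c (?v @ u)"
      using u v by (simp add: presented_group_mult_class)
    also have "\<dots> = \<one>\<^bsub>?G\<^esub>"
      using equiv_class_eq[OF equiv_pres_rel v(2)] by (simp add: one)
    finally show ?thesis using v by (auto simp: car)
  qed
qed


section \<open>Coloured graphs and graph products of cyclic groups\<close>

definition simple_graph :: "'v set \<Rightarrow> 'v rel \<Rightarrow> bool" where
  "simple_graph V E \<longleftrightarrow> E \<subseteq> V \<times> V \<and> sym E \<and> irrefl E"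

definition colors :: "enat set" where
  "colors = {enat (q ^ n) | q n. prime q \<and> n \<ge> 1} \<union> {\<infinity>}"

definition graph_product_relations ::
    "'v set \<Rightarrow> 'v rel \<Rightarrow> ('v \<Rightarrow> enat) \<Rightarrow> ('v word \<times> 'v word) set" where
  "graph_product_relations V E p =
     {(replicate n (a, True), []) | a n. a \<in> V \<and> p a = enat n}
   \<union> {([(b, True), (c, True)], [(c, True), (b, True)]) | b c. (b, c) \<in> E}"

definition graph_product :: "'v set \<Rightarrow> 'v rel \<Rightarrow> ('v \<Rightarrow> enat) \<Rightarrow> 'v word set monoid" where
  "graph_product V E p = presented_group V (graph_product_relations V E p)"

definition color_class :: "'v set \<Rightarrow> ('v \<Rightarrow> enat) \<Rightarrow> enat \<Rightarrow> 'v set" where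
  "color_class V p c = {v \<in> V. p v = c}"

definition polish_conditions :: "'v set \<Rightarrow> 'v rel \<Rightarrow> ('v \<Rightarrow> enat) \<Rightarrow> bool" where
  "polish_conditions V E p \<longleftrightarrow>
     (\<exists>A\<subseteq>V. countable A \<and> (\<forall>a\<in>V. \<forall>b\<in>V - A. a \<noteq> b \<longrightarrow> (a, b) \<in> E)) \<and>
     finite {c \<in> p ` V. uncountable (color_class V p c)} \<and>
     countable (color_class V p \<infinity>) \<and>
     (\<forall>c\<in>p ` V. uncountable (color_class V p c) \<longrightarrow>
        color_class V p c \<approx> (UNIV :: nat set set))"


section \<open>Polish group topologies\<close>

definition group_topology :: "('g, 'm) monoid_scheme \<Rightarrow> 'g topology \<Rightarrow> bool" where
  "group_topology G T \<longleftrightarrow>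
     topspace T = carrier G \<and>
     continuous_map (prod_topology T T) T (\<lambda>(x, y). x \<otimes>\<^bsub>G\<^esub> y) \<and>
     continuous_map T T (\<lambda>x. inv\<^bsub>G\<^esub> x)"

definition separable_space :: "'a topology \<Rightarrow> bool" where
  "separable_space T \<longleftrightarrow> (\<exists>D\<subseteq>topspace T. countable D \<and> T closure_of D = topspace T)"

definition polish_group_topology :: "('g, 'm) monoid_scheme \<Rightarrow> 'g topology \<Rightarrow> bool" where
  "polish_group_topology G T \<longleftrightarrow>
     group_topology G T \<and> separable_space T \<and> completely_metrizable_space T"


section \<open>First-order structures and their automorphism groups\<close>

text \<open>
  A structure together with its signature: sets of function symbols (constants being those of arity
  \<open>0\<close>) and relation symbols, their arities, and their interpretations. The interpretation of a
  function symbol matters only on tuples over the universe whose length is its arity.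
\<close>

record ('f, 'r, 'd) fo_structure =
  universe :: "'d set"
  fun_syms :: "'f set"
  rel_syms :: "'r set"
  fun_arity :: "'f \<Rightarrow> nat"
  rel_arity :: "'r \<Rightarrow> nat"
  fun_interp :: "'f \<Rightarrow> 'd list \<Rightarrow> 'd"
  rel_interp :: "'r \<Rightarrow> 'd list set"

definition tuples :: "'d set \<Rightarrow> nat \<Rightarrow> 'd list set" where
  "tuples D n = {xs \<in> lists D. length xs = n}"

definition is_fo_structure :: "('f, 'r, 'd) fo_structure \<Rightarrow> bool" where
  "is_fo_structure M \<longleftrightarrow>
     universe M \<noteq> {} \<and>
     (\<forall>f\<in>fun_syms M. \<forall>xs\<in>tuples (universe M) (fun_arity M f). fun_interp M f xs \<in> universe M) \<and>
     (\<forall>r\<in>rel_syms M. rel_interp M r \<subseteq> tuples (universe M) (rel_arity M r))"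

definition automorphisms :: "('f, 'r, 'd) fo_structure \<Rightarrow> ('d \<Rightarrow> 'd) set" where
  "automorphisms M = {h \<in> Bij (universe M).
     (\<forall>f\<in>fun_syms M. \<forall>xs\<in>tuples (universe M) (fun_arity M f).
        h (fun_interp M f xs) = fun_interp M f (map h xs)) \<and>
     (\<forall>r\<in>rel_syms M. \<forall>xs\<in>tuples (universe M) (rel_arity M r).
        xs \<in> rel_interp M r \<longleftrightarrow> map h xs \<in> rel_interp M r)}"

definition automorphism_group :: "('f, 'r, 'd) fo_structure \<Rightarrow> ('d \<Rightarrow> 'd) monoid" where
  "automorphism_group M = BijGroup (universe M) \<lparr>carrier := automorphisms M\<rparr>"

lemma group_automorphism_group:
  assumes M: "is_fo_structure M"
  shows "group (automorphism_group M)"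
proof -
  let ?D = "universe M"
  interpret B: group "BijGroup ?D" by (rule group_BijGroup)
  have car: "carrier (BijGroup ?D) = Bij ?D" by (simp add: BijGroup_def)
  have map_tuples: "map h xs \<in> tuples ?D n" if "h \<in> Bij ?D" "xs \<in> tuples ?D n" for h xs n
    using that bij_betw_apply[of h ?D ?D] by (auto simp: tuples_def Bij_def)
  have map_comp: "map (compose ?D g h) xs = map g (map h xs)" if "xs \<in> tuples ?D n" for g h xs n
    using that by (auto simp: tuples_def compose_def)
  have "subgroup (automorphisms M) (BijGroup ?D)"
  proof (rule B.subgroupI)
    show "automorphisms M \<subseteq> carrier (BijGroup ?D)" by (auto simp: car automorphisms_def)
    have "map (\<lambda>x\<in>?D. x) xs = xs" if "xs \<in> tuples ?D n" for xs n
      using that by (auto simp: tuples_def intro!: map_idI)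
    then have "(\<lambda>x\<in>?D. x) \<in> automorphisms M"
      using M by (auto simp: automorphisms_def is_fo_structure_def id_Bij)
    then show "automorphisms M \<noteq> {}" by blast
  next
    fix h assume h: "h \<in> automorphisms M"
    then have hB: "h \<in> Bij ?D" by (simp add: automorphisms_def)
    let ?k = "\<lambda>x\<in>?D. inv_into ?D h x"
    have inv: "inv\<^bsub>BijGroup ?D\<^esub> h = ?k" using hB by (rule inv_BijGroup)
    have kB: "?k \<in> Bij ?D" using hB by (rule restrict_inv_into_Bij)
    have bij: "bij_betw h ?D ?D" using hB by (simp add: Bij_def)
    have kh: "?k (h x) = x" if "x \<in> ?D" for x
      using bij that by (auto simp: bij_betw_def inv_into_f_f)
    have hk: "map h (map ?k xs) = xs" if "xs \<in> tuples ?D n" for xs n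
      using bij that by (auto simp: tuples_def bij_betw_def f_inv_into_f intro!: map_idI)
    have "?k (fun_interp M f xs) = fun_interp M f (map ?k xs)"
      if f: "f \<in> fun_syms M" and xs: "xs \<in> tuples ?D (fun_arity M f)" for f xs
    proof -
      have t: "map ?k xs \<in> tuples ?D (fun_arity M f)" by (rule map_tuples[OF kB xs])
      then have "h (fun_interp M f (map ?k xs)) = fun_interp M f xs"
        using h f hk[OF xs] by (simp add: automorphisms_def del: map_map)
      moreover have "fun_interp M f (map ?k xs) \<in> ?D"
        using M f t by (simp add: is_fo_structure_def)
      ultimately show ?thesis using kh by metis
    qed
    moreover have "xs \<in> rel_interp M r \<longleftrightarrow> map ?k xs \<in> rel_interp M r"
      if r: "r \<in> rel_syms M" and xs: "xs \<in> tuples ?D (rel_arity M r)" for r xs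
      using h r map_tuples[OF kB xs] hk[OF xs] by (simp add: automorphisms_def del: map_map)
    ultimately show "inv\<^bsub>BijGroup ?D\<^esub> h \<in> automorphisms M"
      unfolding inv using kB by (simp add: automorphisms_def)
  next
    fix g h assume g: "g \<in> automorphisms M" and h: "h \<in> automorphisms M"
    then have B: "g \<in> Bij ?D" "h \<in> Bij ?D" by (simp_all add: automorphisms_def)
    have "compose ?D g h (fun_interp M f xs) = fun_interp M f (map (compose ?D g h) xs)"
      if f: "f \<in> fun_syms M" and xs: "xs \<in> tuples ?D (fun_arity M f)" for f xs
    proof -
      have "fun_interp M f xs \<in> ?D" using M f xs by (simp add: is_fo_structure_def)
      then show ?thesis
        using g h f xs map_tuples[OF B(2) xs] map_comp[OF xs, of g h]
        by (simp add: automorphisms_def compose_eq del: map_map)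
    qed
    moreover have "xs \<in> rel_interp M r \<longleftrightarrow> map (compose ?D g h) xs \<in> rel_interp M r"
      if r: "r \<in> rel_syms M" and xs: "xs \<in> tuples ?D (rel_arity M r)" for r xs
      using g h r xs map_tuples[OF B(2) xs] map_comp[OF xs, of g h]
      by (simp add: automorphisms_def del: map_map)
    ultimately show "g \<otimes>\<^bsub>BijGroup ?D\<^esub> h \<in> automorphisms M"
      using B by (simp add: automorphisms_def BijGroup_def compose_Bij)
  qed
  then show ?thesis
    unfolding automorphism_group_def by (rule B.subgroup_imp_group)
qed

end

theory Submission
  imports Defs "HOL-Analysis.Urysohn" "HOL-Algebra.Weak_Morphisms" "HOL-Algebra.Product_Groups" "HOL-Number_Theory.Cong"
begin

text \<open>
  Necessity. In a Polish group every system of equations \<open>x n = x (n + 1) ^ k n * d n\<close> has a solution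
  as soon as each \<open>d n\<close> is close enough to the identity, and any uncountable family contains pairs
  whose quotient is as close to the identity as desired. If (a), (b) or (c) fails, such quotients of
  letters (or of commutators of non-adjacent letters) give a system for which infinitely many
  retractions onto small groups detect \<open>x 0\<close>, although a word has only finitely many letters: for (c)
  the small groups are infinite cyclic, for (a) they are wreath products in which the commutator has
  infinite order, for (b) they are cyclic of rapidly growing order.

  For (d), let \<open>q ^ n\<close> be a colour used uncountably often. Up to countably many letters, the number of
  letters of this colour is the index, in the group of central elements of order dividing \<open>q ^ n\<close>, of
  the subgroup of those \<open>y\<close> for which \<open>y ^ q ^ (n - 1)\<close> is the \<open>q ^ n\<close>-th power of a central element.
  This subgroup is a continuous homomorphic image of a Polish group, hence open or meager, and a
  meager subgroup has continuum many cosets.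

  Sufficiency. All but countably many letters are central and have one of finitely many finite colours,
  each used by continuum many letters. The direct sum of continuum many cyclic groups of order
  \<open>q ^ n\<close> is the countable power of that cyclic group, so the graph product is a countable product of
  countable groups. Such a product is Polish, and it is the automorphism group of the disjoint union of
  its factors with their right multiplications.
\<close>

section \<open>Polish groups\<close>

text \<open>Nothing is known about the shape of neighbourhoods in an unknown Polish topology, so
  necessity only exploits that certain equations become solvable. Their exponents have two tasks: to
  make all later unknowns invisible in a given quotient, and not to destroy the one surviving
  coefficient on its way down to \<open>x 0\<close>. Factorials achieve both when the coefficient
  has infinite order; for letters of finite order, the order itself is the exponent and exceeds the
  product of all earlier ones. For (d), uncountability alone does not give the size of the
  continuum, and a subgroup defined through the existence of a root need not be closed. Hence the
  dichotomy is proved for images of homomorphisms between Polish groups. The quotient isolates one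
  colour: in a cyclic group of prime power order it is trivial unless the order is
  \<open>q ^ n\<close>, and then it has order \<open>q\<close>. Conversely, the topology is not
  visible on the generators: it comes from a basis modulo a prime that is found by Zorn's
  lemma.\<close>

lemma (in Metric_space) MCauchy_geometric:
  assumes f: "\<And>n. f n \<in> M" and step: "\<And>n. N \<le> n \<Longrightarrow> d (f (Suc n)) (f n) \<le> (1/2) ^ n"
  shows "MCauchy f"
proof -
  \<comment> \<open>The exact partial sums of the geometric series serve as the bound, because the
    weaker bound \<open>2 * (1/2) ^ n\<close> would not pass through the induction.\<close>
  have bound: "d (f (n + k)) (f n) \<le> 2 * (1/2) ^ n - 2 * (1/2) ^ (n + k)" if "N \<le> n" for n k
  proof (induction k)
    case 0 show ?case using f by simp
  next
    case (Suc k)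
    have "d (f (n + Suc k)) (f n) \<le> d (f (Suc (n + k))) (f (n + k)) + d (f (n + k)) (f n)"
      using triangle[of "f (Suc (n + k))" "f (n + k)" "f n"] f by simp
    also have "\<dots> \<le> (1/2) ^ (n + k) + (2 * (1/2) ^ n - 2 * (1/2) ^ (n + k))"
      using step[of "n + k"] that Suc by simp
    finally show ?case by simp
  qed
  have close: "d (f m) (f n) \<le> 2 * (1/2) ^ n" if "N \<le> n" "n \<le> m" for m n
  proof -
    obtain k where k: "m = n + k" using \<open>n \<le> m\<close> le_Suc_ex by blast
    have "(0::real) \<le> 2 * (1/2) ^ (n + k)" by simp
    then show ?thesis using bound[OF that(1), of k] unfolding k by linarith
  qed
  show ?thesis unfolding MCauchy_def
  proof (intro conjI allI impI)
    show "range f \<subseteq> M" using f by auto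
    fix \<epsilon> :: real assume "\<epsilon> > 0"
    then obtain K where K: "(1/2::real) ^ K < \<epsilon> / 2"
      using real_arch_pow_inv[of "\<epsilon>/2" "1/2"] by auto
    have "d (f n) (f n') < \<epsilon>" if "max K N \<le> n" "max K N \<le> n'" for n n'
    proof -
      have p: "2 * (1/2::real) ^ n < \<epsilon>" if "K \<le> n" for n
        using K power_decreasing[OF that, of "1/2::real"] by linarith
      show ?thesis
      proof (cases "n \<le> n'")
        case True
        then show ?thesis using close[of n n'] p[of n] that commute[of "f n" "f n'"] by simp
      next
        case False
        then show ?thesis using close[of n' n] p[of n'] that by simp
      qed
    qed
    then show "\<exists>N. \<forall>n n'. N \<le> n \<longrightarrow> N \<le> n' \<longrightarrow> d (f n) (f n') < \<epsilon>" by blast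
  qed
qed

text \<open>The metric is complete and compatible but not assumed to be invariant under
  translations. Closeness is therefore expressed through neighbourhoods of the identity or through
  continuity of the finitely many maps at hand.\<close>

locale polish_grp = group G + Metric_space "carrier G" d for G (structure) and d +
  assumes mcomplete: mcomplete
    and continuous_mult: "continuous_map (prod_topology mtopology mtopology) mtopology (\<lambda>(x, y). x \<otimes> y)"
    and continuous_inv: "continuous_map mtopology mtopology (\<lambda>x. inv x)"
    and separable: "\<exists>D\<subseteq>carrier G. countable D \<and> mtopology closure_of D = carrier G"

lemma polish_group_topologyE:
  assumes "group G" "polish_group_topology G T"
  obtains d where "polish_grp G d" "Metric_space.mtopology (carrier G) d = T"
proof -
  have ts: "topspace T = carrier G" using assms(2)
    by (simp add: polish_group_topology_def group_topology_def)
  obtain M d where d: "Metric_space M d" "Metric_space.mcomplete M d" "T = Metric_space.mtopology M d"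
    using assms(2) by (auto simp: polish_group_topology_def completely_metrizable_space_def)
  have M: "M = carrier G" using d Metric_space.topspace_mtopology ts by metis
  have "polish_grp G d"
    unfolding polish_grp_def polish_grp_axioms_def
    using assms d ts
    by (auto simp: M polish_group_topology_def group_topology_def Defs.separable_space_def)
  then show ?thesis using that d M by blast
qed

section \<open>Neighbourhoods of the identity, separability and equations\<close>

context polish_grp
begin

lemma continuous_map_mult:
  assumes "continuous_map X mtopology f" "continuous_map X mtopology g"
  shows "continuous_map X mtopology (\<lambda>x. f x \<otimes> g x)"
  using continuous_map_compose[OF continuous_map_pairedI[OF assms] continuous_mult]
  by (simp add: o_def)

lemma continuous_map_inv:
  "continuous_map X mtopology f \<Longrightarrow> continuous_map X mtopology (\<lambda>x. inv (f x))"
  using continuous_map_compose[OF _ continuous_inv] by (simp add: o_def)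

lemma continuous_map_pow:
  assumes "continuous_map X mtopology f"
  shows "continuous_map X mtopology (\<lambda>x. f x [^] (n::nat))"
proof (induction n)
  case 0 show ?case by (simp add: nat_pow_def)
next
  case (Suc n) then show ?case by (simp add: continuous_map_mult assms)
qed

lemma continuous_map_to_carrier: "c \<in> carrier G \<Longrightarrow> continuous_map X mtopology (\<lambda>_. c)"
  by simp

definition nhd :: "'a set \<Rightarrow> bool" where
  "nhd U \<longleftrightarrow> openin mtopology U \<and> \<one> \<in> U"

lemma nhd_subset: "nhd U \<Longrightarrow> U \<subseteq> carrier G"
  unfolding nhd_def using openin_subset by fastforce

lemma nhd_Int: "nhd U \<Longrightarrow> nhd V \<Longrightarrow> nhd (U \<inter> V)"
  by (auto simp: nhd_def)

lemma nhd_carrier: "nhd (carrier G)"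
  using openin_topspace[of mtopology] by (simp add: nhd_def)

lemma nhd_preimage:
  assumes "continuous_map mtopology X f" "openin X U" "f \<one> \<in> U"
  shows "nhd {x \<in> carrier G. f x \<in> U}"
  using openin_continuous_map_preimage[OF assms(1,2)] assms(3) by (simp add: nhd_def)

lemma nhd_ball:
  assumes "continuous_map mtopology mtopology f" "0 < r"
  shows "nhd {x \<in> carrier G. d (f \<one>) (f x) < r}"
proof -
  have f: "f x \<in> carrier G" if "x \<in> carrier G" for x
    using continuous_map_image_subset_topspace[OF assms(1)] that by auto
  have "nhd {x \<in> carrier G. f x \<in> mball (f \<one>) r}"
    by (rule nhd_preimage[OF assms(1)]) (use f assms in auto)
  then show ?thesis using f by (auto elim!: back_subst[of nhd])
qed

lemma openin_left_translate:
  assumes "openin mtopology U" "x \<in> carrier G"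
  shows "openin mtopology ((\<lambda>y. x \<otimes> y) ` U)"
proof -
  have U: "U \<subseteq> carrier G" using openin_subset[OF assms(1)] by simp
  have "openin mtopology {z \<in> topspace mtopology. inv x \<otimes> z \<in> U}"
    by (rule openin_continuous_map_preimage[OF _ assms(1)])
       (intro continuous_map_mult continuous_map_to_carrier, use assms in auto)
  also have "{z \<in> topspace mtopology. inv x \<otimes> z \<in> U} = (\<lambda>y. x \<otimes> y) ` U"
  proof (intro equalityI subsetI)
    fix z assume z: "z \<in> {z \<in> topspace mtopology. inv x \<otimes> z \<in> U}"
    then have "z = x \<otimes> (inv x \<otimes> z)" using assms(2) by (simp add: m_assoc[symmetric])
    then show "z \<in> (\<lambda>y. x \<otimes> y) ` U" using z by blast
  next
    fix z assume "z \<in> (\<lambda>y. x \<otimes> y) ` U"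
    then obtain y where "y \<in> U" "z = x \<otimes> y" by blast
    then show "z \<in> {z \<in> topspace mtopology. inv x \<otimes> z \<in> U}"
      using U assms(2) by (auto simp: m_assoc[symmetric])
  qed
  finally show ?thesis .
qed

text \<open>Continuity of division at the pair of identities. The form
  \<open>x \<otimes> inv y\<close> serves the search for close pairs, the form
  \<open>inv x \<otimes> y\<close> the proof that an image is meager.\<close>

lemma nhd_div:
  assumes "nhd U"
  obtains V where "nhd V" "\<And>x y. x \<in> V \<Longrightarrow> y \<in> V \<Longrightarrow> x \<otimes> inv y \<in> U"
    "\<And>x y. x \<in> V \<Longrightarrow> y \<in> V \<Longrightarrow> inv x \<otimes> y \<in> U"
proof -
  have aux: "\<exists>V. nhd V \<and> (\<forall>x\<in>V. \<forall>y\<in>V. f (x, y) \<in> U)"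
    if f: "continuous_map (prod_topology mtopology mtopology) mtopology f" "f (\<one>, \<one>) = \<one>"
    for f
  proof -
    define S where "S = {z \<in> topspace (prod_topology mtopology mtopology). f z \<in> U}"
    have "openin (prod_topology mtopology mtopology) S"
      unfolding S_def by (rule openin_continuous_map_preimage[OF f(1)]) (use assms in \<open>simp add: nhd_def\<close>)
    moreover have "(\<one>, \<one>) \<in> S"
      using assms f by (simp add: nhd_def S_def)
    ultimately obtain A B where AB: "openin mtopology A" "openin mtopology B" "\<one> \<in> A" "\<one> \<in> B" "A \<times> B \<subseteq> S"
      unfolding openin_prod_topology_alt by meson
    have "nhd (A \<inter> B)" using AB by (auto simp: nhd_def)
    moreover have "\<forall>x\<in>A \<inter> B. \<forall>y\<in>A \<inter> B. f (x, y) \<in> U" using AB(5) unfolding S_def by blast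
    ultimately show ?thesis by blast
  qed
  obtain V1 where V1: "nhd V1" "\<forall>x\<in>V1. \<forall>y\<in>V1. fst (x, y) \<otimes> inv (snd (x, y)) \<in> U"
    using aux[of "\<lambda>z. fst z \<otimes> inv (snd z)",
        OF continuous_map_mult[OF continuous_map_fst continuous_map_inv[OF continuous_map_snd]]]
    by auto
  obtain V2 where V2: "nhd V2" "\<forall>x\<in>V2. \<forall>y\<in>V2. inv (fst (x, y)) \<otimes> snd (x, y) \<in> U"
    using aux[of "\<lambda>z. inv (fst z) \<otimes> snd z",
        OF continuous_map_mult[OF continuous_map_inv[OF continuous_map_fst] continuous_map_snd]]
    by auto
  show ?thesis
    by (rule that[of "V1 \<inter> V2"]) (use V1 V2 nhd_Int in auto)
qed

text \<open>The points \<open>k\<close> for which \<open>inv k \<otimes> g\<close> lies in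
  \<open>V\<close> form an open set containing \<open>g\<close>, which must meet a countable dense
  set; likewise on the other side.\<close>

lemma countable_translates:
  assumes "nhd V"
  obtains D where "countable D" "D \<subseteq> carrier G"
    "\<And>g. g \<in> carrier G \<Longrightarrow> \<exists>k\<in>D. inv k \<otimes> g \<in> V" "\<And>g. g \<in> carrier G \<Longrightarrow> \<exists>k\<in>D. g \<otimes> inv k \<in> V"
proof -
  obtain D where D: "D \<subseteq> carrier G" "countable D" "mtopology closure_of D = carrier G"
    using separable by blast
  have "\<exists>k\<in>D. f k \<in> V" if f: "continuous_map mtopology mtopology f" "g \<in> carrier G" "f g = \<one>" for f g
  proof -
    define S where "S = {x \<in> topspace mtopology. f x \<in> V}"
    have "openin mtopology S"
      unfolding S_def by (rule openin_continuous_map_preimage[OF f(1)]) (use assms in \<open>simp add: nhd_def\<close>)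
    moreover have "g \<in> S" using f assms by (simp add: nhd_def S_def)
    moreover have "g \<in> mtopology closure_of D" using D f by simp
    ultimately obtain k where "k \<in> D" "k \<in> S" unfolding in_closure_of by meson
    then show ?thesis unfolding S_def by blast
  qed note * = this
  have 1: "\<exists>k\<in>D. inv k \<otimes> g \<in> V" if "g \<in> carrier G" for g
    by (rule *[of _ g]) (use that in \<open>auto intro!: continuous_map_mult continuous_map_inv\<close>)
  have 2: "\<exists>k\<in>D. g \<otimes> inv k \<in> V" if "g \<in> carrier G" for g
    by (rule *[of _ g]) (use that in \<open>auto intro!: continuous_map_mult continuous_map_inv\<close>)
  show ?thesis by (rule that[OF D(2,1) 1 2])
qed

text \<open>Pigeonhole: countably many translates of a small neighbourhood cover the group, so two
  members of the family share a translate.\<close>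

lemma uncountable_close_pair:
  assumes "uncountable X" "\<And>i. i \<in> X \<Longrightarrow> c i \<in> carrier G" "nhd U"
  obtains i j where "i \<in> X" "j \<in> X" "i \<noteq> j" "c i \<otimes> inv (c j) \<in> U"
proof -
  obtain V where V: "nhd V" "\<And>x y. x \<in> V \<Longrightarrow> y \<in> V \<Longrightarrow> x \<otimes> inv y \<in> U"
    using nhd_div[OF assms(3)] by metis
  obtain D where D: "countable D" "D \<subseteq> carrier G" "\<And>g. g \<in> carrier G \<Longrightarrow> \<exists>k\<in>D. g \<otimes> inv k \<in> V"
    using countable_translates[OF V(1)] by metis
  define k where "k i = (SOME k. k \<in> D \<and> c i \<otimes> inv k \<in> V)" for i
  have k: "k i \<in> D" "c i \<otimes> inv (k i) \<in> V" if "i \<in> X" for i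
    using someI_ex[of "\<lambda>k. k \<in> D \<and> c i \<otimes> inv k \<in> V"] D(3)[OF assms(2)[OF that]]
    unfolding k_def by blast+
  have "\<not> inj_on k X"
    using assms(1) D(1) k(1) by (metis countable_image_inj_on countable_subset image_subsetI)
  then obtain i j where ij: "i \<in> X" "j \<in> X" "i \<noteq> j" "k i = k j"
    unfolding inj_on_def by blast
  have kc: "k j \<in> carrier G" using k ij D by blast
  have "(c i \<otimes> inv (k i)) \<otimes> inv (c j \<otimes> inv (k j)) \<in> U"
    using V(2) k ij by blast
  also have "(c i \<otimes> inv (k i)) \<otimes> inv (c j \<otimes> inv (k j)) = c i \<otimes> inv (c j)"
    using ij kc assms(2)[OF ij(1)] assms(2)[OF ij(2)]
    by (simp add: inv_mult_group m_assoc) (simp add: m_assoc[symmetric])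
  finally show ?thesis using ij that by blast
qed

text \<open>
  The solution \<open>x n\<close> is the limit of the truncations, in which \<open>x m\<close> is replaced by the identity for
  large \<open>m\<close>; these converge if each \<open>dd\<close> is small compared with the moduli of continuity of the
  finitely many words chosen before it.
\<close>

lemma solve_equations:
  fixes kk :: "'s \<Rightarrow> nat" and dd :: "'s \<Rightarrow> 'a" and R :: "'s list \<Rightarrow> 's \<Rightarrow> bool"
  assumes step: "\<And>h U. nhd U \<Longrightarrow> \<exists>s. R h s \<and> dd s \<in> U"
  obtains \<sigma> x where "\<And>n. R (map \<sigma> [0..<n]) (\<sigma> n)" "\<And>n. dd (\<sigma> n) \<in> carrier G"
    "\<And>n. x n \<in> carrier G" "\<And>n. x n = x (Suc n) [^] kk (\<sigma> n) \<otimes> dd (\<sigma> n)"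
proof -
  \<comment> \<open>\<open>E h y\<close> is the nested expression obtained from the equations in
    \<open>h\<close> when \<open>y\<close> stands for the unknown that follows the last of
    them.\<close>
  define F where "F s y = y [^] kk s \<otimes> dd s" for s y
  define E where "E h y = foldr F h y" for h y
  define good where "good h \<longleftrightarrow> (\<forall>s\<in>set h. dd s \<in> carrier G)" for h
  have Fc: "continuous_map mtopology mtopology (F s)" if "dd s \<in> carrier G" for s
    unfolding F_def using that by (intro continuous_map_mult continuous_map_pow) auto
  have Ec: "continuous_map mtopology mtopology (E h)" if "good h" for h
    using that
  proof (induction h)
    case (Cons s h)
    then have "continuous_map mtopology mtopology (F s \<circ> E h)"
      by (intro continuous_map_compose[OF _ Fc]) (auto simp: good_def)
    moreover have "E (s # h) = F s \<circ> E h" by (rule ext) (simp add: E_def)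
    ultimately show ?case by (simp only:)
  next
    case Nil
    have "E [] = id" by (rule ext) (simp add: E_def)
    then show ?case by simp
  qed
  have Ein: "E h y \<in> carrier G" if "good h" "y \<in> carrier G" for h y
    using continuous_map_image_subset_topspace[OF Ec[OF that(1)]] that(2) by auto
  \<comment> \<open>All suffixes \<open>drop i h\<close> are controlled at once, because each
    unknown \<open>x i\<close> is the limit of its own truncations starting at index
    \<open>i\<close>.\<close>
  define W where "W h = (\<Inter>i\<in>{..length h}. {y \<in> carrier G. d (E (drop i h) \<one>) (E (drop i h) y) < (1/2) ^ length h})" for h
  have W: "nhd (W h)" if "good h" for h
  proof -
    have "nhd {y \<in> carrier G. d (E (drop i h) \<one>) (E (drop i h) y) < (1/2) ^ length h}" for i
      by (rule nhd_ball[OF Ec]) (use that in \<open>auto simp: good_def dest: in_set_dropD\<close>)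
    then show ?thesis unfolding W_def nhd_def by (auto intro!: openin_Inter)
  qed
  have "\<exists>s. good h \<longrightarrow> R h s \<and> dd s \<in> W h" for h
    using step W by blast
  then obtain s where s: "\<And>h. good h \<Longrightarrow> R h (s h) \<and> dd (s h) \<in> W h" by metis
  define hist where "hist = rec_nat [] (\<lambda>n h. h @ [s h])"
  have hist_simps: "hist 0 = []" "hist (Suc n) = hist n @ [s (hist n)]" for n
    by (simp_all add: hist_def)
  define \<sigma> where "\<sigma> n = s (hist n)" for n
  have hist: "hist n = map \<sigma> [0..<n]" for n
    by (induction n) (simp_all add: hist_simps \<sigma>_def)
  have good: "good (hist n)" for n
  proof (induction n)
    case 0 show ?case by (simp add: hist_simps good_def)
  next
    case (Suc n)
    then have "dd (s (hist n)) \<in> carrier G" using s nhd_subset[OF W] by blast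
    then show ?case using Suc by (simp add: hist_simps good_def)
  qed
  have dd: "dd (\<sigma> n) \<in> carrier G" for n
    using s[OF good, of n] nhd_subset[OF W[OF good, of n]] by (auto simp: \<sigma>_def)
  have good': "good (map \<sigma> xs)" for xs using dd by (auto simp: good_def)
  define e where "e i n = E (map \<sigma> [i..<n]) \<one>" for i n
  have ein: "e i n \<in> carrier G" for i n unfolding e_def by (rule Ein[OF good']) simp
  have dist: "d (e i (Suc n)) (e i n) \<le> (1/2) ^ n" if "i \<le> n" for i n
  proof -
    have "dd (\<sigma> n) \<in> W (hist n)" using s[OF good] by (simp add: \<sigma>_def)
    then have "d (E (drop i (hist n)) \<one>) (E (drop i (hist n)) (dd (\<sigma> n))) < (1/2) ^ n"
      using that by (auto simp: W_def hist)
    moreover have "drop i (hist n) = map \<sigma> [i..<n]" by (simp add: hist drop_map)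
    \<comment> \<open>The innermost factor of the longer truncation is a power of the identity times
      \<open>dd (\<sigma> n)\<close>. Lengthening a truncation thus amounts to replacing the
      identity by \<open>dd (\<sigma> n)\<close> in the old expression.\<close>
    moreover have "e i (Suc n) = E (map \<sigma> [i..<n]) (dd (\<sigma> n))"
      using that dd by (simp add: e_def E_def F_def)
    ultimately show ?thesis by (simp add: e_def commute)
  qed
  have "\<exists>x. limitin mtopology (e i) x sequentially" for i
    using MCauchy_geometric[of "e i" i] dist ein mcomplete unfolding mcomplete_def by blast
  then obtain x where x: "\<And>i. limitin mtopology (e i) (x i) sequentially" by metis
  have xin: "x i \<in> carrier G" for i using x[of i] by (simp add: limitin_def)
  have eq: "x i = F (\<sigma> i) (x (Suc i))" for i
  proof -
    have "limitin mtopology (F (\<sigma> i) \<circ> e (Suc i)) (F (\<sigma> i) (x (Suc i))) sequentially"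
      by (rule continuous_map_limit[OF Fc[OF dd] x])
    moreover have "e i n = (F (\<sigma> i) \<circ> e (Suc i)) n" if "Suc i \<le> n" for n
      using that by (simp add: e_def E_def upt_conv_Cons)
    then have "eventually (\<lambda>n. e i n = (F (\<sigma> i) \<circ> e (Suc i)) n) sequentially"
      unfolding eventually_sequentially by blast
    ultimately have "limitin mtopology (e i) (F (\<sigma> i) (x (Suc i))) sequentially"
      using limitin_transform_eventually[of "F (\<sigma> i) \<circ> e (Suc i)" "e i"]
      by (simp add: eq_commute)
    then show ?thesis using x[of i] limitin_metric_unique by (metis trivial_limit_sequentially)
  qed
  have R: "R (map \<sigma> [0..<n]) (\<sigma> n)" for n
    using s[OF good, of n] by (simp add: \<sigma>_def hist[symmetric])
  show ?thesis by (rule that[OF R dd xin eq[unfolded F_def]])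
qed

end

section \<open>Uncountable independent families\<close>

text \<open>Every term of such a sequence is divisible by arbitrarily large factorials.\<close>

definition no_divisible :: "('b, 'm) monoid_scheme \<Rightarrow> bool" where
  "no_divisible Q \<longleftrightarrow> (\<forall>y N. (\<forall>m\<ge>N. y m \<in> carrier Q \<and> y m = y (Suc m) [^]\<^bsub>Q\<^esub> (fact m :: nat)) \<longrightarrow> y N = \<one>\<^bsub>Q\<^esub>)"

lemma no_divisibleD:
  assumes "no_divisible Q" "\<And>m. N \<le> m \<Longrightarrow> y m \<in> carrier Q" "\<And>m. N \<le> m \<Longrightarrow> y m = y (Suc m) [^]\<^bsub>Q\<^esub> (fact m :: nat)"
    and "N \<le> n"
  shows "y n = \<one>\<^bsub>Q\<^esub>"
  using assms unfolding no_divisible_def by (meson order_trans)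

text \<open>Unwinding the recursion makes \<open>y N\<close> divisible by \<open>fact M\<close> for
  every \<open>M \<ge> N\<close>, which is impossible for a nonzero integer.\<close>

lemma int_no_divisible:
  fixes y :: "nat \<Rightarrow> int"
  assumes "\<And>m. N \<le> m \<Longrightarrow> y m = fact m * y (Suc m)"
  shows "y N = 0"
proof (rule ccontr)
  assume ne: "y N \<noteq> 0"
  have dvd: "y M dvd y N" if "N \<le> M" for M
    using that
  proof (induction M rule: dec_induct)
    case (step M)
    then show ?case using assms[of M] by (metis dvd_mult_right)
  qed simp
  define M where "M = N + nat \<bar>y N\<bar> + 3"
  have "fact M dvd y N"
    using dvd[of M] assms[of M] by (metis M_def add.assoc dvd_mult_left le_add1)
  then have "fact M \<le> \<bar>y N\<bar>" using ne by (metis dvd_imp_le_int abs_of_nonneg fact_ge_zero)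
  moreover have "int M \<le> fact M" using fact_ge_self[of M] by (metis of_nat_fact of_nat_le_iff)
  ultimately show False by (simp add: M_def)
qed

text \<open>For \<open>n = 0\<close> these are the integers. Otherwise \<open>n\<close> divides
  \<open>fact m\<close> as soon as \<open>m \<ge> n\<close>, so late terms vanish and the recursion
  carries the zeros down to index \<open>N\<close>.\<close>

lemma no_divisible_integer_mod_group: "no_divisible (integer_mod_group n)"
  unfolding no_divisible_def
proof (intro allI impI)
  fix y :: "nat \<Rightarrow> int" and N :: nat
  assume y: "\<forall>m\<ge>N. y m \<in> carrier (integer_mod_group n) \<and>
    y m = y (Suc m) [^]\<^bsub>integer_mod_group n\<^esub> (fact m :: nat)"
  then have eq: "y m = (fact m * y (Suc m)) mod int n" if "N \<le> m" for m
    using that pow_integer_mod_group[of n "y (Suc m)" "fact m"] by (metis of_nat_fact)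
  have "y N = 0"
  proof (cases "n = 0")
    case True
    have "y m = fact m * y (Suc m)" if "N \<le> m" for m
      using eq[OF that] True by simp
    then show ?thesis by (rule int_no_divisible)
  next
    case False
    have high: "y m = 0" if "n \<le> m" "N \<le> m" for m
    proof -
      have "int n dvd fact m" using that False
        by (metis dvd_fact int_dvd_int_iff less_one linorder_not_le of_nat_fact)
      then show ?thesis using eq[OF that(2)] by simp
    qed
    have "N \<le> m \<Longrightarrow> y m = 0" if "m \<le> N + n" for m
      using that
    proof (induction m rule: inc_induct)
      case base then show ?case using high[of "N + n"] by simp
    next
      case (step m) then show ?case using eq[of m] by simp
    qed
    then show ?thesis by simp
  qed
  then show "y N = \<one>\<^bsub>integer_mod_group n\<^esub>" by simp
qed

lemma nat_pow_DirProd: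
  "x [^]\<^bsub>A \<times>\<times> B\<^esub> (n::nat) = (fst x [^]\<^bsub>A\<^esub> n, snd x [^]\<^bsub>B\<^esub> n)"
  by (induction n) (simp_all add: nat_pow_def mult_DirProd' split: prod.splits)

lemma no_divisible_DirProd:
  assumes "no_divisible A" "no_divisible B"
  shows "no_divisible (A \<times>\<times> B)"
  unfolding no_divisible_def
proof (intro allI impI)
  fix y N
  assume y: "\<forall>m\<ge>N. y m \<in> carrier (A \<times>\<times> B) \<and> y m = y (Suc m) [^]\<^bsub>A \<times>\<times> B\<^esub> (fact m :: nat)"
  have eq: "fst (y m) = fst (y (Suc m)) [^]\<^bsub>A\<^esub> (fact m :: nat)"
    "snd (y m) = snd (y (Suc m)) [^]\<^bsub>B\<^esub> (fact m :: nat)" if "N \<le> m" for m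
    using y that nat_pow_DirProd[of A B "y (Suc m)" "fact m"] by (metis fst_conv, metis snd_conv)
  have carrier: "fst (y m) \<in> carrier A" "snd (y m) \<in> carrier B" if "N \<le> m" for m
    using y that unfolding DirProd_def by (metis mem_Times_iff partial_object.select_convs(1))+
  have "fst (y N) = \<one>\<^bsub>A\<^esub>"
    by (rule no_divisibleD[OF assms(1), where y = "\<lambda>m. fst (y m)" and N = N])
      (fact carrier eq order_refl)+
  moreover have "snd (y N) = \<one>\<^bsub>B\<^esub>"
    by (rule no_divisibleD[OF assms(2), where y = "\<lambda>m. snd (y m)" and N = N])
      (fact carrier eq order_refl)+
  ultimately show "y N = \<one>\<^bsub>A \<times>\<times> B\<^esub>" by (simp add: prod_eq_iff)
qed

text \<open>The unrestricted wreath product of the integers by \<open>C\<close>: integer functions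
  on \<open>C\<close>, without any condition on the support, extended by \<open>C\<close> acting
  through translations. Functions are extensional so that each element has a single
  representative.\<close>

definition int_wreath :: "('c, 'm) monoid_scheme \<Rightarrow> (('c \<Rightarrow> int) \<times> 'c) monoid" where
  "int_wreath C =
    \<lparr>carrier = (carrier C \<rightarrow>\<^sub>E UNIV) \<times> carrier C,
     monoid.mult = (\<lambda>(f, c) (g, d). (\<lambda>x\<in>carrier C. f x + g (inv\<^bsub>C\<^esub> c \<otimes>\<^bsub>C\<^esub> x), c \<otimes>\<^bsub>C\<^esub> d)),
     monoid.one = (\<lambda>x\<in>carrier C. 0, \<one>\<^bsub>C\<^esub>)\<rparr>"

section \<open>Wreath products of the integers\<close>

context group
begin

lemma int_wreath_simps:
  "(f, c) \<in> carrier (int_wreath G) \<longleftrightarrow> f \<in> extensional (carrier G) \<and> c \<in> carrier G"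
  "(f, c) \<otimes>\<^bsub>int_wreath G\<^esub> (g, e) = (\<lambda>x\<in>carrier G. f x + g (inv c \<otimes> x), c \<otimes> e)"
  "\<one>\<^bsub>int_wreath G\<^esub> = (\<lambda>x\<in>carrier G. 0, \<one>)"
  by (auto simp: int_wreath_def PiE_def)

lemma group_int_wreath: "group (int_wreath G)"
proof (rule groupI)
  show "x \<otimes>\<^bsub>int_wreath G\<^esub> y \<in> carrier (int_wreath G)"
    if "x \<in> carrier (int_wreath G)" "y \<in> carrier (int_wreath G)" for x y
    using that by (cases x, cases y) (auto simp: int_wreath_simps)
  show "\<one>\<^bsub>int_wreath G\<^esub> \<in> carrier (int_wreath G)" by (simp add: int_wreath_simps)
  show "x \<otimes>\<^bsub>int_wreath G\<^esub> y \<otimes>\<^bsub>int_wreath G\<^esub> z = x \<otimes>\<^bsub>int_wreath G\<^esub> (y \<otimes>\<^bsub>int_wreath G\<^esub> z)"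
    if "x \<in> carrier (int_wreath G)" "y \<in> carrier (int_wreath G)" "z \<in> carrier (int_wreath G)" for x y z
    using that
    by (cases x, cases y, cases z) (auto simp: int_wreath_simps m_assoc inv_mult_group intro!: restrict_ext)
  show "\<one>\<^bsub>int_wreath G\<^esub> \<otimes>\<^bsub>int_wreath G\<^esub> x = x" if "x \<in> carrier (int_wreath G)" for x
  proof -
    obtain f c where x: "x = (f, c)" "f \<in> extensional (carrier G)" "c \<in> carrier G"
      using \<open>x \<in> carrier (int_wreath G)\<close> by (cases x) (auto simp: int_wreath_simps)
    have "(\<lambda>x\<in>carrier G. (\<lambda>x\<in>carrier G. 0) x + f (inv \<one> \<otimes> x)) = f"
      using x(2) by (intro extensionalityI[of _ "carrier G"]) auto
    then show ?thesis using x by (simp add: int_wreath_simps)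
  qed
  show "\<exists>y\<in>carrier (int_wreath G). y \<otimes>\<^bsub>int_wreath G\<^esub> x = \<one>\<^bsub>int_wreath G\<^esub>"
    if "x \<in> carrier (int_wreath G)" for x
  proof -
    obtain f c where x: "x = (f, c)" "f \<in> extensional (carrier G)" "c \<in> carrier G"
      using \<open>x \<in> carrier (int_wreath G)\<close> by (cases x) (auto simp: int_wreath_simps)
    show ?thesis
      by (rule bexI[of _ "(\<lambda>x\<in>carrier G. - f (c \<otimes> x), inv c)"])
        (use x in \<open>auto simp: int_wreath_simps intro!: restrict_ext\<close>)
  qed
qed

lemma snd_pow_int_wreath: "snd (x [^]\<^bsub>int_wreath G\<^esub> (n::nat)) = snd x [^] n"
proof -
  interpret W: group "int_wreath G" by (rule group_int_wreath)
  have "snd (a \<otimes>\<^bsub>int_wreath G\<^esub> b) = snd a \<otimes> snd b" for a b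
    by (cases a, cases b) (simp add: int_wreath_simps)
  then show ?thesis by (induction n) (simp_all add: int_wreath_simps)
qed

lemma pow_int_wreath:
  assumes "f \<in> extensional (carrier G)"
  shows "(f, \<one>) [^]\<^bsub>int_wreath G\<^esub> (n::nat) = (\<lambda>x\<in>carrier G. int n * f x, \<one>)"
proof (induction n)
  case (Suc n)
  interpret W: group "int_wreath G" by (rule group_int_wreath)
  show ?case using Suc
    by (auto simp: int_wreath_simps algebra_simps intro!: restrict_ext)
qed (simp add: int_wreath_simps nat_pow_def restrict_def)

text \<open>The second coordinates form a sequence of the same kind in the group itself, hence are
  trivial. On such elements powers multiply the function pointwise, and the case of the integers
  applies at every point.\<close>

lemma no_divisible_int_wreath:
  assumes "no_divisible G"
  shows "no_divisible (int_wreath G)"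
  unfolding no_divisible_def
proof (intro allI impI)
  fix y N
  assume y: "\<forall>m\<ge>N. y m \<in> carrier (int_wreath G) \<and>
    y m = y (Suc m) [^]\<^bsub>int_wreath G\<^esub> (fact m :: nat)"
  have snd: "snd (y m) = \<one>" if "N \<le> m" for m
  proof (rule no_divisibleD[OF assms, where N = N])
    show "snd (y k) \<in> carrier G" if "N \<le> k" for k
      using y that by (metis int_wreath_simps(1) prod.collapse)
    show "snd (y k) = snd (y (Suc k)) [^] (fact k :: nat)" if "N \<le> k" for k
      using y that snd_pow_int_wreath by metis
  qed (rule that)
  have ext: "fst (y m) \<in> extensional (carrier G)" if "N \<le> m" for m
    using y that by (metis int_wreath_simps(1) prod.collapse)
  have fst: "fst (y m) x = fact m * fst (y (Suc m)) x" if "N \<le> m" "x \<in> carrier G" for m x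
  proof -
    have "y m = (fst (y (Suc m)), \<one>) [^]\<^bsub>int_wreath G\<^esub> (fact m :: nat)"
      using y that snd[of "Suc m"] by (metis le_Suc_eq prod.collapse)
    then have "y m = (\<lambda>x\<in>carrier G. int (fact m) * fst (y (Suc m)) x, \<one>)"
      using pow_int_wreath[OF ext[of "Suc m"]] that by simp
    then have "fst (y m) x = int (fact m) * fst (y (Suc m)) x" using that(2)
      by (metis fst_conv restrict_apply')
    then show ?thesis by simp
  qed
  have "fst (y N) x = 0" if "x \<in> carrier G" for x
    by (rule int_no_divisible[of N "\<lambda>m. fst (y m) x"]) (rule fst[OF _ that])
  then have "fst (y N) = (\<lambda>x\<in>carrier G. 0)"
    using ext[of N] by (intro extensionalityI[of _ "carrier G"]) auto
  then show "y N = \<one>\<^bsub>int_wreath G\<^esub>" using snd[of N] by (simp add: int_wreath_simps prod_eq_iff)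
qed

lemma conjugate_pow:
  assumes "x \<in> carrier G" "m \<in> carrier G"
  shows "(m \<otimes> x \<otimes> inv m) [^] (n::nat) = m \<otimes> x [^] n \<otimes> inv m"
proof (induction n)
  case (Suc n)
  have "m \<otimes> x [^] n \<otimes> inv m \<otimes> (m \<otimes> x \<otimes> inv m) = m \<otimes> x [^] n \<otimes> (inv m \<otimes> m) \<otimes> x \<otimes> inv m"
    using assms by (simp only: m_assoc m_closed inv_closed nat_pow_closed)
  also have "\<dots> = m \<otimes> x [^] Suc n \<otimes> inv m" using assms by (simp add: m_assoc)
  finally show ?case using Suc by simp
qed (use assms in simp)

end

text \<open>The equations have exponents \<open>fact n\<close> and coefficients
  \<open>c i \<otimes> inv (c j)\<close> with fresh indices. Under \<open>\<rho> (i n)\<close> only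
  the \<open>n\<close>-th coefficient survives. The unknowns after it satisfy a system without
  coefficients and are trivial, so \<open>x n\<close> maps to the image of \<open>c (i n)\<close>,
  and descending to \<open>x 0\<close> only takes positive powers. Thus \<open>x 0\<close> violates
  \<open>fin\<close>, as the \<open>i n\<close> are distinct.\<close>

lemma (in polish_grp) no_uncountable_independent_family:
  fixes c :: "'i \<Rightarrow> 'a" and Q :: "'i \<Rightarrow> ('q, 'm) monoid_scheme"
  assumes "uncountable I" and c: "\<And>i. i \<in> I \<Longrightarrow> c i \<in> carrier G"
    and Q: "\<And>i. i \<in> I \<Longrightarrow> group (Q i)" "\<And>i. i \<in> I \<Longrightarrow> no_divisible (Q i)"
    and \<rho>: "\<And>i. i \<in> I \<Longrightarrow> \<rho> i \<in> hom G (Q i)"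
    and kill: "\<And>i j. i \<in> I \<Longrightarrow> j \<in> I \<Longrightarrow> i \<noteq> j \<Longrightarrow> \<rho> i (c j) = \<one>\<^bsub>Q i\<^esub>"
    and fin: "\<And>g. g \<in> carrier G \<Longrightarrow> finite {i \<in> I. \<exists>k::nat\<ge>1. \<rho> i g = \<rho> i (c i) [^]\<^bsub>Q i\<^esub> k}"
  shows False
proof -
  define old :: "(nat \<times> 'i \<times> 'i) list \<Rightarrow> 'i set" where "old h = (fst \<circ> snd) ` set h \<union> (snd \<circ> snd) ` set h" for h
  \<comment> \<open>The position is stored in the step itself: the exponent \<open>kk\<close>
    depends on the step alone and has to be the factorial of the position.\<close>
  define R where "R h s \<longleftrightarrow> (case s of (n, i, j) \<Rightarrow> n = length h \<and> i \<in> I - old h \<and> j \<in> I - old h \<and> i \<noteq> j)" for h s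
  define dd where "dd = (\<lambda>(n :: nat, i, j). c i \<otimes> inv (c j))"
  define kk :: "nat \<times> 'i \<times> 'i \<Rightarrow> nat" where "kk = (\<lambda>(n, i, j). fact n)"
  have "\<exists>s. R h s \<and> dd s \<in> U" if "nhd U" for h U
  proof -
    have "finite (old h)" by (simp add: old_def)
    then have "uncountable (I - old h)" using assms(1) by (simp add: uncountable_minus_countable countable_finite)
    moreover have "c i \<in> carrier G" if "i \<in> I - old h" for i using c that by blast
    ultimately obtain i j where "i \<in> I - old h" "j \<in> I - old h" "i \<noteq> j" "c i \<otimes> inv (c j) \<in> U"
      by (rule uncountable_close_pair[OF _ _ \<open>nhd U\<close>])
    then show ?thesis by (intro exI[of _ "(length h, i, j)"]) (auto simp: R_def dd_def)
  qed
  then obtain \<sigma> x where \<sigma>: "\<And>n. R (map \<sigma> [0..<n]) (\<sigma> n)" and x: "\<And>n. x n \<in> carrier G"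
    and eq: "\<And>n. x n = x (Suc n) [^] kk (\<sigma> n) \<otimes> dd (\<sigma> n)"
    using solve_equations[of R dd kk] by metis
  define i where "i n = fst (snd (\<sigma> n))" for n
  define j where "j n = snd (snd (\<sigma> n))" for n
  have \<sigma>_eq: "\<sigma> n = (n, i n, j n)" for n
    using \<sigma>[of n] by (auto simp: R_def i_def j_def split: prod.splits)
  have I: "i n \<in> I" "j n \<in> I" "i n \<noteq> j n" for n
    using \<sigma>[of n] by (auto simp: R_def \<sigma>_eq)
  have new: "i n \<noteq> i m" "i n \<noteq> j m" "j n \<noteq> i m" if "m < n" for m n
  proof -
    have "old (map \<sigma> [0..<n]) = i ` {..<n} \<union> j ` {..<n}"
      by (simp add: old_def i_def j_def image_image lessThan_atLeast0)
    then show "i n \<noteq> i m" "i n \<noteq> j m" "j n \<noteq> i m"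
      using \<sigma>[of n] that unfolding R_def \<sigma>_eq[of n] by auto
  qed
  have "\<exists>k::nat\<ge>1. \<rho> (i n) (x 0) = \<rho> (i n) (c (i n)) [^]\<^bsub>Q (i n)\<^esub> k" for n
  proof -
    interpret Qn: group "Q (i n)" by (rule Q(1)[OF I(1)])
    interpret h: group_hom G "Q (i n)" "\<rho> (i n)"
      by unfold_locales (rule \<rho>[OF I(1)])
    define y where "y m = \<rho> (i n) (x m)" for m
    have yin: "y m \<in> carrier (Q (i n))" for m using x by (simp add: y_def)
    have rec: "y m = y (Suc m) [^]\<^bsub>Q (i n)\<^esub> (fact m :: nat) \<otimes>\<^bsub>Q (i n)\<^esub> (\<rho> (i n) (c (i m)) \<otimes>\<^bsub>Q (i n)\<^esub> inv\<^bsub>Q (i n)\<^esub> \<rho> (i n) (c (j m)))" for m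
    proof -
      have "y m = \<rho> (i n) (x (Suc m) [^] kk (\<sigma> m) \<otimes> dd (\<sigma> m))"
        unfolding y_def by (rule arg_cong[OF eq])
      then show ?thesis using x c I by (simp add: y_def kk_def dd_def \<sigma>_eq h.hom_nat_pow)
    qed
    have other: "y m = y (Suc m) [^]\<^bsub>Q (i n)\<^esub> (fact m :: nat)" if "m \<noteq> n" for m
    proof -
      have "i n \<noteq> i m" "i n \<noteq> j m"
        using new[of m n] new[of n m] that by (metis linorder_neqE_nat)+
      then show ?thesis using rec[of m] kill I yin[of "Suc m"] by simp
    qed
    \<comment> \<open>Beyond position \<open>n\<close> no coefficient is visible any more, so the
      tail is divisible by all later factorials.\<close>
    have "y (Suc n) = \<one>\<^bsub>Q (i n)\<^esub>"
    proof (rule no_divisibleD[OF Q(2)[OF I(1)[of n]], where N = "Suc n" and y = y])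
      show "y m = y (Suc m) [^]\<^bsub>Q (i n)\<^esub> (fact m :: nat)" if "Suc n \<le> m" for m
        by (rule other) (use that in simp)
    qed (simp_all add: yin)
    then have yn: "y n = \<rho> (i n) (c (i n))"
      using rec[of n] kill[of "i n" "j n"] I c by simp
    have "\<exists>k::nat\<ge>1. y m = \<rho> (i n) (c (i n)) [^]\<^bsub>Q (i n)\<^esub> k" if "m \<le> n" for m
      using that
    proof (induction m rule: inc_induct)
      case base
      have "\<rho> (i n) (c (i n)) \<in> carrier (Q (i n))" using c I by simp
      then have "y n = \<rho> (i n) (c (i n)) [^]\<^bsub>Q (i n)\<^esub> (1::nat)" using yn by simp
      then show ?case by blast
    next
      case (step m)
      then obtain k where k: "1 \<le> k" "y (Suc m) = \<rho> (i n) (c (i n)) [^]\<^bsub>Q (i n)\<^esub> (k::nat)" by blast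
      then have "y m = \<rho> (i n) (c (i n)) [^]\<^bsub>Q (i n)\<^esub> (k * fact m)"
        using other[of m] step c I by (simp add: Qn.nat_pow_pow)
      moreover have "1 \<le> k * fact m" using k(1) fact_ge_1[of m] by (metis mult_le_mono nat_mult_1)
      ultimately show ?case by blast
    qed
    then show ?thesis by (simp add: y_def)
  qed
  then have "range i \<subseteq> {i \<in> I. \<exists>k::nat\<ge>1. \<rho> i (x 0) = \<rho> i (c i) [^]\<^bsub>Q i\<^esub> k}"
    using I by blast
  then have "finite (range i)" using fin[OF x] finite_subset by blast
  moreover have "inj i" by (rule linorder_injI) (metis new(1))
  ultimately show False using finite_imageD by blast
qed

section \<open>Homomorphisms out of graph products\<close>

definition eval_word :: "('b, 'm) monoid_scheme \<Rightarrow> ('a \<Rightarrow> 'b) \<Rightarrow> 'a word \<Rightarrow> 'b" where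
  "eval_word H f w = foldr (\<lambda>(v, b) x. (if b then f v else inv\<^bsub>H\<^esub> f v) \<otimes>\<^bsub>H\<^esub> x) w \<one>\<^bsub>H\<^esub>"

lemma eval_word_simps [simp]:
  "eval_word H f [] = \<one>\<^bsub>H\<^esub>"
  "eval_word H f ((v, b) # w) = (if b then f v else inv\<^bsub>H\<^esub> f v) \<otimes>\<^bsub>H\<^esub> eval_word H f w"
  by (simp_all add: eval_word_def)

lemma words_simps [simp]:
  "[] \<in> words S"
  "x # w \<in> words S \<longleftrightarrow> fst x \<in> S \<and> w \<in> words S"
  "u @ v \<in> words S \<longleftrightarrow> u \<in> words S \<and> v \<in> words S"
  by (auto simp: words_def mem_Times_iff)

lemma words_iff: "w \<in> words S \<longleftrightarrow> fst ` set w \<subseteq> S"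
  by (induction w) auto

context group
begin

lemma eval_word_closed [simp]:
  "f \<in> S \<rightarrow> carrier G \<Longrightarrow> w \<in> words S \<Longrightarrow> eval_word G f w \<in> carrier G"
  by (induction w) (auto simp: Pi_iff)

lemma eval_word_append:
  "f \<in> S \<rightarrow> carrier G \<Longrightarrow> u \<in> words S \<Longrightarrow> v \<in> words S \<Longrightarrow>
    eval_word G f (u @ v) = eval_word G f u \<otimes> eval_word G f v"
  by (induction u) (auto simp: m_assoc Pi_iff)

lemma eval_word_replicate:
  assumes "f v \<in> carrier G"
  shows "eval_word G f (replicate n (v, True)) = f v [^] n"
proof (induction n)
  case (Suc n)
  then have "eval_word G f (replicate (Suc n) (v, True)) = f v \<otimes> f v [^] n" by simp
  also have "\<dots> = f v [^] Suc n" using nat_pow_Suc2[OF assms] by metis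
  finally show ?case .
qed simp

lemma eval_word_pres_rel:
  assumes f: "f \<in> S \<rightarrow> carrier G"
    and R: "\<And>u v. (u, v) \<in> R \<Longrightarrow> u \<in> words S \<Longrightarrow> v \<in> words S \<Longrightarrow> eval_word G f u = eval_word G f v"
    and uv: "(u, v) \<in> pres_rel S R"
  shows "eval_word G f u = eval_word G f v"
  using uv
proof (induction rule: pres_rel.induct)
  case (append u u' v v')
  then show ?case using f pres_rel_words by (metis eval_word_append)
next
  case (cancel x b)
  then have "f x \<in> carrier G" using f by auto
  then show ?case by simp
qed (use R in auto)

text \<open>The universal property of a presentation. The value at a class is read off from an
  arbitrarily chosen representative, which \<open>eval_word_pres_rel\<close> makes harmless.\<close>

lemma presented_group_hom:
  assumes f: "f \<in> S \<rightarrow> carrier G"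
    and R: "\<And>u v. (u, v) \<in> R \<Longrightarrow> u \<in> words S \<Longrightarrow> v \<in> words S \<Longrightarrow> eval_word G f u = eval_word G f v"
  obtains \<phi> where "\<phi> \<in> hom (presented_group S R) G"
    "\<And>w. w \<in> words S \<Longrightarrow> \<phi> (pres_rel S R `` {w}) = eval_word G f w"
proof -
  define \<phi> where "\<phi> X = eval_word G f (SOME w. w \<in> X)" for X
  have \<phi>: "\<phi> (pres_rel S R `` {w}) = eval_word G f w" if "w \<in> words S" for w
  proof -
    have "(SOME u. u \<in> pres_rel S R `` {w}) \<in> pres_rel S R `` {w}"
      using pres_rel.refl[OF that] by (metis Image_singleton_iff someI)
    then have "(w, SOME u. u \<in> pres_rel S R `` {w}) \<in> pres_rel S R" by blast
    then show ?thesis unfolding \<phi>_def using eval_word_pres_rel[OF f R] by metis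
  qed
  have "\<phi> \<in> hom (presented_group S R) G"
  proof (rule homI)
    fix X Y assume "X \<in> carrier (presented_group S R)" "Y \<in> carrier (presented_group S R)"
    then obtain u v where "u \<in> words S" "X = pres_rel S R `` {u}" "v \<in> words S" "Y = pres_rel S R `` {v}"
      by (auto simp: presented_group_def quotient_def)
    then show "\<phi> X \<in> carrier G" "\<phi> (X \<otimes>\<^bsub>presented_group S R\<^esub> Y) = \<phi> X \<otimes> \<phi> Y"
      using \<phi> f by (simp_all add: presented_group_mult_class eval_word_append)
  qed
  then show ?thesis using \<phi> that by blast
qed

end

definition gp_class :: "'v set \<Rightarrow> 'v rel \<Rightarrow> ('v \<Rightarrow> enat) \<Rightarrow> 'v word \<Rightarrow> 'v word set" where
  "gp_class V E p w = pres_rel V (graph_product_relations V E p) `` {w}"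

text \<open>The value \<open>0\<close> encodes the colour \<open>\<infinity>\<close>.\<close>

definition color_order :: "enat \<Rightarrow> nat" where
  "color_order c = (case c of enat n \<Rightarrow> n | \<infinity> \<Rightarrow> 0)"

lemma color_order_simps [simp]: "color_order (enat n) = n" "color_order \<infinity> = 0"
  by (simp_all add: color_order_def)

lemma color_order_neq_1: "c \<in> colors \<Longrightarrow> color_order c \<noteq> 1"
  by (auto simp: colors_def dest: prime_gt_1_nat)

definition exp_sum :: "'v \<Rightarrow> 'v word \<Rightarrow> int" where
  "exp_sum a w = (\<Sum>(v, b)\<leftarrow>w. if v = a then (if b then 1 else -1) else 0)"

lemma exp_sum_simps [simp]:
  "exp_sum a [] = 0"
  "exp_sum a ((v, b) # w) = (if v = a then (if b then 1 else -1) else 0) + exp_sum a w"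
  "exp_sum a (u @ w) = exp_sum a u + exp_sum a w"
  by (simp_all add: exp_sum_def)

lemma exp_sum_eq_0: "a \<notin> fst ` set w \<Longrightarrow> exp_sum a w = 0"
  by (induction w) auto

locale colored_graph =
  fixes V :: "'v set" and E :: "'v rel" and p :: "'v \<Rightarrow> enat"
  assumes graph: "simple_graph V E" and colors: "p \<in> V \<rightarrow> colors"
begin

abbreviation "GP \<equiv> graph_product V E p"

abbreviation "cls \<equiv> gp_class V E p"

abbreviation "gen v \<equiv> cls [(v, True)]"

abbreviation "ord v \<equiv> color_order (p v)"

sublocale GP: group GP
  unfolding graph_product_def by (rule group_presented_group)

lemma edge_V: "(b, c) \<in> E \<Longrightarrow> b \<in> V \<and> c \<in> V"
  using graph by (auto simp: simple_graph_def)

lemma carrier_GP: "carrier GP = cls ` words V"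
  by (auto simp: graph_product_def presented_group_def quotient_def gp_class_def)

lemma cls_closed [simp]: "w \<in> words V \<Longrightarrow> cls w \<in> carrier GP"
  by (simp add: carrier_GP)

lemma GP_cases:
  assumes "g \<in> carrier GP"
  obtains w where "w \<in> words V" "g = cls w"
  using assms by (auto simp: carrier_GP)

lemma cls_append: "u \<in> words V \<Longrightarrow> v \<in> words V \<Longrightarrow> cls (u @ v) = cls u \<otimes>\<^bsub>GP\<^esub> cls v"
  by (simp add: graph_product_def gp_class_def presented_group_mult_class)

lemma cls_Nil: "cls [] = \<one>\<^bsub>GP\<^esub>"
  by (simp add: graph_product_def gp_class_def presented_group_def)

lemma cls_eqI: "(u, v) \<in> pres_rel V (graph_product_relations V E p) \<Longrightarrow> cls u = cls v"
  unfolding gp_class_def by (rule equiv_class_eq[OF equiv_pres_rel])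

lemma cls_eqD: "cls u = cls v \<Longrightarrow> v \<in> words V \<Longrightarrow> (u, v) \<in> pres_rel V (graph_product_relations V E p)"
  unfolding gp_class_def using eq_equiv_class[OF _ equiv_pres_rel] by blast

lemma cls_False: "v \<in> V \<Longrightarrow> cls [(v, False)] = inv\<^bsub>GP\<^esub> gen v"
proof -
  assume v: "v \<in> V"
  have "cls ([(v, False)] @ [(v, True)]) = cls []"
    by (rule cls_eqI) (use pres_rel.cancel[OF v, of False] in simp)
  then have "cls [(v, False)] \<otimes>\<^bsub>GP\<^esub> gen v = \<one>\<^bsub>GP\<^esub>"
    using v by (subst (asm) cls_append) (simp_all add: cls_Nil)
  then show ?thesis using GP.inv_equality v by simp
qed

lemma cls_Cons:
  "v \<in> V \<Longrightarrow> w \<in> words V \<Longrightarrow> cls ((v, b) # w) = (if b then gen v else inv\<^bsub>GP\<^esub> gen v) \<otimes>\<^bsub>GP\<^esub> cls w"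
  using cls_append[of "[(v, b)]" w] cls_False by (cases b) auto

lemma gen_commute:
  assumes "(b, c) \<in> E"
  shows "gen b \<otimes>\<^bsub>GP\<^esub> gen c = gen c \<otimes>\<^bsub>GP\<^esub> gen b"
proof -
  have bc: "b \<in> V" "c \<in> V" using edge_V assms by auto
  have "([(b, True), (c, True)], [(c, True), (b, True)]) \<in> pres_rel V (graph_product_relations V E p)"
    by (rule pres_rel.defining) (use assms bc in \<open>auto simp: graph_product_relations_def\<close>)
  then have "cls ([(b, True)] @ [(c, True)]) = cls ([(c, True)] @ [(b, True)])"
    using cls_eqI by simp
  then show ?thesis using bc by (subst (asm) (1 2) cls_append) auto
qed

lemma cls_replicate:
  assumes "v \<in> V"
  shows "cls (replicate n (v, True)) = gen v [^]\<^bsub>GP\<^esub> n"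
proof (induction n)
  case (Suc n)
  have "replicate n (v, True) \<in> words V" using assms by (auto simp: words_iff)
  then have "cls (replicate (Suc n) (v, True)) = gen v \<otimes>\<^bsub>GP\<^esub> gen v [^]\<^bsub>GP\<^esub> n"
    using Suc assms cls_Cons[of v "replicate n (v, True)" True] by simp
  also have "\<dots> = gen v [^]\<^bsub>GP\<^esub> Suc n" using GP.nat_pow_Suc2[of "gen v" n] assms by simp
  finally show ?case .
qed (simp add: cls_Nil)

lemma gen_pow_ord:
  assumes "v \<in> V"
  shows "gen v [^]\<^bsub>GP\<^esub> ord v = \<one>\<^bsub>GP\<^esub>"
proof (cases "p v")
  case (enat n)
  have "(replicate n (v, True), []) \<in> pres_rel V (graph_product_relations V E p)"
    by (rule pres_rel.defining) (use assms enat in \<open>auto simp: graph_product_relations_def words_iff\<close>)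
  then have "cls (replicate n (v, True)) = \<one>\<^bsub>GP\<^esub>" using cls_eqI cls_Nil by metis
  then show ?thesis using assms cls_replicate enat by simp
qed simp

text \<open>The universal property of the graph product. For a letter of colour
  \<open>\<infinity>\<close> the power condition has exponent \<open>0\<close> and is
  automatic.\<close>

lemma GP_hom:
  assumes H: "group H" and f: "f \<in> V \<rightarrow> carrier H"
    and ord: "\<And>v. v \<in> V \<Longrightarrow> f v [^]\<^bsub>H\<^esub> ord v = \<one>\<^bsub>H\<^esub>"
    and comm: "\<And>b c. (b, c) \<in> E \<Longrightarrow> f b \<otimes>\<^bsub>H\<^esub> f c = f c \<otimes>\<^bsub>H\<^esub> f b"
  obtains \<phi> where "\<phi> \<in> hom GP H" "\<And>w. w \<in> words V \<Longrightarrow> \<phi> (cls w) = eval_word H f w"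
proof -
  interpret H: group H by (rule H)
  have ev: "eval_word H f u = eval_word H f v" if "(u, v) \<in> graph_product_relations V E p" for u v
  proof -
    from that consider a n where "u = replicate n (a, True)" "v = []" "a \<in> V" "p a = enat n"
      | b c where "u = [(b, True), (c, True)]" "v = [(c, True), (b, True)]" "(b, c) \<in> E"
      unfolding graph_product_relations_def by blast
    then show ?thesis
    proof cases
      case 1
      have "f a \<in> carrier H" using f 1 by auto
      then show ?thesis using ord[of a] 1 H.eval_word_replicate[of f a n] by simp
    next
      case 2
      have "f b \<in> carrier H" "f c \<in> carrier H" using f edge_V 2 by auto
      then show ?thesis using comm 2 by simp
    qed
  qed
  show ?thesis
    by (rule H.presented_group_hom[OF f ev]) (assumption, rule that, simp_all add: graph_product_def gp_class_def)
qed

text \<open>All letters other than \<open>a\<close> are sent to the identity; the commutation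
  relations hold because the target is commutative.\<close>

lemma exponent_hom:
  assumes a: "a \<in> V"
  obtains \<theta> where "\<theta> \<in> hom GP (integer_mod_group (ord a))"
    "\<And>w. w \<in> words V \<Longrightarrow> \<theta> (cls w) = exp_sum a w mod int (ord a)"
proof -
  let ?Z = "integer_mod_group (ord a)"
  interpret Z: comm_group ?Z by simp
  define f where "f v = (if v = a then 1 else 0 :: int)" for v
  \<comment> \<open>Order \<open>1\<close> is the only one for which \<open>1\<close> would fail to
    be a canonical residue; order \<open>0\<close> gives all integers.\<close>
  have ne: "ord a \<noteq> 1" using colors a color_order_neq_1 by auto
  have f: "f \<in> V \<rightarrow> carrier ?Z" using ne by (auto simp: f_def)
  obtain \<theta> where \<theta>: "\<theta> \<in> hom GP ?Z" "\<And>w. w \<in> words V \<Longrightarrow> \<theta> (cls w) = eval_word ?Z f w"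
  proof (rule GP_hom[of ?Z f])
    show "f v [^]\<^bsub>?Z\<^esub> ord v = \<one>\<^bsub>?Z\<^esub>" if "v \<in> V" for v
      by (simp add: f_def)
    show "f b \<otimes>\<^bsub>?Z\<^esub> f c = f c \<otimes>\<^bsub>?Z\<^esub> f b" for b c
      by (simp add: add.commute)
  qed (use f in simp_all)
  have "eval_word ?Z f w = exp_sum a w mod int (ord a)" if "w \<in> words V" for w
    using that
  proof (induction w)
    case (Cons x w)
    obtain v b where x: "x = (v, b)" by (cases x)
    have inv: "inv\<^bsub>?Z\<^esub> f v = (- f v) mod int (ord a)"
      by (rule inv_integer_mod_group) (use f Cons.prems x in auto)
    have "eval_word ?Z f (x # w) =
        ((if b then f v else (- f v) mod int (ord a)) + exp_sum a w mod int (ord a)) mod int (ord a)"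
      using Cons by (simp add: x inv)
    also have "\<dots> = exp_sum a (x # w) mod int (ord a)" by (auto simp: x f_def mod_simps algebra_simps)
    finally show ?case .
  qed simp
  then show ?thesis using that \<theta> by metis
qed

lemma gen_inj: "inj_on gen V"
proof (rule inj_onI, rule ccontr)
  fix a b assume ab: "a \<in> V" "b \<in> V" "gen a = gen b" "a \<noteq> b"
  obtain \<theta> where \<theta>: "\<And>w. w \<in> words V \<Longrightarrow> \<theta> (cls w) = exp_sum a w mod int (ord a)"
    using exponent_hom[OF ab(1)] by metis
  have "1 mod int (ord a) = 0"
    using \<theta>[of "[(a, True)]"] \<theta>[of "[(b, True)]"] ab by simp
  then show False using colors ab(1) color_order_neq_1
    by (metis Pi_mem mod_0_imp_dvd int_dvd_int_iff nat_dvd_1_iff_1 of_nat_1)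
qed

end

text \<open>Write \<open>\<delta>_x\<close> for the indicator function of \<open>x\<close>. As
  \<open>m\<close> is \<open>\<delta>_\<one>\<close>, the function of \<open>B\<close> is
  \<open>\<delta>_\<one> - \<delta>_\<beta>\<close>, and that of the commutator is
  \<open>\<delta>_\<alpha> - \<delta>_(\<alpha>\<beta>) - \<delta>_\<one> +
  \<delta>_\<beta>\<close>. The three inequalities say that only the third term is nonzero at the
  identity.\<close>

lemma (in comm_group) int_wreath_commutator:
  fixes m
  assumes \<alpha>: "\<alpha> \<in> carrier G" "\<beta> \<in> carrier G" "\<alpha> \<noteq> \<one>" "\<beta> \<noteq> \<one>" "\<alpha> \<otimes> \<beta> \<noteq> \<one>"
  defines "W \<equiv> int_wreath G"
  defines "m \<equiv> (\<lambda>x\<in>carrier G. if x = \<one> then 1 else 0 :: int, \<one>)"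
  defines "A \<equiv> (\<lambda>x\<in>carrier G. 0 :: int, \<alpha>)"
  defines "B \<equiv> m \<otimes>\<^bsub>W\<^esub> (\<lambda>x\<in>carrier G. 0 :: int, \<beta>) \<otimes>\<^bsub>W\<^esub> inv\<^bsub>W\<^esub> m"
  shows "A \<in> carrier W" "B \<in> carrier W"
    "\<And>n::nat. \<alpha> [^] n = \<one> \<Longrightarrow> A [^]\<^bsub>W\<^esub> n = \<one>\<^bsub>W\<^esub>"
    "\<And>n::nat. \<beta> [^] n = \<one> \<Longrightarrow> B [^]\<^bsub>W\<^esub> n = \<one>\<^bsub>W\<^esub>"
    "inv\<^bsub>W\<^esub> A = (\<lambda>x\<in>carrier G. 0, inv \<alpha>)"
    "fst (A \<otimes>\<^bsub>W\<^esub> B \<otimes>\<^bsub>W\<^esub> inv\<^bsub>W\<^esub> A \<otimes>\<^bsub>W\<^esub> inv\<^bsub>W\<^esub> B) \<one> = -1"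
    "snd (A \<otimes>\<^bsub>W\<^esub> B \<otimes>\<^bsub>W\<^esub> inv\<^bsub>W\<^esub> A \<otimes>\<^bsub>W\<^esub> inv\<^bsub>W\<^esub> B) = \<one>"
proof -
  interpret W: group W unfolding W_def by (rule group_int_wreath)
  define D where "D = (\<lambda>c :: 'a. (\<lambda>x\<in>carrier G. 0 :: int, c))"
  have D: "D c \<in> carrier W" if "c \<in> carrier G" for c
    using that by (simp add: D_def W_def int_wreath_simps)
  have Dmult: "D c \<otimes>\<^bsub>W\<^esub> D e = D (c \<otimes> e)" if "c \<in> carrier G" "e \<in> carrier G" for c e
    using that by (auto simp: D_def W_def int_wreath_simps intro!: restrict_ext)
  have Done: "D \<one> = \<one>\<^bsub>W\<^esub>" by (simp add: D_def W_def int_wreath_simps)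
  have Dinv: "inv\<^bsub>W\<^esub> D c = D (inv c)" if "c \<in> carrier G" for c
    by (rule W.inv_equality) (use that D Dmult Done in auto)
  have Dpow: "D c [^]\<^bsub>W\<^esub> (n::nat) = D (c [^] n)" if "c \<in> carrier G" for c n
    by (induction n) (use that Done Dmult in auto)
  have AD: "A = D \<alpha>" and BD: "B = m \<otimes>\<^bsub>W\<^esub> D \<beta> \<otimes>\<^bsub>W\<^esub> inv\<^bsub>W\<^esub> m"
    by (simp_all add: A_def B_def D_def)
  have m: "m \<in> carrier W" by (simp add: m_def W_def int_wreath_simps)
  define m' where "m' = (\<lambda>x\<in>carrier G. if x = \<one> then -1 else 0 :: int, \<one>)"
  have m': "inv\<^bsub>W\<^esub> m = m'"
    by (rule W.inv_equality) (use m in \<open>auto simp: m_def m'_def W_def int_wreath_simps intro!: restrict_ext\<close>)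
  show A: "A \<in> carrier W" using D \<alpha> AD by simp
  show B: "B \<in> carrier W" using D \<alpha> m BD by simp
  show "A [^]\<^bsub>W\<^esub> n = \<one>\<^bsub>W\<^esub>" if "\<alpha> [^] n = \<one>" for n :: nat
    using that Dpow Done \<alpha> AD by simp
  show "B [^]\<^bsub>W\<^esub> n = \<one>\<^bsub>W\<^esub>" if "\<beta> [^] n = \<one>" for n :: nat
    using that Dpow Done \<alpha> BD m D W.conjugate_pow by simp
  show invA: "inv\<^bsub>W\<^esub> A = (\<lambda>x\<in>carrier G. 0, inv \<alpha>)" using Dinv \<alpha> AD by (simp add: D_def)
  have "inv\<^bsub>W\<^esub> B = m \<otimes>\<^bsub>W\<^esub> D (inv \<beta>) \<otimes>\<^bsub>W\<^esub> inv\<^bsub>W\<^esub> m"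
    using \<alpha> m D Dinv by (simp add: BD W.inv_mult_group W.m_assoc)
  then have invB: "inv\<^bsub>W\<^esub> B = m \<otimes>\<^bsub>W\<^esub> D (inv \<beta>) \<otimes>\<^bsub>W\<^esub> m'" by (simp add: m')
  have B': "B = m \<otimes>\<^bsub>W\<^esub> D \<beta> \<otimes>\<^bsub>W\<^esub> m'" by (simp add: BD m')
  have ne: "inv \<alpha> \<noteq> \<one>" "inv \<beta> \<noteq> \<one>" "inv \<beta> \<otimes> inv \<alpha> \<noteq> \<one>"
    using \<alpha> by (metis inv_inv inv_one, metis inv_inv inv_one, metis inv_inv inv_mult_group inv_one m_closed)
  have comm: "\<alpha> \<otimes> (\<beta> \<otimes> (inv \<alpha> \<otimes> inv \<beta>)) = \<one>"
    using \<alpha>(1,2) by (metis r_inv inv_mult m_assoc m_closed inv_closed)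
  have comm': "\<alpha> \<otimes> (inv \<alpha> \<otimes> inv \<beta>) = inv \<beta>"
    using \<alpha>(1,2) by (simp add: m_assoc[symmetric])
  show "snd (A \<otimes>\<^bsub>W\<^esub> B \<otimes>\<^bsub>W\<^esub> inv\<^bsub>W\<^esub> A \<otimes>\<^bsub>W\<^esub> inv\<^bsub>W\<^esub> B) = \<one>"
    unfolding invA invB unfolding B' unfolding A_def D_def m_def m'_def W_def
    using \<alpha> comm comm' by (simp add: int_wreath_simps m_assoc)
  show "fst (A \<otimes>\<^bsub>W\<^esub> B \<otimes>\<^bsub>W\<^esub> inv\<^bsub>W\<^esub> A \<otimes>\<^bsub>W\<^esub> inv\<^bsub>W\<^esub> B) \<one> = -1"
  proof -
    have 1: "inv (\<alpha> \<otimes> \<beta> \<otimes> inv \<alpha>) = inv \<beta>" using \<alpha> comm' by (simp add: inv_mult_group m_ac)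
    show ?thesis
      unfolding invA invB unfolding B' unfolding A_def D_def m_def m'_def W_def
      using \<alpha> ne by (simp add: int_wreath_simps 1)
  qed
qed

section \<open>Uncountably many letters\<close>

text \<open>A maximal set disjoint from its image is taken. If it is countable, all but countably
  many points are mapped into it, and then an uncountable fibre over one of its points does the
  job.\<close>

lemma uncountable_displaced_subset:
  assumes X: "uncountable X" "f ` X \<subseteq> X" and ne: "\<And>x. x \<in> X \<Longrightarrow> f x \<noteq> x"
  obtains B where "B \<subseteq> X" "uncountable B" "f ` B \<inter> B = {}"
proof -
  let ?\<A> = "{B. B \<subseteq> X \<and> f ` B \<inter> B = {}}"
  have "\<exists>M\<in>?\<A>. \<forall>Y\<in>?\<A>. M \<subseteq> Y \<longrightarrow> Y = M"
  proof (rule subset_Zorn_nonempty)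
    show "?\<A> \<noteq> {}" by auto
    fix C assume C: "C \<noteq> {}" "subset.chain ?\<A> C"
    have "f x \<noteq> y" if xy: "x \<in> \<Union>C" "y \<in> \<Union>C" for x y
    proof -
      obtain A where A: "A \<in> C" "x \<in> A" using xy(1) by blast
      obtain B where B: "B \<in> C" "y \<in> B" using xy(2) by blast
      note AB = A B
      then have "A \<subseteq> B \<or> B \<subseteq> A" using C by (auto simp: subset_chain_def psubset_eq)
      then obtain D where "D \<in> C" "x \<in> D" "y \<in> D" using AB by blast
      then have "f ` D \<inter> D = {}" using C by (auto simp: subset_chain_def)
      then show ?thesis using \<open>x \<in> D\<close> \<open>y \<in> D\<close> by auto
    qed
    moreover have "\<Union>C \<subseteq> X" using C by (auto simp: subset_chain_def)
    ultimately show "\<Union>C \<in> ?\<A>" by auto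
  qed
  then obtain M where M0: "M \<in> ?\<A>" "\<forall>Y\<in>?\<A>. M \<subseteq> Y \<longrightarrow> Y = M" by (rule bexE)
  have M: "M \<subseteq> X" "f ` M \<inter> M = {}" using M0(1) by simp_all
  have max: "Y = M" if "Y \<subseteq> X" "f ` Y \<inter> Y = {}" "M \<subseteq> Y" for Y
    using M0(2) that by simp
  show ?thesis
  proof (cases "countable M")
    case True
    define Y where "Y = X - (M \<union> f ` M)"
    have Y: "uncountable Y" using X True by (simp add: Y_def uncountable_minus_countable)
    \<comment> \<open>Maximality forbids adding \<open>x\<close> to \<open>M\<close>. Since
      \<open>x\<close> is not fixed and is not the image of a point of \<open>M\<close>, the only
      remaining obstruction is \<open>f x \<in> M\<close>.\<close>
    have fY: "f x \<in> M" if "x \<in> Y" for x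
    proof (rule ccontr)
      assume "f x \<notin> M"
      then have "f ` insert x M \<inter> insert x M = {}"
        using M that ne[of x] by (auto simp: Y_def)
      then have "insert x M = M" using max[of "insert x M"] M that by (auto simp: Y_def)
      then show False using that by (auto simp: Y_def)
    qed
    have "Y = (\<Union>m\<in>M. {x \<in> Y. f x = m})" using fY by auto
    then obtain m where m: "m \<in> M" "uncountable {x \<in> Y. f x = m}"
      using Y True by (metis (no_types, lifting) countable_UN)
    \<comment> \<open>The image of the fibre is the single point \<open>m\<close>, which belongs to
      \<open>M\<close> and hence not to \<open>Y\<close>.\<close>
    show ?thesis
      by (rule that[OF _ m(2)]) (use m(1) in \<open>auto simp: Y_def\<close>)
  next
    case False then show ?thesis using that M by blast
  qed
qed

lemma finite_Collect_ex_ge: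
  assumes "finite S" "\<And>i k. i \<in> I \<Longrightarrow> m \<le> k \<Longrightarrow> P i k \<Longrightarrow> i \<in> S"
  shows "finite {i \<in> I. \<exists>k\<ge>m. P i k}"
  by (rule finite_subset[OF _ assms(1)]) (use assms(2) in blast)

section \<open>Detecting the commutator of two non-adjacent letters\<close>

context colored_graph
begin

abbreviation "comm_class a b \<equiv> gen a \<otimes>\<^bsub>GP\<^esub> gen b \<otimes>\<^bsub>GP\<^esub> inv\<^bsub>GP\<^esub> gen a \<otimes>\<^bsub>GP\<^esub> inv\<^bsub>GP\<^esub> gen b"

abbreviation "cyc a \<equiv> integer_mod_group (ord a)"

text \<open>
  The letter \<open>a\<close> goes to the shift by the first coordinate and \<open>b\<close> to a conjugate of the shift by the
  second one, so that their commutator is a nonzero function on the abelianisation.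
\<close>

lemma nonadjacent_hom:
  assumes ab: "a \<in> V" "b \<in> V" "a \<noteq> b" "(a, b) \<notin> E"
  defines "C \<equiv> cyc a \<times>\<times> cyc b"
  obtains \<phi> where "\<phi> \<in> hom GP (int_wreath C)"
    "\<And>v. v \<in> V \<Longrightarrow> v \<noteq> a \<Longrightarrow> v \<noteq> b \<Longrightarrow> \<phi> (gen v) = \<one>\<^bsub>int_wreath C\<^esub>"
    "\<And>w. w \<in> words V \<Longrightarrow> b \<notin> fst ` set w \<Longrightarrow> fst (\<phi> (cls w)) \<one>\<^bsub>C\<^esub> = 0"
    "\<And>k::nat. fst (\<phi> (comm_class a b) [^]\<^bsub>int_wreath C\<^esub> k) \<one>\<^bsub>C\<^esub> = - int k"
proof -
  have C: "comm_group C" unfolding C_def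
    by (intro group.group_comm_groupI DirProd_group group_integer_mod_group) (auto simp: DirProd_def add.commute)
  interpret C: comm_group C by (rule C)
  let ?W = "int_wreath C"
  interpret W: group ?W by (rule C.group_int_wreath)
  have ne: "ord a \<noteq> 1" "ord b \<noteq> 1" using colors ab color_order_neq_1 by auto
  have one_mod: "(1::int) mod int n \<noteq> 0" if "n \<noteq> 1" for n
    using that by (metis mod_0_imp_dvd int_dvd_int_iff nat_dvd_1_iff_1 of_nat_1)
  let ?\<alpha> = "(1, 0) :: int \<times> int" and ?\<beta> = "(0, 1) :: int \<times> int"
  have one: "\<one>\<^bsub>C\<^esub> = (0, 0)" by (simp add: C_def)
  have car: "?\<alpha> \<in> carrier C" "?\<beta> \<in> carrier C" using ne by (auto simp: C_def)
  have mult: "?\<alpha> \<otimes>\<^bsub>C\<^esub> ?\<beta> \<noteq> \<one>\<^bsub>C\<^esub>" "?\<alpha> \<noteq> \<one>\<^bsub>C\<^esub>" "?\<beta> \<noteq> \<one>\<^bsub>C\<^esub>"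
    using ne one_mod by (auto simp: C_def)
  define A where "A = (\<lambda>x\<in>carrier C. 0 :: int, ?\<alpha>)"
  define m where "m = (\<lambda>x\<in>carrier C. if x = \<one>\<^bsub>C\<^esub> then 1 else 0 :: int, \<one>\<^bsub>C\<^esub>)"
  define B where "B = m \<otimes>\<^bsub>?W\<^esub> (\<lambda>x\<in>carrier C. 0 :: int, ?\<beta>) \<otimes>\<^bsub>?W\<^esub> inv\<^bsub>?W\<^esub> m"
  note AB = C.int_wreath_commutator[OF car mult(2,3,1), folded m_def, folded A_def B_def]
  define f where "f v = (if v = a then A else if v = b then B else \<one>\<^bsub>?W\<^esub>)" for v
  have f: "f \<in> V \<rightarrow> carrier ?W" using AB(1,2) by (auto simp: f_def)
  obtain \<phi> where \<phi>: "\<phi> \<in> hom GP ?W" "\<And>w. w \<in> words V \<Longrightarrow> \<phi> (cls w) = eval_word ?W f w"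
  proof (rule GP_hom[OF W.is_group f])
    fix v assume "v \<in> V"
    have "?\<alpha> [^]\<^bsub>C\<^esub> ord a = \<one>\<^bsub>C\<^esub>" "?\<beta> [^]\<^bsub>C\<^esub> ord b = \<one>\<^bsub>C\<^esub>"
      unfolding one C_def by (simp_all add: nat_pow_DirProd)
    then show "f v [^]\<^bsub>?W\<^esub> ord v = \<one>\<^bsub>?W\<^esub>"
      using AB(3,4) by (auto simp: f_def)
  next
    \<comment> \<open>An edge is not a loop and does not join \<open>a\<close> and \<open>b\<close>,
      so one of its endpoints goes to the identity.\<close>
    fix v w assume vw: "(v, w) \<in> E"
    then have "(w, v) \<in> E" "v \<noteq> w" using graph by (auto simp: simple_graph_def irrefl_def dest: symD)
    then have "v \<notin> {a, b} \<or> w \<notin> {a, b}" using vw ab by auto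
    then show "f v \<otimes>\<^bsub>?W\<^esub> f w = f w \<otimes>\<^bsub>?W\<^esub> f v"
      using AB(1,2) by (auto simp: f_def)
  qed (rule that)
  interpret h: group_hom GP ?W \<phi> by unfold_locales (rule \<phi>(1))
  have gen: "\<phi> (gen v) = f v" if "v \<in> V" for v
    using \<phi>(2)[of "[(v, True)]"] that funcset_mem[OF f that] by simp
  show ?thesis
  proof (rule that[OF \<phi>(1)])
    show "\<phi> (gen v) = \<one>\<^bsub>?W\<^esub>" if "v \<in> V" "v \<noteq> a" "v \<noteq> b" for v
      using gen that by (simp add: f_def)
    \<comment> \<open>Letters other than \<open>b\<close> go to pure shifts, that is, to elements
      with zero function, and a product of pure shifts is a pure shift.\<close>
    have "fst (eval_word ?W f w) = (\<lambda>x\<in>carrier C. 0)" if "w \<in> words V" "b \<notin> fst ` set w" for w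
      using that
    proof (induction w)
      case (Cons x w)
      obtain v b' where x: "x = (v, b')" by (cases x)
      let ?y = "if b' then f v else inv\<^bsub>?W\<^esub> f v"
      have y: "fst ?y = (\<lambda>x\<in>carrier C. 0)" "snd ?y \<in> carrier C"
      proof -
        have Ad: "fst A = (\<lambda>x\<in>carrier C. 0)" "snd A \<in> carrier C"
          using car by (simp_all add: A_def)
        have Ai: "fst (inv\<^bsub>?W\<^esub> A) = (\<lambda>x\<in>carrier C. 0)" "snd (inv\<^bsub>?W\<^esub> A) \<in> carrier C"
          unfolding AB(5) using car by simp_all
        have W1: "fst \<one>\<^bsub>?W\<^esub> = (\<lambda>x\<in>carrier C. 0)" "snd \<one>\<^bsub>?W\<^esub> \<in> carrier C"
          by (simp_all add: C.int_wreath_simps(3))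
        have "fst y = (\<lambda>x\<in>carrier C. 0) \<and> snd y \<in> carrier C"
          if "y = A \<or> y = inv\<^bsub>?W\<^esub> A \<or> y = \<one>\<^bsub>?W\<^esub>" for y
          using that Ad Ai W1 by (elim disjE) (simp_all only: simp_thms)
        moreover have "?y = A \<or> ?y = inv\<^bsub>?W\<^esub> A \<or> ?y = \<one>\<^bsub>?W\<^esub>" using Cons.prems x by (auto simp: f_def)
        ultimately show "fst ?y = (\<lambda>x\<in>carrier C. 0)" "snd ?y \<in> carrier C" by presburger+
      qed
      have "\<exists>d. eval_word ?W f w = (\<lambda>x\<in>carrier C. 0, d)"
        by (rule exI[of _ "snd (eval_word ?W f w)"]) (use Cons in \<open>simp add: prod_eq_iff restrict_def\<close>)
      then obtain d where d: "eval_word ?W f w = (\<lambda>x\<in>carrier C. 0, d)" ..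
      have "\<exists>c. ?y = (\<lambda>x\<in>carrier C. 0, c) \<and> c \<in> carrier C"
        by (rule exI[of _ "snd ?y"]) (simp only: prod_eq_iff fst_conv snd_conv y simp_thms)
      then obtain c where c: "?y = (\<lambda>x\<in>carrier C. 0, c)" "c \<in> carrier C" by (elim exE conjE)
      have "eval_word ?W f (x # w) = ?y \<otimes>\<^bsub>?W\<^esub> eval_word ?W f w" by (simp add: x)
      also have "\<dots> = (\<lambda>x\<in>carrier C. 0, c \<otimes>\<^bsub>C\<^esub> d)"
        unfolding c d using c(2) by (auto simp: C.int_wreath_simps intro!: restrict_ext)
      finally show ?case by simp
    qed (simp add: C.int_wreath_simps)
    then show "fst (\<phi> (cls w)) \<one>\<^bsub>C\<^esub> = 0" if "w \<in> words V" "b \<notin> fst ` set w" for w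
      using that \<phi>(2) by simp
    let ?D = "A \<otimes>\<^bsub>?W\<^esub> B \<otimes>\<^bsub>?W\<^esub> inv\<^bsub>?W\<^esub> A \<otimes>\<^bsub>?W\<^esub> inv\<^bsub>?W\<^esub> B"
    have "\<phi> (comm_class a b) = ?D" using ab gen by (simp add: f_def)
    moreover have "?D = (fst ?D, \<one>\<^bsub>C\<^esub>)" using AB(7) by (metis prod.collapse)
    moreover have "?D \<in> carrier ?W" using AB(1,2) by simp
    then have "fst ?D \<in> extensional (carrier C)" by (metis C.int_wreath_simps(1) prod.collapse)
    ultimately show "fst (\<phi> (comm_class a b) [^]\<^bsub>?W\<^esub> k) \<one>\<^bsub>C\<^esub> = - int k" for k :: nat
      using C.pow_int_wreath[of "fst ?D" k] AB(6) by simp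
  qed
qed

end

section \<open>Necessity of conditions (a), (b) and (c)\<close>

locale polish_colored_graph = colored_graph V E p + P: polish_grp "graph_product V E p" d
  for V :: "'v set" and E p d
begin

text \<open>Each \<open>b\<close> with a non-neighbour is paired with one, \<open>f b\<close>, and
  the commutators of these pairs are to be independent. The homomorphism for \<open>i\<close> only
  keeps the letters \<open>i\<close> and \<open>f i\<close>, so it kills the commutator for
  \<open>j\<close> once \<open>j\<close> is neither of them. For \<open>j = f i\<close> this could
  fail, which is why the index set is first made disjoint from its image under
  \<open>f\<close>.\<close>

lemma few_nonadjacent:
  "\<exists>A\<subseteq>V. countable A \<and> (\<forall>a\<in>V. \<forall>b\<in>V - A. a \<noteq> b \<longrightarrow> (a, b) \<in> E)"
proof (rule ccontr)
  assume neg: "\<not> ?thesis"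
  define X where "X = {b \<in> V. \<exists>a\<in>V. a \<noteq> b \<and> (a, b) \<notin> E}"
  have "uncountable X"
  proof
    assume "countable X"
    moreover have "X \<subseteq> V" "\<forall>a\<in>V. \<forall>b\<in>V - X. a \<noteq> b \<longrightarrow> (a, b) \<in> E" by (auto simp: X_def)
    ultimately have "\<exists>A\<subseteq>V. countable A \<and> (\<forall>a\<in>V. \<forall>b\<in>V - A. a \<noteq> b \<longrightarrow> (a, b) \<in> E)"
      by (intro exI[of _ X] conjI)
    with neg show False by contradiction
  qed
  define f where "f b = (SOME a. a \<in> V \<and> a \<noteq> b \<and> (a, b) \<notin> E)" for b
  have f: "f b \<in> V" "f b \<noteq> b" "(f b, b) \<notin> E" if "b \<in> X" for b
    using that someI_ex[of "\<lambda>a. a \<in> V \<and> a \<noteq> b \<and> (a, b) \<notin> E"] unfolding X_def f_def by blast+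
  have "f ` X \<subseteq> X"
  proof
    fix a assume "a \<in> f ` X"
    then obtain b where b: "b \<in> X" "a = f b" by blast
    then have "(b, a) \<notin> E" using f[OF b(1)] graph by (auto simp: simple_graph_def dest: symD)
    moreover have "b \<in> V" using b(1) by (simp add: X_def)
    ultimately have "\<exists>c\<in>V. c \<noteq> a \<and> (c, a) \<notin> E"
      using f(2)[OF b(1)] b(2) by (intro bexI[of _ b]) auto
    then show "a \<in> X" using f(1)[OF b(1)] b(2) unfolding X_def by simp
  qed
  then obtain B where B: "B \<subseteq> X" "uncountable B" "f ` B \<inter> B = {}"
    by (rule uncountable_displaced_subset[OF \<open>uncountable X\<close> _ f(2)])
  let ?C = "\<lambda>b. cyc (f b) \<times>\<times> cyc b"
  define good where "good b \<phi> \<longleftrightarrow> \<phi> \<in> hom GP (int_wreath (?C b)) \<and>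
      (\<forall>v\<in>V. v \<noteq> f b \<longrightarrow> v \<noteq> b \<longrightarrow> \<phi> (gen v) = \<one>\<^bsub>int_wreath (?C b)\<^esub>) \<and>
      (\<forall>w\<in>words V. b \<notin> fst ` set w \<longrightarrow> fst (\<phi> (cls w)) \<one>\<^bsub>?C b\<^esub> = 0) \<and>
      (\<forall>k::nat. fst (\<phi> (comm_class (f b) b) [^]\<^bsub>int_wreath (?C b)\<^esub> k) \<one>\<^bsub>?C b\<^esub> = - int k)" for b \<phi>
  have "\<exists>\<phi>. good b \<phi>" if "b \<in> B" for b
  proof -
    have b: "b \<in> X" "b \<in> V" using that B by (auto simp: X_def)
    show ?thesis
    proof (rule nonadjacent_hom[OF f(1)[OF b(1)] b(2) f(2,3)[OF b(1)]])
      fix \<phi>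
      assume "\<phi> \<in> hom GP (int_wreath (?C b))"
        "\<And>v. v \<in> V \<Longrightarrow> v \<noteq> f b \<Longrightarrow> v \<noteq> b \<Longrightarrow> \<phi> (gen v) = \<one>\<^bsub>int_wreath (?C b)\<^esub>"
        "\<And>w. w \<in> words V \<Longrightarrow> b \<notin> fst ` set w \<Longrightarrow> fst (\<phi> (cls w)) \<one>\<^bsub>?C b\<^esub> = 0"
        "\<And>k::nat. fst (\<phi> (comm_class (f b) b) [^]\<^bsub>int_wreath (?C b)\<^esub> k) \<one>\<^bsub>?C b\<^esub> = - int k"
      then have "good b \<phi>" unfolding good_def by (intro conjI ballI allI impI)
      then show ?thesis by (intro exI[of _ \<phi>])
    qed
  qed
  then obtain \<rho> where "\<forall>b\<in>B. good b (\<rho> b)" by (meson bchoice)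
  then have \<rho>: "\<And>b. b \<in> B \<Longrightarrow> \<rho> b \<in> hom GP (int_wreath (?C b))"
    "\<And>b v. b \<in> B \<Longrightarrow> v \<in> V \<Longrightarrow> v \<noteq> f b \<Longrightarrow> v \<noteq> b \<Longrightarrow> \<rho> b (gen v) = \<one>\<^bsub>int_wreath (?C b)\<^esub>"
    "\<And>b w. b \<in> B \<Longrightarrow> w \<in> words V \<Longrightarrow> b \<notin> fst ` set w \<Longrightarrow> fst (\<rho> b (cls w)) \<one>\<^bsub>?C b\<^esub> = 0"
    "\<And>b k. b \<in> B \<Longrightarrow> fst (\<rho> b (comm_class (f b) b) [^]\<^bsub>int_wreath (?C b)\<^esub> (k::nat)) \<one>\<^bsub>?C b\<^esub> = - int k"
    unfolding good_def by simp_all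
  have C: "group (?C b)" for b by (intro DirProd_group group_integer_mod_group)
  have W: "group (int_wreath (?C b))" for b using group.group_int_wreath[OF C] .
  have BV: "b \<in> V" "f b \<in> V" if "b \<in> B" for b using B f that by (auto simp: X_def)
  show False
  proof (rule P.no_uncountable_independent_family[OF B(2), where c = "\<lambda>b. comm_class (f b) b"
        and Q = "\<lambda>b. int_wreath (?C b)" and \<rho> = \<rho>])
    show "no_divisible (int_wreath (?C b))" for b
      by (rule group.no_divisible_int_wreath[OF C])
        (intro no_divisible_DirProd no_divisible_integer_mod_group)
    show "\<rho> i (comm_class (f j) j) = \<one>\<^bsub>int_wreath (?C i)\<^esub>" if ij: "i \<in> B" "j \<in> B" "i \<noteq> j" for i j
    proof -
      interpret W: group "int_wreath (?C i)" by (rule W)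
      interpret h: group_hom GP "int_wreath (?C i)" "\<rho> i" by unfold_locales (rule \<rho>(1)[OF ij(1)])
      have "j \<noteq> f i" using B(3) ij by blast
      then have "\<rho> i (gen j) = \<one>\<^bsub>int_wreath (?C i)\<^esub>" using \<rho>(2)[OF ij(1) BV(1)[OF ij(2)]] ij by blast
      then show ?thesis using BV ij by simp
    qed
    \<comment> \<open>If \<open>i\<close> does not occur in the word, the function coordinate of the
      image vanishes at the identity, whereas the \<open>k\<close>-th power of the commutator takes
      the value \<open>- k\<close> there.\<close>
    show "finite {i \<in> B. \<exists>k::nat\<ge>1. \<rho> i g = \<rho> i (comm_class (f i) i) [^]\<^bsub>int_wreath (?C i)\<^esub> k}"
      if g: "g \<in> carrier GP" for g
    proof -
      obtain w where w: "w \<in> words V" "g = cls w" using GP_cases[OF g] .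
      have "i \<in> fst ` set w" if i: "i \<in> B" "1 \<le> k" "\<rho> i g = \<rho> i (comm_class (f i) i) [^]\<^bsub>int_wreath (?C i)\<^esub> (k::nat)" for i k
        using \<rho>(3)[OF i(1) w(1)] \<rho>(4)[OF i(1), of k] i(2,3) w(2) by fastforce
      then show ?thesis by (intro finite_Collect_ex_ge[of "fst ` set w"]) simp_all
    qed
  qed (use BV \<rho>(1) W in auto)
qed

text \<open>The letters themselves are independent: each is detected by its exponent, and a positive
  multiple of \<open>1\<close> is a nonzero integer.\<close>

lemma countable_infinite_color: "countable (color_class V p \<infinity>)"
proof (rule ccontr)
  assume unc: "uncountable (color_class V p \<infinity>)"
  have V: "v \<in> V" "ord v = 0" if "v \<in> color_class V p \<infinity>" for v
    using that by (auto simp: color_class_def)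
  have "\<exists>\<theta>. \<theta> \<in> hom GP (integer_mod_group 0) \<and> (\<forall>w\<in>words V. \<theta> (cls w) = exp_sum v w)"
    if "v \<in> color_class V p \<infinity>" for v
    using exponent_hom[OF V(1)[OF that]] V(2)[OF that] by (metis mod_by_0 of_nat_0)
  then obtain \<theta> where \<theta>: "\<And>v. v \<in> color_class V p \<infinity> \<Longrightarrow> \<theta> v \<in> hom GP (integer_mod_group 0)"
    "\<And>v w. v \<in> color_class V p \<infinity> \<Longrightarrow> w \<in> words V \<Longrightarrow> \<theta> v (cls w) = exp_sum v w"
    by metis
  have pow: "x [^]\<^bsub>integer_mod_group 0\<^esub> k = int k * x" for x and k :: nat
    by simp
  show False
  proof (rule P.no_uncountable_independent_family[OF unc, where c = "\<lambda>v. gen v"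
        and Q = "\<lambda>_. integer_mod_group 0" and \<rho> = \<theta>])
    show "finite {i \<in> color_class V p \<infinity>. \<exists>k::nat\<ge>1. \<theta> i g = \<theta> i (gen i) [^]\<^bsub>integer_mod_group 0\<^esub> k}"
      if g: "g \<in> carrier GP" for g
    proof -
      obtain w where w: "w \<in> words V" "g = cls w" using GP_cases[OF g] .
      have "i \<in> fst ` set w" if i: "i \<in> color_class V p \<infinity>" "1 \<le> k"
        "\<theta> i g = \<theta> i (gen i) [^]\<^bsub>integer_mod_group 0\<^esub> (k::nat)" for i k
      proof (rule ccontr)
        assume "i \<notin> fst ` set w"
        then have "\<theta> i g = 0" using \<theta>(2)[OF i(1) w(1)] w(2) exp_sum_eq_0 by metis
        moreover have "\<theta> i (gen i) = 1" using \<theta>(2)[OF i(1), of "[(i, True)]"] V[OF i(1)] by simp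
        ultimately show False using i(2,3) pow by simp
      qed
      then show ?thesis by (intro finite_Collect_ex_ge[of "fst ` set w"]) simp_all
    qed
  qed (use V \<theta> no_divisible_integer_mod_group in auto)
qed

text \<open>The criterion for independent families does not apply, because a positive power of a
  letter of finite order can be trivial and then detects nothing. Instead the exponents are the
  colours themselves: the \<open>n\<close>-th one cuts off the tail modulo \<open>c n\<close>, and
  the product of the earlier ones is too small to vanish modulo \<open>c n\<close>.\<close>

lemma finite_uncountable_colors: "finite {c \<in> p ` V. uncountable (color_class V p c)}"
proof (rule ccontr)
  assume inf: "infinite {c \<in> p ` V. uncountable (color_class V p c)}"
  define N where "N = {n. enat n \<in> p ` V \<and> uncountable (color_class V p (enat n))}"
  have "{c \<in> p ` V. uncountable (color_class V p c)} \<subseteq> insert \<infinity> (enat ` N)"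
  proof
    fix c assume "c \<in> {c \<in> p ` V. uncountable (color_class V p c)}"
    then show "c \<in> insert \<infinity> (enat ` N)" by (cases c) (auto simp: N_def)
  qed
  then have infN: "infinite N" using inf finite_subset by blast
  define R where "R h s \<longleftrightarrow> (case s of (n, a, b) \<Rightarrow> prod_list (map fst h) < n \<and> a \<in> color_class V p (enat n)
      \<and> b \<in> color_class V p (enat n) \<and> a \<noteq> b)" for h :: "(nat \<times> 'v \<times> 'v) list" and s
  define dd where "dd = (\<lambda>(n :: nat, a, b). gen a \<otimes>\<^bsub>GP\<^esub> inv\<^bsub>GP\<^esub> gen b)"
  define kk :: "nat \<times> 'v \<times> 'v \<Rightarrow> nat" where "kk = fst"
  have "\<exists>s. R h s \<and> dd s \<in> U" if U: "P.nhd U" for h U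
  proof -
    obtain n where n: "n \<in> N" "prod_list (map fst h) < n" using infN infinite_nat_iff_unbounded by blast
    have c: "gen a \<in> carrier GP" if "a \<in> color_class V p (enat n)" for a using that by (auto simp: color_class_def)
    have "uncountable (color_class V p (enat n))" using n by (simp add: N_def)
    then obtain a b where "a \<in> color_class V p (enat n)" "b \<in> color_class V p (enat n)" "a \<noteq> b"
      "gen a \<otimes>\<^bsub>GP\<^esub> inv\<^bsub>GP\<^esub> gen b \<in> U"
      by (rule P.uncountable_close_pair[OF _ c U])
    then show ?thesis using n by (intro exI[of _ "(n, a, b)"]) (simp add: R_def dd_def)
  qed
  then obtain \<sigma> x where \<sigma>: "\<And>n. R (map \<sigma> [0..<n]) (\<sigma> n)" and x: "\<And>n. x n \<in> carrier GP"
    and eq: "\<And>n. x n = x (Suc n) [^]\<^bsub>GP\<^esub> kk (\<sigma> n) \<otimes>\<^bsub>GP\<^esub> dd (\<sigma> n)"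
    using P.solve_equations[of R dd kk] by metis
  define c where "c n = fst (\<sigma> n)" for n
  define a where "a n = fst (snd (\<sigma> n))" for n
  define b where "b n = snd (snd (\<sigma> n))" for n
  have \<sigma>_eq: "\<sigma> n = (c n, a n, b n)" for n by (simp add: c_def a_def b_def)
  have big: "(\<Prod>m<n. c m) < c n" for n
  proof -
    have "prod_list (map fst (map \<sigma> [0..<n])) = (\<Prod>m<n. c m)"
      by (induction n) (simp_all add: c_def mult.commute)
    then show ?thesis using \<sigma>[of n] by (simp add: R_def \<sigma>_eq)
  qed
  have ab: "a n \<in> V" "p (a n) = enat (c n)" "b n \<in> V" "p (b n) = enat (c n)" "a n \<noteq> b n" for n
    using \<sigma>[of n] by (auto simp: R_def \<sigma>_eq color_class_def)
  have c2: "c n \<ge> 2" for n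
  proof -
    have "enat (c n) \<in> colors" using colors ab(1,2)[of n] by (metis Pi_mem)
    then have "c n \<noteq> 1" using color_order_neq_1 by fastforce
    then show ?thesis using big[of n] by linarith
  qed
  have c_less: "c m < c n" if "m < n" for m n
  proof -
    have "c m dvd (\<Prod>m<n. c m)" using that by (intro dvd_prodI) auto
    moreover have "(\<Prod>m<n. c m) > 0" using c2 by (intro prod_pos) (metis less_le_trans zero_less_numeral)
    ultimately have "c m \<le> (\<Prod>m<n. c m)" by (rule dvd_imp_le)
    then show ?thesis using big[of n] by (rule le_less_trans)
  qed
  have c_inj: "c m \<noteq> c n" if "m \<noteq> n" for m n
    using c_less that by (metis linorder_neqE_nat less_irrefl)
  obtain w where w: "w \<in> words V" "x 0 = cls w" using GP_cases[OF x] by blast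
  have "a n \<in> fst ` set w" for n
  proof -
    let ?Z = "integer_mod_group (ord (a n))"
    have ordn: "ord (a n) = c n" using ab by simp
    obtain \<theta> where \<theta>: "\<theta> \<in> hom GP ?Z" "\<And>w. w \<in> words V \<Longrightarrow> \<theta> (cls w) = exp_sum (a n) w mod int (ord (a n))"
      using exponent_hom[OF ab(1)] by blast
    interpret Z: group ?Z by simp
    interpret h: group_hom GP ?Z \<theta> by unfold_locales (rule \<theta>(1))
    have gen: "\<theta> (gen v) = (if v = a n then 1 else 0)" if "v \<in> V" for v
      using \<theta>(2)[of "[(v, True)]"] that c2[of n] by (auto simp: ordn)
    have rec: "\<theta> (x m) = (int (c m) * \<theta> (x (Suc m)) + (if m = n then 1 else 0)) mod int (c n)" for m
    proof -
      have dm: "\<theta> (dd (\<sigma> m)) = (if m = n then 1 else 0)"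
      proof (cases "m = n")
        case True
        then have "\<theta> (dd (\<sigma> m)) = \<theta> (gen (a n)) \<otimes>\<^bsub>?Z\<^esub> inv\<^bsub>?Z\<^esub> \<theta> (gen (b n))"
          using ab by (simp add: dd_def \<sigma>_eq)
        also have "\<theta> (gen (b n)) = \<one>\<^bsub>?Z\<^esub>" using gen[OF ab(3)[of n]] ab(5)[of n] by simp
        also have "\<theta> (gen (a n)) \<otimes>\<^bsub>?Z\<^esub> inv\<^bsub>?Z\<^esub> \<one>\<^bsub>?Z\<^esub> = \<theta> (gen (a n))"
          unfolding Z.inv_one by (rule Z.r_one, rule h.hom_closed) (use ab in simp)
        also have "\<theta> (gen (a n)) = 1" using gen[OF ab(1)[of n]] by simp
        finally show ?thesis using True by simp
      next
        case False
        then have "a m \<noteq> a n" "b m \<noteq> a n" using c_inj[OF False] ab by (metis enat.inject)+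
        then have "\<theta> (gen (a m)) = \<one>\<^bsub>?Z\<^esub>" "\<theta> (gen (b m)) = \<one>\<^bsub>?Z\<^esub>" using gen ab by simp_all
        moreover have "\<theta> (dd (\<sigma> m)) = \<theta> (gen (a m)) \<otimes>\<^bsub>?Z\<^esub> inv\<^bsub>?Z\<^esub> \<theta> (gen (b m))"
          using ab by (simp add: dd_def \<sigma>_eq)
        ultimately have "\<theta> (dd (\<sigma> m)) = \<one>\<^bsub>?Z\<^esub>" by (metis Z.inv_one Z.l_one Z.one_closed)
        then show ?thesis using False by simp
      qed
      have dc: "dd (\<sigma> m) \<in> carrier GP" using ab by (simp add: dd_def \<sigma>_eq)
      have "\<theta> (x m) = \<theta> (x (Suc m) [^]\<^bsub>GP\<^esub> kk (\<sigma> m) \<otimes>\<^bsub>GP\<^esub> dd (\<sigma> m))" by (rule arg_cong[OF eq])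
      also have "\<dots> = \<theta> (x (Suc m)) [^]\<^bsub>?Z\<^esub> c m \<otimes>\<^bsub>?Z\<^esub> \<theta> (dd (\<sigma> m))"
        using x dc by (simp add: kk_def c_def h.hom_nat_pow del: mult_integer_mod_group)
      also have "\<dots> = (int (c m) * \<theta> (x (Suc m)) + (if m = n then 1 else 0)) mod int (c n)"
        unfolding dm by (simp add: ordn mod_simps)
      finally show ?thesis .
    qed
    \<comment> \<open>The exponent of the \<open>n\<close>-th equation is \<open>c n\<close>, which
      is zero in the target, so the later unknowns have no influence.\<close>
    have xn: "\<theta> (x n) = 1" using rec[of n] c2[of n] by (simp add: mod_add_left_eq[symmetric])
    have low: "\<theta> (x m) = int (\<Prod>k=m..<n. c k) mod int (c n)" if "m \<le> n" for m
      using that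
    proof (induction m rule: inc_induct)
      case base
      then show ?case using xn c2[of n] by simp
    next
      case (step m)
      then have "\<theta> (x m) = (int (c m) * (int (\<Prod>k=Suc m..<n. c k) mod int (c n))) mod int (c n)"
        using rec[of m] by simp
      also have "\<dots> = int (\<Prod>k=m..<n. c k) mod int (c n)"
        using step by (simp add: prod.atLeast_Suc_lessThan mod_simps)
      finally show ?case .
    qed
    \<comment> \<open>The product is below \<open>c n\<close>, so it equals its own residue, and it
      is positive.\<close>
    from low[of 0] have "\<theta> (x 0) = int (\<Prod>k<n. c k)"
      using big[of n] by (simp add: lessThan_atLeast0 flip: of_nat_mod of_nat_prod)
    moreover have "(\<Prod>k<n. c k) > 0" using c2 by (intro prod_pos) (metis less_le_trans zero_less_numeral)
    ultimately have "\<theta> (x 0) \<noteq> 0" by (metis of_nat_eq_0_iff less_irrefl)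
    then have "exp_sum (a n) w \<noteq> 0" using \<theta>(2)[OF w(1)] w(2) by auto
    then show ?thesis using exp_sum_eq_0 by metis
  qed
  then have "range a \<subseteq> fst ` set w" by (rule image_subsetI)
  then have "finite (range a)" by (rule finite_subset) simp
  moreover have "inj a" by (rule injI) (metis c_inj ab(2) enat.inject)
  ultimately show False using finite_imageD by blast
qed

end

section \<open>Continuous images of Polish groups\<close>

lemma (in Metric_space) limitin_close_sequence:
  assumes f: "limitin mtopology f l sequentially"
    and g: "\<And>n. g n \<in> M" and fg: "\<And>n. f n \<in> M" "\<And>n. d (f n) (g n) \<le> (1/2) ^ n"
  shows "limitin mtopology g l sequentially"
  unfolding limitin_metric
proof (intro conjI allI impI)
  show l: "l \<in> M" using f by (simp add: limitin_metric)
  fix \<epsilon> :: real assume \<epsilon>: "\<epsilon> > 0"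
  obtain K where K: "(1/2::real) ^ K < \<epsilon> / 2"
    using real_arch_pow_inv[of "\<epsilon>/2" "1/2"] \<epsilon> by auto
  have "\<forall>\<^sub>F n in sequentially. f n \<in> M \<and> d (f n) l < \<epsilon> / 2"
    using f \<epsilon> unfolding limitin_metric by (meson half_gt_zero)
  moreover have "\<forall>\<^sub>F n in sequentially. (1/2::real) ^ n < \<epsilon> / 2"
    unfolding eventually_sequentially
  proof (intro exI allI impI)
    fix n assume "K \<le> n"
    then show "(1/2::real) ^ n < \<epsilon> / 2" using K power_decreasing[of K n "1/2::real"] by linarith
  qed
  ultimately show "\<forall>\<^sub>F n in sequentially. g n \<in> M \<and> d (g n) l < \<epsilon>"
  proof (eventually_elim)
    case (elim n)
    have "d (g n) l \<le> d (g n) (f n) + d (f n) l" using triangle g fg l by blast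
    then show ?case using elim fg(2)[of n] g commute[of "f n" "g n"] by auto
  qed
qed

text \<open>Finitely many conditions that hold for all sufficiently small radii have a common
  threshold, namely the minimum.\<close>

lemma finite_uniform_radius:
  fixes Q :: "'x \<Rightarrow> real \<Rightarrow> bool"
  assumes "finite F" "\<And>x. x \<in> F \<Longrightarrow> \<exists>e>0. \<forall>r. 0 < r \<and> r \<le> e \<longrightarrow> Q x r"
  shows "\<exists>e>0. \<forall>r. 0 < r \<and> r \<le> e \<longrightarrow> (\<forall>x\<in>F. Q x r)"
  using assms
proof (induction F rule: finite_induct)
  case empty show ?case by (intro exI[of _ 1]) simp
next
  case (insert x F)
  obtain e1 where e1: "e1 > 0" "\<forall>r. 0 < r \<and> r \<le> e1 \<longrightarrow> Q x r" using insert.prems by blast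
  obtain e2 where e2: "e2 > 0" "\<forall>r. 0 < r \<and> r \<le> e2 \<longrightarrow> (\<forall>x\<in>F. Q x r)" using insert by blast
  show ?case by (intro exI[of _ "min e1 e2"]) (use e1 e2 in simp)
qed

section \<open>Baire category in Polish groups\<close>

context polish_grp
begin

lemma nhd_INT:
  assumes "finite S" "\<And>t. t \<in> S \<Longrightarrow> nhd (W t)"
  shows "nhd ((\<Inter>t\<in>S. W t) \<inter> carrier G)"
  using assms
proof (induction S rule: finite_induct)
  case empty show ?case using nhd_carrier by simp
next
  case (insert t S)
  have "nhd (W t \<inter> ((\<Inter>t\<in>S. W t) \<inter> carrier G))" by (rule nhd_Int) (use insert in simp_all)
  then show ?case by (simp add: Int_assoc)
qed

lemma closure_left_translate:
  assumes "g \<in> carrier G"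
  shows "(\<lambda>y. g \<otimes> y) ` (mtopology closure_of S) \<subseteq> mtopology closure_of ((\<lambda>y. g \<otimes> y) ` S)"
  by (rule continuous_map_image_closure_subset) (intro continuous_map_mult continuous_map_to_carrier assms, simp)

text \<open>The pair \<open>f\<close>, \<open>g\<close> is a self-homeomorphism with its inverse. It
  is used for translations and for translations composed with inversion.\<close>

lemma nowhere_dense_preimage:
  assumes L: "closedin mtopology L" "mtopology interior_of L = {}"
    and f: "continuous_map mtopology mtopology f" and g: "continuous_map mtopology mtopology g"
    and fg: "\<And>x. x \<in> carrier G \<Longrightarrow> f (g x) = x" "\<And>x. x \<in> carrier G \<Longrightarrow> g (f x) = x"
  shows "closedin mtopology {x \<in> carrier G. f x \<in> L}"
    "mtopology interior_of {x \<in> carrier G. f x \<in> L} = {}"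
proof -
  show "closedin mtopology {x \<in> carrier G. f x \<in> L}"
    using closedin_continuous_map_preimage[OF f L(1)] by simp
  show "mtopology interior_of {x \<in> carrier G. f x \<in> L} = {}"
  proof (rule ccontr)
    assume "mtopology interior_of {x \<in> carrier G. f x \<in> L} \<noteq> {}"
    then obtain x where x: "x \<in> mtopology interior_of {x \<in> carrier G. f x \<in> L}" by blast
    define U where "U = mtopology interior_of {x \<in> carrier G. f x \<in> L}"
    have U: "openin mtopology U" "x \<in> U" "U \<subseteq> {x \<in> carrier G. f x \<in> L}"
      using x by (simp_all add: U_def interior_of_subset)
    have "openin mtopology {y \<in> topspace mtopology. g y \<in> U}"
      by (rule openin_continuous_map_preimage[OF g U(1)])
    moreover have "{y \<in> topspace mtopology. g y \<in> U} \<subseteq> L"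
    proof
      fix y assume y: "y \<in> {y \<in> topspace mtopology. g y \<in> U}"
      then have "f (g y) \<in> L" using U(3) by blast
      then show "y \<in> L" using y fg(1) by simp
    qed
    ultimately have sub: "{y \<in> topspace mtopology. g y \<in> U} \<subseteq> mtopology interior_of L"
      by (rule interior_of_maximal[rotated])
    have xc: "x \<in> carrier G" using U by blast
    then have "f x \<in> carrier G" using continuous_map_image_subset_topspace[OF f] by auto
    then have "f x \<in> {y \<in> topspace mtopology. g y \<in> U}" using fg(2)[OF xc] U(2) by simp
    then show False using sub L(2) by blast
  qed
qed

text \<open>
  Mycielski's construction: \<open>x A\<close> is the product over \<open>A\<close> of a sequence of generic elements which
  converges to the identity fast enough.
\<close>

lemma perfect_independent_set:
  assumes comm: "comm_group G"
    and L: "\<And>i::nat. closedin mtopology (L i)" "\<And>i. mtopology interior_of (L i) = {}"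
  obtains x :: "nat set \<Rightarrow> 'a" where "\<And>A. x A \<in> carrier G"
    "\<And>A B. A \<noteq> B \<Longrightarrow> x A \<otimes> inv (x B) \<notin> (\<Union>i. L i)"
proof -
  interpret comm_group G by (rule comm)
  \<comment> \<open>In the quotient of two truncated products each stage contributes
    \<open>g\<close>, its inverse or nothing; \<open>grow\<close> collects the values changed by the
    new stage.\<close>
  define grow where "grow S g = (\<lambda>t. t \<otimes> g) ` S \<union> (\<lambda>t. t \<otimes> inv g) ` S" for S g
  \<comment> \<open>\<open>S\<close> contains all quotients possible so far. \<open>T\<close>
    contains those that have received a generic factor at some stage and therefore avoid every
    \<open>L i\<close>; the balls around them keep a distance from \<open>L 0\<close> up to
    \<open>L n\<close>.\<close>
  define ok where "ok n s \<longleftrightarrow> (case s of (g, S, T, r) \<Rightarrow> g \<in> carrier G \<and> finite S \<and> S \<subseteq> carrier G \<and> T \<subseteq> S \<and>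
      (\<forall>t\<in>T. \<forall>i. t \<notin> L i) \<and> 0 < r \<and> r \<le> (1/2) ^ n \<and> (\<forall>t\<in>T. \<forall>i\<le>n. mball t (4 * r) \<inter> L i = {}))"
    for n :: nat and s :: "'a \<times> 'a set \<times> 'a set \<times> real"
  define nxt where "nxt s s' \<longleftrightarrow> (case s of (g, S, T, r) \<Rightarrow> case s' of (g', S', T', r') \<Rightarrow>
      S' = S \<union> grow S g' \<and> T' = T \<union> grow S g' \<and> r' \<le> r / 2 \<and>
      (\<forall>t\<in>S. d t (t \<otimes> g') < r \<and> d t (t \<otimes> inv g') < r))"
    for s s' :: "'a \<times> 'a set \<times> 'a set \<times> real"
  have step: "\<exists>s'. ok (Suc n) s' \<and> nxt s s'" if s: "ok n s" for n s
  proof -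
    obtain g S T r where s_eq: "s = (g, S, T, r)" by (cases s)
    have S: "finite S" "S \<subseteq> carrier G" "T \<subseteq> S" "\<And>t i. t \<in> T \<Longrightarrow> t \<notin> L i" "0 < r" "r \<le> (1/2) ^ n"
      using s unfolding ok_def s_eq by simp_all
    have c1: "continuous_map mtopology mtopology (\<lambda>x. t \<otimes> x)" if "t \<in> S" for t
      using S that by (intro continuous_map_mult continuous_map_to_carrier) auto
    have c2: "continuous_map mtopology mtopology (\<lambda>x. t \<otimes> inv x)" if "t \<in> S" for t
      using S that by (intro continuous_map_mult continuous_map_to_carrier continuous_map_inv) auto
    define U where "U = (\<Inter>t\<in>S. {x \<in> carrier G. d t (t \<otimes> x) < r} \<inter> {x \<in> carrier G. d t (t \<otimes> inv x) < r}) \<inter> carrier G"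
    have "nhd ({x \<in> carrier G. d t (t \<otimes> x) < r} \<inter> {x \<in> carrier G. d t (t \<otimes> inv x) < r})" if "t \<in> S" for t
    proof (rule nhd_Int)
      have t: "t \<otimes> \<one> = t" "t \<otimes> inv \<one> = t" using that S by auto
      show "nhd {x \<in> carrier G. d t (t \<otimes> x) < r}"
        using nhd_ball[OF c1[OF that] S(5)] unfolding t .
      show "nhd {x \<in> carrier G. d t (t \<otimes> inv x) < r}"
        using nhd_ball[OF c2[OF that] S(5)] unfolding t .
    qed
    with S(1) have "nhd U" unfolding U_def by (rule nhd_INT)
    \<comment> \<open>These are the bad choices of the next generic element, those that put a new
      quotient into some \<open>L i\<close>. They are countably many closed sets with empty
      interior, so they cannot cover the neighbourhood \<open>U\<close>.\<close>
    define \<B> where "\<B> = (\<lambda>(t, i). {x \<in> carrier G. t \<otimes> x \<in> L i}) ` (S \<times> UNIV) \<union>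
        (\<lambda>(t, i). {x \<in> carrier G. t \<otimes> inv x \<in> L i}) ` (S \<times> UNIV)"
    have "mtopology interior_of \<Union>\<B> = {}"
    proof (rule metric_Baire_category_alt[OF mcomplete])
      show "countable \<B>" unfolding \<B>_def using S(1) by (simp add: countable_finite)
      fix Z assume "Z \<in> \<B>"
      then consider t i where "t \<in> S" "Z = {x \<in> carrier G. t \<otimes> x \<in> L i}"
        | t i where "t \<in> S" "Z = {x \<in> carrier G. t \<otimes> inv x \<in> L i}"
        unfolding \<B>_def by auto
      then show "closedin mtopology Z \<and> mtopology interior_of Z = {}"
      proof cases
        case 1
        have t: "t \<in> carrier G" using 1 S by blast
        have c: "continuous_map mtopology mtopology (\<lambda>x. inv t \<otimes> x)"
          using t by (intro continuous_map_mult continuous_map_to_carrier) auto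
        show ?thesis unfolding 1(2)
          by (intro conjI nowhere_dense_preimage[OF L c1[OF 1(1)] c])
            (use t in \<open>simp_all add: m_assoc[symmetric]\<close>)
      next
        case 2
        have t: "t \<in> carrier G" using 2 S by blast
        have c: "continuous_map mtopology mtopology (\<lambda>x. inv x \<otimes> t)"
          using t by (intro continuous_map_mult continuous_map_to_carrier continuous_map_inv) auto
        show ?thesis unfolding 2(2)
          by (intro conjI nowhere_dense_preimage[OF L c2[OF 2(1)] c])
            (use t in \<open>simp_all add: inv_mult_group m_assoc m_assoc[symmetric, of t "inv t"] m_assoc[symmetric, of _ "inv t" t]\<close>)
      qed
    qed
    then have "\<not> U \<subseteq> \<Union>\<B>"
      using \<open>nhd U\<close> interior_of_maximal[of U "\<Union>\<B>" mtopology] unfolding nhd_def by blast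
    then obtain g' where g': "g' \<in> U" "g' \<notin> \<Union>\<B>" by blast
    have gc: "g' \<in> carrier G" using g'(1) by (simp add: U_def)
    have close: "d t (t \<otimes> g') < r" "d t (t \<otimes> inv g') < r" if "t \<in> S" for t
      using g'(1) that by (auto simp: U_def)
    have avoid: "t \<otimes> g' \<notin> L i" "t \<otimes> inv g' \<notin> L i" if "t \<in> S" for t i
      using g'(2) gc that by (auto simp: \<B>_def)
    define S' where "S' = S \<union> grow S g'"
    define T' where "T' = T \<union> grow S g'"
    have S': "finite S'" "S' \<subseteq> carrier G" "T' \<subseteq> S'"
      using S gc by (auto simp: S'_def T'_def grow_def)
    have T': "t \<notin> L i" if "t \<in> T'" for t i
      using that S(4) avoid by (auto simp: T'_def grow_def)
    have fin: "finite (T' \<times> {..Suc n})" using S' finite_subset by blast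
    have "\<exists>e>0. \<forall>r. 0 < r \<and> r \<le> e \<longrightarrow> mball (fst z) (4 * r) \<inter> L (snd z) = {}" if "z \<in> T' \<times> {..Suc n}" for z
    proof -
      have z: "fst z \<in> carrier G - L (snd z)" using that T' S' by auto
      have "openin mtopology (carrier G - L (snd z))" using L(1) unfolding closedin_def by simp
      then obtain e where e: "e > 0" "mball (fst z) e \<subseteq> carrier G - L (snd z)"
        using z unfolding openin_mtopology by meson
      have "mball (fst z) (4 * r) \<inter> L (snd z) = {}" if "0 < r \<and> r \<le> e / 4" for r
      proof -
        have "mball (fst z) (4 * r) \<subseteq> mball (fst z) e" using that by (intro mball_subset_concentric) auto
        then show ?thesis using e(2) by blast
      qed
      then show ?thesis using e(1) by (intro exI[of _ "e / 4"]) simp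
    qed
    with fin have "\<exists>e>0. \<forall>r. 0 < r \<and> r \<le> e \<longrightarrow> (\<forall>z\<in>T' \<times> {..Suc n}. mball (fst z) (4 * r) \<inter> L (snd z) = {})"
      by (rule finite_uniform_radius)
    then obtain e where e: "e > 0" "\<forall>r. 0 < r \<and> r \<le> e \<longrightarrow> (\<forall>z\<in>T' \<times> {..Suc n}. mball (fst z) (4 * r) \<inter> L (snd z) = {})"
      by (elim exE conjE)
    \<comment> \<open>Because the radii at least halve, all future moves together amount to at most
      \<open>2 * r\<close>, which keeps the limit inside the ball of radius
      \<open>4 * r\<close>.\<close>
    define r' where "r' = min e (r / 2)"
    have r': "0 < r'" "r' \<le> e" "r' \<le> r / 2" using e S(5) by (auto simp: r'_def)
    have "\<forall>z\<in>T' \<times> {..Suc n}. mball (fst z) (4 * r') \<inter> L (snd z) = {}"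
      using e(2) r'(1,2) by (meson conjI)
    then have "\<forall>t\<in>T'. \<forall>i\<le>Suc n. mball t (4 * r') \<inter> L i = {}"
      by (simp add: Ball_def)
    moreover have "r' \<le> (1/2) ^ Suc n" using r'(3) S(6) by simp
    ultimately have "ok (Suc n) (g', S', T', r')"
      unfolding ok_def using gc S' T' r'(1) by simp
    moreover have "nxt s (g', S', T', r')"
      unfolding nxt_def s_eq using close r'(3) by (simp add: S'_def T'_def)
    ultimately show ?thesis by blast
  qed
  have init: "ok 0 (\<one>, {\<one>}, {}, 1)" by (simp add: ok_def)
  have "\<exists>s. \<forall>n. (ok n (s n) \<and> (n = 0 \<longrightarrow> s n = (\<one>, {\<one>}, {}, 1))) \<and> nxt (s n) (s (Suc n))"
    by (rule dependent_nat_choice) (use init step in auto)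
  then obtain s where s: "\<And>n. ok n (s n)" "s 0 = (\<one>, {\<one>}, {}, 1)" "\<And>n. nxt (s n) (s (Suc n))" by blast
  define g where "g n = fst (s (Suc n))" for n
  define S where "S n = fst (snd (s n))" for n
  define T where "T n = fst (snd (snd (s n)))" for n
  define r where "r n = snd (snd (snd (s n)))" for n
  have s_eq: "s n = (fst (s n), S n, T n, r n)" for n by (simp add: S_def T_def r_def)
  have ok: "S n \<subseteq> carrier G" "T n \<subseteq> S n" "0 < r n" "r n \<le> (1/2) ^ n"
    "\<And>t i. t \<in> T n \<Longrightarrow> i \<le> n \<Longrightarrow> mball t (4 * r n) \<inter> L i = {}" for n
    using s(1)[of n] unfolding ok_def by (subst (asm) s_eq, simp)+
  have gc: "g n \<in> carrier G" for n
    using s(1)[of "Suc n"] unfolding ok_def g_def by (subst (asm) s_eq, simp)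
  have nx: "S (Suc n) = S n \<union> grow (S n) (g n)" "T (Suc n) = T n \<union> grow (S n) (g n)" "r (Suc n) \<le> r n / 2"
    "\<And>t. t \<in> S n \<Longrightarrow> d t (t \<otimes> g n) < r n" "\<And>t. t \<in> S n \<Longrightarrow> d t (t \<otimes> inv g n) < r n" for n
    using s(3)[of n] unfolding nxt_def by (subst (asm) (1 2) s_eq, simp add: g_def)+
  have one: "\<one> \<in> S 0" by (simp add: S_def s(2))
  define p where "p A n = rec_nat \<one> (\<lambda>n x. x \<otimes> (if n \<in> A then g n else \<one>)) n" for A n
  have p_simps: "p A 0 = \<one>" "p A (Suc n) = p A n \<otimes> (if n \<in> A then g n else \<one>)" for A n
    by (simp_all add: p_def)
  have pc: "p A n \<in> carrier G" for A n by (induction n) (simp_all add: p_simps gc)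
  have move: "u \<otimes> h \<in> S (Suc n)" "d (u \<otimes> h) u \<le> r n" "h \<noteq> \<one> \<Longrightarrow> u \<otimes> h \<in> T (Suc n)"
    "u \<in> T n \<Longrightarrow> u \<otimes> h \<in> T (Suc n)"
    if u: "u \<in> S n" and h: "h = g n \<or> h = inv (g n) \<or> h = \<one>" for u h n
  proof -
    have uc: "u \<in> carrier G" using u ok(1) by blast
    show "u \<otimes> h \<in> S (Suc n)" using u h uc by (auto simp: nx(1) grow_def)
    show "d (u \<otimes> h) u \<le> r n"
      using h nx(4,5)[OF u] uc ok(3)[of n] commute[of "u \<otimes> h" u] by (elim disjE) auto
    show "u \<otimes> h \<in> T (Suc n)" if "h \<noteq> \<one>" using u h that by (auto simp: nx(2) grow_def)
    show "u \<otimes> h \<in> T (Suc n)" if "u \<in> T n" using u h that uc by (auto simp: nx(2) grow_def)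
  qed
  have pS: "p A n \<in> S n" for A n
    by (induction n) (use one move(1) in \<open>auto simp: p_simps\<close>)
  have "MCauchy (p A)" for A
  proof (rule MCauchy_geometric[where N = 0])
    show "d (p A (Suc n)) (p A n) \<le> (1/2) ^ n" for n
    proof -
      have "d (p A (Suc n)) (p A n) \<le> r n" unfolding p_simps by (rule move(2)[OF pS]) simp
      then show ?thesis using ok(4)[of n] by linarith
    qed
  qed (rule pc)
  then have "\<exists>x. limitin mtopology (p A) x sequentially" for A
    using mcomplete unfolding mcomplete_def by blast
  then obtain x where x: "\<And>A. limitin mtopology (p A) (x A) sequentially" by metis
  have xc: "x A \<in> carrier G" for A using x[of A] by (simp add: limitin_metric)
  have "x A \<otimes> inv (x B) \<notin> L m" if AB: "A \<noteq> B" for A B m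
  proof -
    obtain k where k: "k \<in> A \<longleftrightarrow> k \<notin> B" using AB by blast
    define y where "y n = p A n \<otimes> inv (p B n)" for n
    define h where "h n = (if n \<in> A then g n else \<one>) \<otimes> inv (if n \<in> B then g n else \<one>)" for n
    have h: "h n = g n \<or> h n = inv (g n) \<or> h n = \<one>" for n using gc by (simp add: h_def)
    have ySuc: "y (Suc n) = y n \<otimes> h n" for n
      using pc gc by (simp add: y_def p_simps h_def inv_mult m_ac)
    have yS: "y n \<in> S n" for n
    proof (induction n)
      case 0 show ?case using one by (simp add: y_def p_simps)
    next
      case (Suc n) then show ?case unfolding ySuc by (rule move(1)[OF _ h])
    qed
    have yT: "y n \<in> T n" if "Suc k \<le> n" for n
      using that
    proof (induction n rule: dec_induct)
      case base
      show ?case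
      proof (cases "g k = \<one>")
        \<comment> \<open>Even when the generic element is the identity, \<open>grow\<close> has put
          the unchanged quotient into \<open>T\<close>.\<close>
        case True
        then have "y k \<otimes> g k \<in> T (Suc k)" using yS[of k] by (auto simp: nx(2) grow_def)
        then show ?thesis unfolding ySuc using True by (simp add: h_def)
      next
        case False
        then have "h k \<noteq> \<one>" using k gc[of k] by (auto simp: h_def)
        then show ?thesis unfolding ySuc by (rule move(3)[OF yS h])
      qed
    next
      case (step n) then show ?case unfolding ySuc by (intro move(4)[OF yS h])
    qed
    have yc: "y n \<in> carrier G" for n using yS ok(1) by blast
    \<comment> \<open>From stage \<open>Suc k\<close> on the quotient belongs to \<open>T\<close>,
      and from stage \<open>m\<close> on the balls around \<open>T\<close> miss
      \<open>L m\<close>.\<close>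
    define n where "n = max m (Suc k)"
    have dist: "d (y (n + j)) (y n) \<le> 2 * r n - 2 * r (n + j)" for j
    proof (induction j)
      case (Suc j)
      have "d (y (n + Suc j)) (y n) \<le> d (y (Suc (n + j))) (y (n + j)) + d (y (n + j)) (y n)"
        using triangle yc by simp
      moreover have "d (y (Suc (n + j))) (y (n + j)) \<le> r (n + j)"
        unfolding ySuc by (rule move(2)[OF yS h])
      ultimately show ?case using Suc nx(3)[of "n + j"] by simp
    qed (use yc in simp)
    have lim: "limitin mtopology y (x A \<otimes> inv (x B)) sequentially"
    proof -
      have "limitin (prod_topology mtopology mtopology) (\<lambda>n. (p A n, p B n)) (x A, x B) sequentially"
        using x by (simp add: limitin_pairwise o_def)
      then have "limitin mtopology ((\<lambda>z. fst z \<otimes> inv (snd z)) \<circ> (\<lambda>n. (p A n, p B n))) (fst (x A, x B) \<otimes> inv (snd (x A, x B))) sequentially"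
        by (rule continuous_map_limit[rotated])
          (intro continuous_map_mult continuous_map_inv continuous_map_fst continuous_map_snd)
      then show ?thesis by (simp add: o_def y_def[abs_def])
    qed
    then have "\<forall>\<^sub>F j in sequentially. y j \<in> carrier G \<and> d (y j) (x A \<otimes> inv (x B)) < r n"
      using ok(3)[of n] unfolding limitin_metric by blast
    then obtain N where N: "\<And>j. N \<le> j \<Longrightarrow> d (y j) (x A \<otimes> inv (x B)) < r n"
      unfolding eventually_sequentially by blast
    have z: "x A \<otimes> inv (x B) \<in> carrier G" using xc by simp
    have "d (y n) (x A \<otimes> inv (x B)) \<le> d (y n) (y (n + N)) + d (y (n + N)) (x A \<otimes> inv (x B))"
      using triangle yc z by blast
    also have "\<dots> < 4 * r n"
      using dist[of N] N[of "n + N"] ok(3)[of n] ok(3)[of "n + N"] commute[of "y n" "y (n + N)"] by simp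
    finally have "x A \<otimes> inv (x B) \<in> mball (y n) (4 * r n)" using yc z by simp
    moreover have "mball (y n) (4 * r n) \<inter> L m = {}"
      by (rule ok(5)[OF yT]) (simp_all add: n_def)
    ultimately show ?thesis by blast
  qed
  then show ?thesis using that[of x] xc by blast
qed

end

section \<open>Images of continuous homomorphisms are open or meager\<close>

locale polish_grp_hom = K: polish_grp K dK + P: polish_grp P dP + group_hom K P \<phi>
  for K (structure) and dK and P (structure) and dP and \<phi> +
  assumes continuous: "continuous_map K.mtopology P.mtopology \<phi>"
begin

text \<open>The near openness of open mapping theorems: it can be tested by category arguments in
  the target, and completeness of the domain upgrades it to openness.\<close>

definition almost_open :: bool where
  "almost_open \<longleftrightarrow> (\<forall>U. K.nhd U \<longrightarrow> (\<exists>W. P.nhd W \<and> W \<subseteq> P.mtopology closure_of (\<phi> ` U)))"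

text \<open>Near openness at the identity is moved to an arbitrary point of the domain. The factor
  \<open>z\<close> allows the map and its translate by \<open>z\<close> to be treated alike.\<close>

lemma almost_open_translate:
  assumes "almost_open" "openin K.mtopology A" "a \<in> A" "z \<in> carrier P"
  obtains Q where "openin P.mtopology Q" "z \<otimes>\<^bsub>P\<^esub> \<phi> a \<in> Q"
    "Q \<subseteq> P.mtopology closure_of ((\<lambda>x. z \<otimes>\<^bsub>P\<^esub> \<phi> x) ` A)"
proof -
  have A: "A \<subseteq> carrier K" using openin_subset[OF assms(2)] by simp
  then have a: "a \<in> carrier K" using assms(3) by blast
  define U where "U = {x \<in> carrier K. a \<otimes>\<^bsub>K\<^esub> x \<in> A}"
  have "K.nhd U" unfolding U_def
  proof (rule K.nhd_preimage[OF _ assms(2)])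
    show "continuous_map K.mtopology K.mtopology (\<lambda>x. a \<otimes>\<^bsub>K\<^esub> x)"
      by (intro K.continuous_map_mult K.continuous_map_to_carrier a) simp
    show "a \<otimes>\<^bsub>K\<^esub> \<one>\<^bsub>K\<^esub> \<in> A" using a assms(3) by simp
  qed
  then obtain W where W: "P.nhd W" "W \<subseteq> P.mtopology closure_of (\<phi> ` U)"
    using assms(1) unfolding almost_open_def by meson
  let ?g = "z \<otimes>\<^bsub>P\<^esub> \<phi> a"
  have g: "?g \<in> carrier P" using a assms(4) by simp
  show ?thesis
  proof (rule that)
    show "openin P.mtopology ((\<lambda>y. ?g \<otimes>\<^bsub>P\<^esub> y) ` W)"
      using P.openin_left_translate[OF _ g] W(1) unfolding P.nhd_def by blast
    show "?g \<in> (\<lambda>y. ?g \<otimes>\<^bsub>P\<^esub> y) ` W"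
      using W(1) g unfolding P.nhd_def by (intro image_eqI[of _ _ "\<one>\<^bsub>P\<^esub>"]) auto
    have "(\<lambda>y. ?g \<otimes>\<^bsub>P\<^esub> y) ` W \<subseteq> (\<lambda>y. ?g \<otimes>\<^bsub>P\<^esub> y) ` (P.mtopology closure_of (\<phi> ` U))"
      by (rule image_mono[OF W(2)])
    also have "\<dots> \<subseteq> P.mtopology closure_of ((\<lambda>y. ?g \<otimes>\<^bsub>P\<^esub> y) ` (\<phi> ` U))"
      by (rule P.closure_left_translate[OF g])
    also have "\<dots> \<subseteq> P.mtopology closure_of ((\<lambda>x. z \<otimes>\<^bsub>P\<^esub> \<phi> x) ` A)"
    proof (rule closure_of_mono, rule subsetI)
      fix y assume "y \<in> (\<lambda>y. ?g \<otimes>\<^bsub>P\<^esub> y) ` (\<phi> ` U)"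
      then obtain u where u: "u \<in> U" "y = ?g \<otimes>\<^bsub>P\<^esub> \<phi> u" by auto
      then have "y = z \<otimes>\<^bsub>P\<^esub> \<phi> (a \<otimes>\<^bsub>K\<^esub> u)" using a assms(4) by (simp add: U_def P.m_assoc)
      then show "y \<in> (\<lambda>x. z \<otimes>\<^bsub>P\<^esub> \<phi> x) ` A" using u(1) by (auto simp: U_def)
    qed
    finally show "(\<lambda>y. ?g \<otimes>\<^bsub>P\<^esub> y) ` W \<subseteq> P.mtopology closure_of ((\<lambda>x. z \<otimes>\<^bsub>P\<^esub> \<phi> x) ` A)" .
  qed
qed

text \<open>
  For \<open>z\<close> near the identity, two sequences in the domain are built in
  alternation, one with images approaching a point and one with \<open>z\<close>-translated images approaching
  the same point; completeness of the domain then writes \<open>z\<close> as a quotient of two values of \<open>\<phi>\<close>.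
\<close>

lemma almost_open_imp_open:
  assumes ao: almost_open
  obtains W where "P.nhd W" "W \<subseteq> \<phi> ` carrier K"
proof -
  obtain W where W: "openin P.mtopology W" "\<one>\<^bsub>P\<^esub> \<otimes>\<^bsub>P\<^esub> \<phi> \<one>\<^bsub>K\<^esub> \<in> W"
    "W \<subseteq> P.mtopology closure_of ((\<lambda>x. \<one>\<^bsub>P\<^esub> \<otimes>\<^bsub>P\<^esub> \<phi> x) ` carrier K)"
    by (rule almost_open_translate[OF ao, of "carrier K" "\<one>\<^bsub>K\<^esub>" "\<one>\<^bsub>P\<^esub>"])
      (use K.nhd_carrier in \<open>simp_all add: K.nhd_def\<close>)
  have one_mult: "(\<lambda>x. \<one>\<^bsub>P\<^esub> \<otimes>\<^bsub>P\<^esub> \<phi> x) ` A = \<phi> ` A" if "A \<subseteq> carrier K" for A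
    using that by (intro image_cong) auto
  have "z \<in> \<phi> ` carrier K" if z: "z \<in> W" for z
  proof -
    have zc: "z \<in> carrier P" using z openin_subset[OF W(1)] by auto
    define zf where "zf x = z \<otimes>\<^bsub>P\<^esub> \<phi> x" for x
    have zf_in: "zf x \<in> carrier P" if "x \<in> carrier K" for x using that zc by (simp add: zf_def)
    \<comment> \<open>\<open>Q\<close> lies in both closures, so each nonempty open part of it
      contains a value of \<open>\<phi>\<close> on \<open>A\<close> and also a value of
      \<open>zf\<close> on \<open>B\<close>.\<close>
    define inv_st where "inv_st s \<longleftrightarrow> (case s of (A, B, Q, a, b) \<Rightarrow> openin K.mtopology A \<and> openin K.mtopology B \<and>
        openin P.mtopology Q \<and> Q \<noteq> {} \<and> Q \<subseteq> P.mtopology closure_of (\<phi> ` A) \<and> Q \<subseteq> P.mtopology closure_of (zf ` B))"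
      for s :: "'a set \<times> 'a set \<times> 'c set \<times> 'a \<times> 'a"
    define near where "near n s \<longleftrightarrow> (case s of (A, B, Q, a, b) \<Rightarrow> a \<in> A \<and> b \<in> B \<and>
        A \<subseteq> K.mball a ((1/2) ^ n) \<and> B \<subseteq> K.mball b ((1/2) ^ n) \<and> dP (\<phi> a) (zf b) < (1/2) ^ n)"
      for n :: nat and s :: "'a set \<times> 'a set \<times> 'c set \<times> 'a \<times> 'a"
    define nested where "nested s s' \<longleftrightarrow> fst s' \<subseteq> fst s \<and> fst (snd s') \<subseteq> fst (snd s)"
      for s s' :: "'a set \<times> 'a set \<times> 'c set \<times> 'a \<times> 'a"
    have step: "\<exists>s'. (inv_st s' \<and> near n s') \<and> nested s s'" if s: "inv_st s" for s n
    proof -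
      obtain A B Q a0 b0 where s_eq: "s = (A, B, Q, a0, b0)" by (cases s)
      have A: "openin K.mtopology A" and B: "openin K.mtopology B" and Q: "openin P.mtopology Q" "Q \<noteq> {}"
        and QA: "Q \<subseteq> P.mtopology closure_of (\<phi> ` A)" and QB: "Q \<subseteq> P.mtopology closure_of (zf ` B)"
        using s unfolding inv_st_def s_eq by simp_all
      have AK: "A \<subseteq> carrier K" and BK: "B \<subseteq> carrier K" using openin_subset[OF A] openin_subset[OF B] by simp_all
      let ?e = "(1/2::real) ^ n"
      obtain q where q: "q \<in> Q" using Q(2) by blast
      then have "q \<in> P.mtopology closure_of (\<phi> ` A)" using QA by blast
      then obtain y where "y \<in> \<phi> ` A" "y \<in> Q" using q Q(1) unfolding in_closure_of by meson
      then obtain a where a: "a \<in> A" "\<phi> a \<in> Q" by blast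
      have ac: "a \<in> carrier K" using a(1) AK by blast
      define A1 where "A1 = A \<inter> K.mball a ?e"
      have A1: "openin K.mtopology A1" "a \<in> A1" "A1 \<subseteq> A" "A1 \<subseteq> K.mball a ?e"
        unfolding A1_def using A a ac by (simp_all add: openin_Int)
      obtain Qa where Qa: "openin P.mtopology Qa" "\<one>\<^bsub>P\<^esub> \<otimes>\<^bsub>P\<^esub> \<phi> a \<in> Qa"
        "Qa \<subseteq> P.mtopology closure_of ((\<lambda>x. \<one>\<^bsub>P\<^esub> \<otimes>\<^bsub>P\<^esub> \<phi> x) ` A1)"
        by (rule almost_open_translate[OF ao A1(1,2) P.one_closed])
      have Qa': "\<phi> a \<in> Qa" "Qa \<subseteq> P.mtopology closure_of (\<phi> ` A1)"
        using Qa(2,3) ac one_mult[of A1] A1(3) AK by simp_all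
      \<comment> \<open>Shrinking around \<open>\<phi> a\<close> before choosing \<open>b\<close>
        forces \<open>zf b\<close> to be close to \<open>\<phi> a\<close>.\<close>
      define Q1 where "Q1 = Q \<inter> Qa \<inter> P.mball (\<phi> a) ?e"
      have Q1: "openin P.mtopology Q1" "\<phi> a \<in> Q1" unfolding Q1_def
        using Q(1) Qa(1) a(2) Qa'(1) ac by (simp_all add: openin_Int)
      have "\<phi> a \<in> P.mtopology closure_of (zf ` B)" using QB a(2) by blast
      then obtain y where "y \<in> zf ` B" "y \<in> Q1" using Q1 unfolding in_closure_of by meson
      then obtain b where b: "b \<in> B" "zf b \<in> Q1" by blast
      have bc: "b \<in> carrier K" using b(1) BK by blast
      define B1 where "B1 = B \<inter> K.mball b ?e"
      have B1: "openin K.mtopology B1" "b \<in> B1" "B1 \<subseteq> B" "B1 \<subseteq> K.mball b ?e"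
        unfolding B1_def using B b bc by (simp_all add: openin_Int)
      obtain Qb where Qb: "openin P.mtopology Qb" "zf b \<in> Qb" "Qb \<subseteq> P.mtopology closure_of (zf ` B1)"
        unfolding zf_def by (rule almost_open_translate[OF ao B1(1,2) zc])
      define Q2 where "Q2 = Q1 \<inter> Qb"
      have Q2: "openin P.mtopology Q2" "Q2 \<noteq> {}" "Q2 \<subseteq> P.mtopology closure_of (\<phi> ` A1)"
        "Q2 \<subseteq> P.mtopology closure_of (zf ` B1)"
      proof -
        show "openin P.mtopology Q2" unfolding Q2_def using Q1(1) Qb(1) by (rule openin_Int)
        show "Q2 \<noteq> {}" unfolding Q2_def using b(2) Qb(2) by blast
        show "Q2 \<subseteq> P.mtopology closure_of (\<phi> ` A1)" using Qa'(2) unfolding Q2_def Q1_def by blast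
        show "Q2 \<subseteq> P.mtopology closure_of (zf ` B1)" using Qb(3) unfolding Q2_def by blast
      qed
      have "dP (\<phi> a) (zf b) < ?e" using b(2) by (simp add: Q1_def)
      then show ?thesis
        by (intro exI[of _ "(A1, B1, Q2, a, b)"])
          (simp add: inv_st_def near_def nested_def s_eq A1 B1 Q2)
    qed
    obtain Q0 where Q0: "openin P.mtopology Q0" "z \<otimes>\<^bsub>P\<^esub> \<phi> \<one>\<^bsub>K\<^esub> \<in> Q0"
      "Q0 \<subseteq> P.mtopology closure_of ((\<lambda>x. z \<otimes>\<^bsub>P\<^esub> \<phi> x) ` carrier K)"
      by (rule almost_open_translate[OF ao, of "carrier K" "\<one>\<^bsub>K\<^esub>" z])
        (use K.nhd_carrier zc in \<open>simp_all add: K.nhd_def\<close>)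
    have "inv_st (carrier K, carrier K, W \<inter> Q0, \<one>\<^bsub>K\<^esub>, \<one>\<^bsub>K\<^esub>)"
    proof -
      have "openin K.mtopology (carrier K)" using K.nhd_carrier by (simp add: K.nhd_def)
      moreover have "z \<in> W \<inter> Q0" using z Q0(2) zc by simp
      moreover have "W \<subseteq> P.mtopology closure_of (\<phi> ` carrier K)" using W(3) one_mult[of "carrier K"] by simp
      moreover have "Q0 \<subseteq> P.mtopology closure_of (zf ` carrier K)" using Q0(3) unfolding zf_def .
      ultimately show ?thesis unfolding inv_st_def using W(1) Q0(1) openin_Int by fastforce
    qed
    \<comment> \<open>The starting state need not satisfy the closeness condition, so one step is
      made in advance.\<close>
    then obtain s0 where s0: "inv_st s0" "near 0 s0" using step[of _ 0] by meson
    have "\<exists>s. \<forall>n. (inv_st (s n) \<and> near n (s n)) \<and> nested (s n) (s (Suc n))"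
      by (rule dependent_nat_choice) (use s0 step in meson)+
    then obtain s where s: "\<And>n. inv_st (s n)" "\<And>n. near n (s n)" "\<And>n. nested (s n) (s (Suc n))" by meson
    define A where "A n = fst (s n)" for n
    define B where "B n = fst (snd (s n))" for n
    define Q where "Q n = fst (snd (snd (s n)))" for n
    define a where "a n = fst (snd (snd (snd (s n))))" for n
    define b where "b n = snd (snd (snd (snd (s n))))" for n
    have s_eq: "s n = (A n, B n, Q n, a n, b n)" for n by (simp add: A_def B_def Q_def a_def b_def)
    have near: "a n \<in> A n" "b n \<in> B n" "A n \<subseteq> K.mball (a n) ((1/2) ^ n)" "B n \<subseteq> K.mball (b n) ((1/2) ^ n)"
      "dP (\<phi> (a n)) (zf (b n)) < (1/2) ^ n" for n
      using s(2)[of n] unfolding near_def s_eq by simp_all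
    have sub: "A (Suc n) \<subseteq> A n" "B (Suc n) \<subseteq> B n" for n
      using s(3)[of n] unfolding nested_def by (simp_all add: A_def B_def)
    have ab: "a n \<in> carrier K" "b n \<in> carrier K" for n
      using near(1-4)[of n] by auto
    have "K.MCauchy a"
    proof (rule K.MCauchy_geometric[where N = 0])
      show "dK (a (Suc n)) (a n) \<le> (1/2) ^ n" for n
        using near(1)[of "Suc n"] sub(1)[of n] near(3)[of n] K.commute[of "a n" "a (Suc n)"] by auto
    qed (rule ab)
    then obtain la where la: "limitin K.mtopology a la sequentially"
      using K.mcomplete unfolding K.mcomplete_def by blast
    have "K.MCauchy b"
    proof (rule K.MCauchy_geometric[where N = 0])
      show "dK (b (Suc n)) (b n) \<le> (1/2) ^ n" for n
        using near(2)[of "Suc n"] sub(2)[of n] near(4)[of n] K.commute[of "b n" "b (Suc n)"] by auto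
    qed (rule ab)
    then obtain lb where lb: "limitin K.mtopology b lb sequentially"
      using K.mcomplete unfolding K.mcomplete_def by blast
    have lab: "la \<in> carrier K" "lb \<in> carrier K" using la lb by (simp_all add: K.limitin_metric)
    have cont_zf: "continuous_map K.mtopology P.mtopology zf"
      unfolding zf_def[abs_def] by (intro P.continuous_map_mult P.continuous_map_to_carrier zc continuous)
    have "limitin P.mtopology (\<phi> \<circ> a) (\<phi> la) sequentially" by (rule continuous_map_limit[OF continuous la])
    then have "limitin P.mtopology (zf \<circ> b) (\<phi> la) sequentially"
      by (rule P.limitin_close_sequence) (use ab near(5) zf_in in \<open>simp_all add: less_imp_le\<close>)
    moreover have "limitin P.mtopology (zf \<circ> b) (zf lb) sequentially" by (rule continuous_map_limit[OF cont_zf lb])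
    ultimately have "\<phi> la = zf lb"
      by (rule P.limitin_metric_unique) simp
    then have "z = \<phi> la \<otimes>\<^bsub>P\<^esub> inv\<^bsub>P\<^esub> \<phi> lb" using zc lab by (simp add: zf_def P.m_assoc)
    also have "\<dots> = \<phi> (la \<otimes>\<^bsub>K\<^esub> inv\<^bsub>K\<^esub> lb)" using lab by simp
    finally show ?thesis using lab by blast
  qed
  moreover have "P.nhd W" using W by (simp add: P.nhd_def)
  ultimately show ?thesis using that by blast
qed

text \<open>Let \<open>U\<close> witness the failure and let \<open>V\<close> be so small that
  \<open>inv x \<otimes> y\<close> stays in \<open>U\<close>. If the closure of the image of
  \<open>V\<close> had interior, dividing by one of its values would give a neighbourhood of the
  identity inside the closure of the image of \<open>U\<close>. Countably many translates of
  \<open>V\<close> cover the domain.\<close>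

lemma not_almost_open_imp_meager:
  assumes "\<not> almost_open"
  obtains L :: "nat \<Rightarrow> 'c set" where "\<And>i. closedin P.mtopology (L i)" "\<And>i. P.mtopology interior_of (L i) = {}"
    "\<phi> ` carrier K \<subseteq> (\<Union>i. L i)"
proof -
  obtain U where U: "K.nhd U" "\<And>W. P.nhd W \<Longrightarrow> \<not> W \<subseteq> P.mtopology closure_of (\<phi> ` U)"
    using assms unfolding almost_open_def by meson
  obtain V where V: "K.nhd V" "\<And>x y. x \<in> V \<Longrightarrow> y \<in> V \<Longrightarrow> inv\<^bsub>K\<^esub> x \<otimes>\<^bsub>K\<^esub> y \<in> U"
    by (rule K.nhd_div[OF U(1)]) (rule that)
  have VK: "V \<subseteq> carrier K" by (rule K.nhd_subset[OF V(1)])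
  define F where "F = P.mtopology closure_of (\<phi> ` V)"
  have F: "closedin P.mtopology F" by (simp add: F_def)
  have F_int: "P.mtopology interior_of F = {}"
  proof (rule ccontr)
    assume "P.mtopology interior_of F \<noteq> {}"
    then obtain q where q: "q \<in> P.mtopology interior_of F" by blast
    define Q where "Q = P.mtopology interior_of F"
    have Q: "openin P.mtopology Q" "q \<in> Q" "Q \<subseteq> F" using q by (simp_all add: Q_def interior_of_subset)
    then have "q \<in> P.mtopology closure_of (\<phi> ` V)" unfolding F_def by blast
    then obtain y where "y \<in> \<phi> ` V" "y \<in> Q" using Q(1,2) unfolding in_closure_of by meson
    then obtain v where v: "v \<in> V" "\<phi> v \<in> Q" by blast
    have vc: "v \<in> carrier K" using v VK by blast
    let ?g = "inv\<^bsub>P\<^esub> \<phi> v"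
    have g: "?g \<in> carrier P" using vc by simp
    define W where "W = (\<lambda>y. ?g \<otimes>\<^bsub>P\<^esub> y) ` Q"
    have "P.nhd W" unfolding P.nhd_def
    proof
      show "openin P.mtopology W" unfolding W_def by (rule P.openin_left_translate[OF Q(1) g])
      show "\<one>\<^bsub>P\<^esub> \<in> W" unfolding W_def using v vc by (intro image_eqI[of _ _ "\<phi> v"]) auto
    qed
    moreover have "W \<subseteq> P.mtopology closure_of (\<phi> ` U)"
    proof -
      have "W \<subseteq> (\<lambda>y. ?g \<otimes>\<^bsub>P\<^esub> y) ` (P.mtopology closure_of (\<phi> ` V))"
        unfolding W_def using Q(3) unfolding F_def by (rule image_mono)
      also have "\<dots> \<subseteq> P.mtopology closure_of ((\<lambda>y. ?g \<otimes>\<^bsub>P\<^esub> y) ` (\<phi> ` V))"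
        by (rule P.closure_left_translate[OF g])
      also have "\<dots> \<subseteq> P.mtopology closure_of (\<phi> ` U)"
      proof (rule closure_of_mono, rule subsetI)
        fix y assume "y \<in> (\<lambda>y. ?g \<otimes>\<^bsub>P\<^esub> y) ` (\<phi> ` V)"
        then obtain x where x: "x \<in> V" "y = ?g \<otimes>\<^bsub>P\<^esub> \<phi> x" by auto
        then have "y = \<phi> (inv\<^bsub>K\<^esub> v \<otimes>\<^bsub>K\<^esub> x)" using vc VK by auto
        then show "y \<in> \<phi> ` U" using V(2)[OF v(1) x(1)] by blast
      qed
      finally show ?thesis .
    qed
    ultimately show False using U(2) by blast
  qed
  obtain D where D: "countable D" "D \<subseteq> carrier K" "\<And>g. g \<in> carrier K \<Longrightarrow> \<exists>k\<in>D. inv\<^bsub>K\<^esub> k \<otimes>\<^bsub>K\<^esub> g \<in> V"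
    by (rule K.countable_translates[OF V(1)]) (rule that)
  have "D \<noteq> {}" using D(3)[OF K.one_closed] by blast
  define k where "k = from_nat_into D"
  have k: "range k = D" using range_from_nat_into[OF \<open>D \<noteq> {}\<close> D(1)] by (simp add: k_def)
  have kc: "k i \<in> carrier K" for i using k D(2) by blast
  define L where "L i = {y \<in> carrier P. inv\<^bsub>P\<^esub> \<phi> (k i) \<otimes>\<^bsub>P\<^esub> y \<in> F}" for i
  have c: "continuous_map P.mtopology P.mtopology (\<lambda>y. g \<otimes>\<^bsub>P\<^esub> y)" if "g \<in> carrier P" for g
    by (intro P.continuous_map_mult P.continuous_map_to_carrier that) simp
  have ki: "\<phi> (k i) \<in> carrier P" "inv\<^bsub>P\<^esub> \<phi> (k i) \<in> carrier P" for i using kc by simp_all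
  have cancel: "inv\<^bsub>P\<^esub> \<phi> (k i) \<otimes>\<^bsub>P\<^esub> (\<phi> (k i) \<otimes>\<^bsub>P\<^esub> y) = y" "\<phi> (k i) \<otimes>\<^bsub>P\<^esub> (inv\<^bsub>P\<^esub> \<phi> (k i) \<otimes>\<^bsub>P\<^esub> y) = y"
    if "y \<in> carrier P" for y i
    using that ki[of i] by (simp_all add: P.m_assoc[symmetric])
  show ?thesis
  proof (rule that[of L])
    show "closedin P.mtopology (L i)" for i
      unfolding L_def by (rule P.nowhere_dense_preimage[OF F F_int c[OF ki(2)] c[OF ki(1)[of i]]]) (use cancel in simp_all)
    show "P.mtopology interior_of (L i) = {}" for i
      unfolding L_def by (rule P.nowhere_dense_preimage[OF F F_int c[OF ki(2)] c[OF ki(1)[of i]]]) (use cancel in simp_all)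
    show "\<phi> ` carrier K \<subseteq> (\<Union>i. L i)"
    proof (rule image_subsetI)
      fix g assume g: "g \<in> carrier K"
      obtain h where h: "h \<in> D" "inv\<^bsub>K\<^esub> h \<otimes>\<^bsub>K\<^esub> g \<in> V" using D(3)[OF g] by blast
      then obtain i where i: "h = k i" using k by blast
      have "\<phi> (inv\<^bsub>K\<^esub> h \<otimes>\<^bsub>K\<^esub> g) \<in> F" unfolding F_def
        using h(2) VK by (intro subsetD[OF closure_of_subset]) auto
      then have "\<phi> g \<in> L i" using g kc i by (simp add: L_def)
      then show "\<phi> g \<in> (\<Union>i. L i)" by blast
    qed
  qed
qed

text \<open>If the image contains a neighbourhood of the identity, an uncountable family has two
  members in one coset, contrary to \<open>ineq\<close>. So the image is meager, and Mycielski's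
  construction supplies continuum many cosets.\<close>

lemma uncountable_index_imp_continuum:
  assumes comm: "comm_group P"
    and X: "uncountable X" "\<And>i. i \<in> X \<Longrightarrow> c i \<in> carrier P"
    and ineq: "\<And>i j. i \<in> X \<Longrightarrow> j \<in> X \<Longrightarrow> i \<noteq> j \<Longrightarrow> c i \<otimes>\<^bsub>P\<^esub> inv\<^bsub>P\<^esub> c j \<notin> \<phi> ` carrier K"
  obtains x :: "nat set \<Rightarrow> 'c" where "\<And>A. x A \<in> carrier P"
    "\<And>A B. A \<noteq> B \<Longrightarrow> x A \<otimes>\<^bsub>P\<^esub> inv\<^bsub>P\<^esub> x B \<notin> \<phi> ` carrier K"
proof (cases almost_open)
  case True
  then obtain W where W: "P.nhd W" "W \<subseteq> \<phi> ` carrier K" by (rule almost_open_imp_open)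
  obtain i j where "i \<in> X" "j \<in> X" "i \<noteq> j" "c i \<otimes>\<^bsub>P\<^esub> inv\<^bsub>P\<^esub> c j \<in> W"
    by (rule P.uncountable_close_pair[OF X W(1)])
  then show ?thesis using ineq[of i j] subsetD[OF W(2)] by simp
next
  case False
  then obtain L :: "nat \<Rightarrow> 'c set" where L: "\<And>i. closedin P.mtopology (L i)" "\<And>i. P.mtopology interior_of (L i) = {}"
    "\<phi> ` carrier K \<subseteq> (\<Union>i. L i)" by (rule not_almost_open_imp_meager) (rule that)
  obtain x :: "nat set \<Rightarrow> 'c" where x: "\<And>A. x A \<in> carrier P"
    "\<And>A B. A \<noteq> B \<Longrightarrow> x A \<otimes>\<^bsub>P\<^esub> inv\<^bsub>P\<^esub> (x B) \<notin> (\<Union>i. L i)"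
    by (rule P.perfect_independent_set[OF comm L(1,2)]) (rule that)
  show ?thesis
  proof (rule that[of x, OF x(1)])
    show "x A \<otimes>\<^bsub>P\<^esub> inv\<^bsub>P\<^esub> x B \<notin> \<phi> ` carrier K" if "A \<noteq> B" for A B
      using x(2)[OF that] subsetD[OF L(3)] by (rule contrapos_nn)
  qed
qed

end

section \<open>Closed subgroups and products of Polish groups\<close>

text \<open>A dense set of the whole space may miss \<open>S\<close>. So for every dense point and
  every radius \<open>(1/2) ^ n\<close> some point of \<open>S\<close> within that radius is
  selected, whenever there is one.\<close>

lemma separable_metrizable_subtopology:
  assumes "metrizable_space T" "Defs.separable_space T" "S \<subseteq> topspace T"
  shows "Defs.separable_space (subtopology T S)"
proof -
  obtain M d where Md: "Metric_space M d" "T = Metric_space.mtopology M d"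
    using assms(1) unfolding metrizable_space_def by blast
  interpret Metric_space M d by (rule Md(1))
  have M: "topspace T = M" using Md(2) by simp
  obtain D where D: "D \<subseteq> M" "countable D" "T closure_of D = M"
    using assms(2) unfolding Defs.separable_space_def M by blast
  define f where "f = (\<lambda>(a, n::nat). SOME s. s \<in> S \<and> d a s < (1/2) ^ n)"
  define I where "I = {(a, n). a \<in> D \<and> (\<exists>s. s \<in> S \<and> d a s < (1/2) ^ n)}"
  have f: "f (a, n) \<in> S" "d a (f (a, n)) < (1/2) ^ n" if "(a, n) \<in> I" for a n
  proof -
    have "\<exists>s. s \<in> S \<and> d a s < (1/2) ^ n" using that by (simp add: I_def)
    from someI_ex[OF this] show "f (a, n) \<in> S" "d a (f (a, n)) < (1/2) ^ n" by (simp_all add: f_def)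
  qed
  have "countable I"
    by (rule countable_subset[of _ "D \<times> UNIV"]) (use D(2) in \<open>auto simp: I_def\<close>)
  define C where "C = f ` I"
  have C: "countable C" "C \<subseteq> S" using \<open>countable I\<close> f(1) by (auto simp: C_def)
  have S: "S \<subseteq> M" using assms(3) M by simp
  have "s \<in> subtopology T S closure_of C" if s: "s \<in> S" for s
    unfolding in_closure_of
  proof (intro conjI allI impI)
    show "s \<in> topspace (subtopology T S)" using s assms(3) by auto
    fix U assume "s \<in> U \<and> openin (subtopology T S) U"
    then obtain U' where U': "openin T U'" "U = U' \<inter> S" "s \<in> U'"
      unfolding openin_subtopology by blast
    then obtain e where e: "e > 0" "mball s e \<subseteq> U'"
      unfolding Md(2) openin_mtopology by meson
    obtain n where n: "(1/2::real) ^ n < e / 2" using real_arch_pow_inv[of "e/2" "1/2"] e(1) by auto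
    have sM: "s \<in> M" using s S by blast
    have "s \<in> T closure_of D" using sM D(3) by simp
    moreover have "openin T (mball s ((1/2) ^ n))" "s \<in> mball s ((1/2) ^ n)" using sM by (simp_all add: Md(2))
    ultimately obtain a where a: "a \<in> D" "a \<in> mball s ((1/2) ^ n)" unfolding in_closure_of by meson
    have aM: "a \<in> M" using a(2) by simp
    have "(a, n) \<in> I" using a s commute[of a s] by (auto simp: I_def)
    note fa = f[OF this]
    have fM: "f (a, n) \<in> M" using fa(1) S by blast
    have "d s (f (a, n)) \<le> d s a + d a (f (a, n))" by (rule triangle[OF sM aM fM])
    also have "\<dots> < e" using a(2) fa(2) n by simp
    finally have "f (a, n) \<in> U'" using e(2) sM fM by auto
    then have "f (a, n) \<in> U" using U'(2) fa(1) by blast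
    moreover have "f (a, n) \<in> C" using \<open>(a, n) \<in> I\<close> by (simp add: C_def)
    ultimately show "\<exists>y. y \<in> C \<and> y \<in> U" by blast
  qed
  moreover have "topspace (subtopology T S) = S" using assms(3) by auto
  ultimately show ?thesis unfolding Defs.separable_space_def
    using C closure_of_subset_topspace[of "subtopology T S" C] by (intro exI[of _ C]) auto
qed

lemma polish_group_topology_subgroup:
  assumes G: "group G" and T: "polish_group_topology G T" and H: "subgroup H G" "closedin T H"
  shows "polish_group_topology (G\<lparr>carrier := H\<rparr>) (subtopology T H)"
proof -
  interpret group G by (rule G)
  interpret H: subgroup H G by (rule H(1))
  have ts: "topspace T = carrier G" and mult: "continuous_map (prod_topology T T) T (\<lambda>(x, y). x \<otimes>\<^bsub>G\<^esub> y)"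
    and inv: "continuous_map T T (\<lambda>x. inv\<^bsub>G\<^esub> x)"
    and sep: "Defs.separable_space T" and cm: "completely_metrizable_space T"
    using T by (simp_all add: polish_group_topology_def group_topology_def)
  have tsH: "topspace (subtopology T H) = H" using ts H.subset by auto
  have prod: "prod_topology (subtopology T H) (subtopology T H) = subtopology (prod_topology T T) (H \<times> H)"
    by (simp add: subtopology_Times)
  have "continuous_map (prod_topology (subtopology T H) (subtopology T H)) (subtopology T H)
      (\<lambda>(x, y). x \<otimes>\<^bsub>G\<^esub> y)"
    unfolding prod
  proof (rule continuous_map_into_subtopology[OF continuous_map_from_subtopology[OF mult]])
    show "(\<lambda>(x, y). x \<otimes>\<^bsub>G\<^esub> y) \<in> topspace (subtopology (prod_topology T T) (H \<times> H)) \<rightarrow> H" by auto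
  qed
  moreover have "continuous_map (subtopology T H) (subtopology T H) (\<lambda>x. inv\<^bsub>G\<lparr>carrier := H\<rparr>\<^esub> x)"
  proof (rule continuous_map_eq)
    show "continuous_map (subtopology T H) (subtopology T H) (\<lambda>x. inv\<^bsub>G\<^esub> x)"
      by (rule continuous_map_into_subtopology[OF continuous_map_from_subtopology[OF inv]]) auto
    show "inv\<^bsub>G\<^esub> x = inv\<^bsub>G\<lparr>carrier := H\<rparr>\<^esub> x" if "x \<in> topspace (subtopology T H)" for x
      using m_inv_consistent[OF H(1)] that tsH by simp
  qed
  moreover have "Defs.separable_space (subtopology T H)"
    by (rule separable_metrizable_subtopology)
      (use cm sep ts H.subset completely_metrizable_imp_metrizable_space in auto)
  moreover have "completely_metrizable_space (subtopology T H)"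
    by (rule completely_metrizable_space_closedin[OF cm H(2)])
  ultimately show ?thesis using tsH
    by (simp add: polish_group_topology_def group_topology_def)
qed

lemma polish_group_topology_DirProd:
  assumes G: "group G" "polish_group_topology G S" and H: "group H" "polish_group_topology H T"
  shows "polish_group_topology (G \<times>\<times> H) (prod_topology S T)"
proof -
  have S: "topspace S = carrier G" "continuous_map (prod_topology S S) S (\<lambda>(x, y). x \<otimes>\<^bsub>G\<^esub> y)"
    "continuous_map S S (\<lambda>x. inv\<^bsub>G\<^esub> x)" "Defs.separable_space S" "completely_metrizable_space S"
    using G(2) by (simp_all add: polish_group_topology_def group_topology_def)
  have T: "topspace T = carrier H" "continuous_map (prod_topology T T) T (\<lambda>(x, y). x \<otimes>\<^bsub>H\<^esub> y)"
    "continuous_map T T (\<lambda>x. inv\<^bsub>H\<^esub> x)" "Defs.separable_space T" "completely_metrizable_space T"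
    using H(2) by (simp_all add: polish_group_topology_def group_topology_def)
  let ?P = "prod_topology S T"
  have ff: "continuous_map (prod_topology ?P ?P) S (fst \<circ> fst)" "continuous_map (prod_topology ?P ?P) S (fst \<circ> snd)"
    "continuous_map (prod_topology ?P ?P) T (snd \<circ> fst)" "continuous_map (prod_topology ?P ?P) T (snd \<circ> snd)"
    by (rule continuous_map_compose[OF continuous_map_fst continuous_map_fst]
      continuous_map_compose[OF continuous_map_snd continuous_map_fst]
      continuous_map_compose[OF continuous_map_fst continuous_map_snd]
      continuous_map_compose[OF continuous_map_snd continuous_map_snd])+
  have 1: "continuous_map (prod_topology ?P ?P) ?P (\<lambda>(x, y). x \<otimes>\<^bsub>G \<times>\<times> H\<^esub> y)"
  proof (rule continuous_map_eq)
    show "continuous_map (prod_topology ?P ?P) ?P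
      (\<lambda>z. (((\<lambda>(x, y). x \<otimes>\<^bsub>G\<^esub> y) \<circ> (\<lambda>z. ((fst \<circ> fst) z, (fst \<circ> snd) z))) z,
            ((\<lambda>(x, y). x \<otimes>\<^bsub>H\<^esub> y) \<circ> (\<lambda>z. ((snd \<circ> fst) z, (snd \<circ> snd) z))) z))"
      by (rule continuous_map_pairedI; rule continuous_map_compose[OF continuous_map_pairedI])
        (rule ff S(2) T(2))+
    show "(((\<lambda>(x, y). x \<otimes>\<^bsub>G\<^esub> y) \<circ> (\<lambda>z. ((fst \<circ> fst) z, (fst \<circ> snd) z))) z,
            ((\<lambda>(x, y). x \<otimes>\<^bsub>H\<^esub> y) \<circ> (\<lambda>z. ((snd \<circ> fst) z, (snd \<circ> snd) z))) z) = (\<lambda>(x, y). x \<otimes>\<^bsub>G \<times>\<times> H\<^esub> y) z" for z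
      by (simp add: DirProd_def split: prod.splits)
  qed
  have 2: "continuous_map ?P ?P (\<lambda>x. inv\<^bsub>G \<times>\<times> H\<^esub> x)"
  proof (rule continuous_map_eq)
    show "continuous_map ?P ?P (\<lambda>z. (((\<lambda>x. inv\<^bsub>G\<^esub> x) \<circ> fst) z, ((\<lambda>x. inv\<^bsub>H\<^esub> x) \<circ> snd) z))"
      by (rule continuous_map_pairedI)
        (rule continuous_map_compose[OF continuous_map_fst S(3)] continuous_map_compose[OF continuous_map_snd T(3)])+
    show "(((\<lambda>x. inv\<^bsub>G\<^esub> x) \<circ> fst) z, ((\<lambda>x. inv\<^bsub>H\<^esub> x) \<circ> snd) z) = inv\<^bsub>G \<times>\<times> H\<^esub> z"
      if "z \<in> topspace ?P" for z
      using that inv_DirProd[OF G(1) H(1)] S(1) T(1) by (cases z) simp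
  qed
  have 3: "Defs.separable_space ?P"
  proof -
    obtain D where D: "D \<subseteq> carrier G" "countable D" "S closure_of D = carrier G"
      using S(4) unfolding Defs.separable_space_def S(1) by blast
    obtain C where C: "C \<subseteq> carrier H" "countable C" "T closure_of C = carrier H"
      using T(4) unfolding Defs.separable_space_def T(1) by blast
    have "?P closure_of (D \<times> C) = carrier G \<times> carrier H"
      by (simp add: closure_of_Times D C)
    then show ?thesis unfolding Defs.separable_space_def
      using D(1,2) C(1,2) S(1) T(1) by (intro exI[of _ "D \<times> C"]) (simp add: Sigma_mono)
  qed
  have 4: "completely_metrizable_space ?P"
    using S(5) T(5) by (simp add: completely_metrizable_space_prod_topology)
  have "topspace ?P = carrier (G \<times>\<times> H)" using S(1) T(1) by (simp add: DirProd_def)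
  then show ?thesis using 1 2 3 4
    by (simp add: polish_group_topology_def group_topology_def)
qed

lemma (in polish_grp) polish_group_topology_mtopology: "polish_group_topology G mtopology"
  using continuous_mult continuous_inv separable completely_metrizable_space_mtopology[OF mcomplete]
  by (simp add: polish_group_topology_def group_topology_def Defs.separable_space_def)

text \<open>A point is recovered from the set of balls containing it, among the balls with radius a
  power of \<open>1/2\<close> around the points of a countable dense set.\<close>

lemma (in polish_grp) carrier_lepoll_continuum: "carrier G \<lesssim> (UNIV :: nat set set)"
proof -
  obtain D where D: "D \<subseteq> carrier G" "countable D" "mtopology closure_of D = carrier G"
    using separable by blast
  have dense: "\<exists>a\<in>D. d x a < r" if x: "x \<in> carrier G" and r: "0 < r" for x r
  proof -
    have "x \<in> mtopology closure_of D" using x D(3) by simp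
    moreover have "openin mtopology (mball x r)" "x \<in> mball x r" using x r by simp_all
    ultimately obtain a where "a \<in> D" "a \<in> mball x r" unfolding in_closure_of by meson
    then show ?thesis by auto
  qed
  then have "D \<noteq> {}" using one_closed zero_less_one by blast
  define a where "a = from_nat_into D"
  have a: "range a = D" using range_from_nat_into[OF \<open>D \<noteq> {}\<close> D(2)] by (simp add: a_def)
  define f where "f x = {k. d x (a (fst (prod_decode k))) < (1/2) ^ snd (prod_decode k)}" for x
  have "inj_on f (carrier G)"
  proof (rule inj_onI, rule ccontr)
    fix x y assume xy: "x \<in> carrier G" "y \<in> carrier G" "f x = f y" "x \<noteq> y"
    have e: "d x y > 0" using mdist_pos_less[OF xy(4,1,2)] .
    obtain n where n: "(1/2::real) ^ n < d x y / 2" using real_arch_pow_inv[of "d x y/2" "1/2"] e by auto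
    obtain i where i: "d x (a i) < (1/2) ^ n" using dense[OF xy(1), of "(1/2) ^ n"] a by auto
    have ai: "a i \<in> carrier G" using a D(1) by blast
    have "prod_encode (i, n) \<in> f x" using i by (simp add: f_def)
    then have "prod_encode (i, n) \<in> f y" using xy(3) by simp
    then have "d y (a i) < (1/2) ^ n" by (simp add: f_def)
    then show False using triangle[OF xy(1) ai xy(2)] commute[of y "a i"] i n by simp
  qed
  then show ?thesis unfolding lepoll_def by blast
qed

section \<open>Cardinal arithmetic\<close>

lemma infinite_times_lepoll: "infinite X \<Longrightarrow> X \<times> X \<lesssim> X"
  using card_of_Times_same_infinite[of X] unfolding lepoll_def
  by (metis bij_betw_def card_of_ordIso subset_refl)

text \<open>Iterated pairing is injective on lists of a fixed length. The length is recorded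
  separately since codes of lists of different lengths may coincide.\<close>

lemma infinite_lists_lepoll:
  assumes "infinite X"
  shows "lists X \<lesssim> X"
proof -
  obtain g where g: "inj_on g (X \<times> X)" "g ` (X \<times> X) \<subseteq> X"
    using infinite_times_lepoll[OF assms] unfolding lepoll_def by blast
  obtain x0 where x0: "x0 \<in> X" using assms by fastforce
  define enc where "enc xs = foldr (\<lambda>x y. g (x, y)) xs x0" for xs
  have encX: "enc xs \<in> X" if "xs \<in> lists X" for xs
    using that by (induction xs) (use x0 g(2) in \<open>auto simp: enc_def\<close>)
  have inj: "xs = ys" if "xs \<in> lists X" "ys \<in> lists X" "length xs = length ys" "enc xs = enc ys" for xs ys
    using that(3,1,2,4)
  proof (induction xs ys rule: list_induct2)
    case (Cons x xs y ys)
    then have "g (x, enc xs) = g (y, enc ys)" by (simp add: enc_def)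
    then have "(x, enc xs) = (y, enc ys)"
      by (rule inj_onD[OF g(1)]) (use Cons.prems encX in auto)
    then show ?case using Cons by simp
  qed simp
  have "inj_on (\<lambda>xs. (length xs, enc xs)) (lists X)"
    by (rule inj_onI) (use inj in auto)
  moreover have "(\<lambda>xs. (length xs, enc xs)) ` lists X \<subseteq> (UNIV :: nat set) \<times> X"
    using encX by blast
  ultimately have "lists X \<lesssim> (UNIV :: nat set) \<times> X" unfolding lepoll_def by blast
  also have "\<dots> \<lesssim> X \<times> X" using assms by (intro times_lepoll_mono) (simp_all add: infinite_le_lepoll)
  also have "\<dots> \<lesssim> X" by (rule infinite_times_lepoll[OF assms])
  finally show ?thesis .
qed

lemma countable_Un_lepoll:
  assumes "infinite X" "countable C"
  shows "C \<union> X \<lesssim> X"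
proof -
  obtain i where i: "inj_on i C" "i ` C \<subseteq> X"
  proof -
    have "C \<lesssim> (UNIV :: nat set)" using assms(2) unfolding countable_def lepoll_def by blast
    also have "\<dots> \<lesssim> X" using assms(1) by (simp add: infinite_le_lepoll)
    finally show ?thesis using that unfolding lepoll_def by blast
  qed
  obtain a b where ab: "a \<in> X" "b \<in> X" "a \<noteq> b"
    using assms(1) by (metis finite.emptyI finite_insert finite_subset insertI1 subsetI singletonD)
  \<comment> \<open>The tags \<open>a\<close> and \<open>b\<close> separate the two parts inside the
    square of \<open>X\<close>.\<close>
  let ?f = "\<lambda>x. if x \<in> X then (a, x) else (b, i x)"
  have "inj_on ?f (C \<union> X)"
    using i(1) ab(3) by (intro inj_onI) (auto split: if_splits dest: inj_onD)
  moreover have "?f ` (C \<union> X) \<subseteq> X \<times> X" using i(2) ab by auto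
  ultimately have "C \<union> X \<lesssim> X \<times> X" unfolding lepoll_def by blast
  also have "\<dots> \<lesssim> X" by (rule infinite_times_lepoll[OF assms(1)])
  finally show ?thesis .
qed

lemma words_lepoll:
  assumes "infinite X" "countable C"
  shows "words (C \<union> X) \<lesssim> X"
proof -
  have "(C \<union> X) \<times> (UNIV :: bool set) \<lesssim> X \<times> X"
    by (intro times_lepoll_mono countable_Un_lepoll assms finite_lepoll_infinite) (use assms in simp_all)
  also have "\<dots> \<lesssim> X" by (rule infinite_times_lepoll[OF assms(1)])
  finally have "words (C \<union> X) \<lesssim> lists X" unfolding words_def by (rule lists_lepoll_mono)
  also have "\<dots> \<lesssim> X" by (rule infinite_lists_lepoll[OF assms(1)])
  finally show ?thesis .
qed

section \<open>Central letters\<close>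

lemma (in group) commute_inv:
  assumes "x \<in> carrier G" "y \<in> carrier G" "x \<otimes> y = y \<otimes> x"
  shows "inv x \<otimes> y = y \<otimes> inv x"
proof -
  have "inv x \<otimes> y = inv x \<otimes> (y \<otimes> x) \<otimes> inv x" using assms(1,2) by (simp add: m_assoc)
  also have "\<dots> = inv x \<otimes> (x \<otimes> y) \<otimes> inv x" by (simp only: assms(3))
  also have "\<dots> = y \<otimes> inv x" using assms(1,2) by (simp add: m_assoc[symmetric])
  finally show ?thesis .
qed

context colored_graph
begin

definition central :: "'v set" where
  "central = {v \<in> V. \<forall>a\<in>V. a \<noteq> v \<longrightarrow> (a, v) \<in> E}"

lemma gen_central:
  assumes v: "v \<in> central" and g: "g \<in> carrier GP"
  shows "g \<otimes>\<^bsub>GP\<^esub> gen v = gen v \<otimes>\<^bsub>GP\<^esub> g"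
proof -
  have vV: "v \<in> V" using v by (simp add: central_def)
  then have gv: "gen v \<in> carrier GP" by simp
  obtain w where w: "w \<in> words V" "g = cls w" using GP_cases[OF g] .
  have "cls w \<otimes>\<^bsub>GP\<^esub> gen v = gen v \<otimes>\<^bsub>GP\<^esub> cls w"
    using w(1)
  proof (induction w)
    case Nil show ?case using gv by (simp add: cls_Nil)
  next
    case (Cons x w)
    obtain a b where x: "x = (a, b)" by (cases x)
    have aV: "a \<in> V" and wV: "w \<in> words V" using Cons.prems x by simp_all
    have ga: "gen a \<in> carrier GP" and cw: "cls w \<in> carrier GP" using aV wV by simp_all
    have comm: "gen a \<otimes>\<^bsub>GP\<^esub> gen v = gen v \<otimes>\<^bsub>GP\<^esub> gen a"
      using gen_commute[of a v] v aV by (cases "a = v") (simp_all add: central_def)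
    define h where "h = (if b then gen a else inv\<^bsub>GP\<^esub> gen a)"
    have h: "h \<in> carrier GP" using ga by (simp add: h_def)
    have hv: "h \<otimes>\<^bsub>GP\<^esub> gen v = gen v \<otimes>\<^bsub>GP\<^esub> h"
      using comm GP.commute_inv[OF ga gv comm] by (cases b) (simp_all add: h_def)
    have "cls (x # w) = h \<otimes>\<^bsub>GP\<^esub> cls w" unfolding x h_def by (rule cls_Cons[OF aV wV])
    then show ?case
      using Cons.IH[OF wV] h hv cw gv by (metis GP.m_assoc)
  qed
  then show ?thesis using w(2) by simp
qed

definition GP_center :: "'v word set set" where
  "GP_center = {g \<in> carrier GP. \<forall>h\<in>carrier GP. h \<otimes>\<^bsub>GP\<^esub> g = g \<otimes>\<^bsub>GP\<^esub> h}"

lemma gen_in_center: "v \<in> central \<Longrightarrow> gen v \<in> GP_center"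
  using gen_central by (auto simp: GP_center_def central_def)

lemma center_closed: "g \<in> GP_center \<Longrightarrow> g \<in> carrier GP"
  by (simp add: GP_center_def)

lemma center_commute: "g \<in> GP_center \<Longrightarrow> h \<in> carrier GP \<Longrightarrow> h \<otimes>\<^bsub>GP\<^esub> g = g \<otimes>\<^bsub>GP\<^esub> h"
  by (simp add: GP_center_def)

lemma center_subgroup: "subgroup GP_center GP"
proof (rule GP.subgroupI)
  show "GP_center \<noteq> {}" by (auto simp: GP_center_def intro!: exI[of _ "\<one>\<^bsub>GP\<^esub>"])
  show "inv\<^bsub>GP\<^esub> g \<in> GP_center" if "g \<in> GP_center" for g
  proof -
    have g: "g \<in> carrier GP" using that by (rule center_closed)
    have "h \<otimes>\<^bsub>GP\<^esub> inv\<^bsub>GP\<^esub> g = inv\<^bsub>GP\<^esub> g \<otimes>\<^bsub>GP\<^esub> h" if h: "h \<in> carrier GP" for h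
    proof -
      have "inv\<^bsub>GP\<^esub> h \<otimes>\<^bsub>GP\<^esub> g = g \<otimes>\<^bsub>GP\<^esub> inv\<^bsub>GP\<^esub> h"
        using center_commute[OF \<open>g \<in> GP_center\<close>] h by simp
      then have "inv\<^bsub>GP\<^esub> (inv\<^bsub>GP\<^esub> h \<otimes>\<^bsub>GP\<^esub> g) = inv\<^bsub>GP\<^esub> (g \<otimes>\<^bsub>GP\<^esub> inv\<^bsub>GP\<^esub> h)" by simp
      then show ?thesis using g h by (simp add: GP.inv_mult_group)
    qed
    then show ?thesis using g by (simp add: GP_center_def)
  qed
  show "g \<otimes>\<^bsub>GP\<^esub> k \<in> GP_center" if gk: "g \<in> GP_center" "k \<in> GP_center" for g k
  proof -
    have c: "g \<in> carrier GP" "k \<in> carrier GP" using gk by (simp_all add: center_closed)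
    have "h \<otimes>\<^bsub>GP\<^esub> (g \<otimes>\<^bsub>GP\<^esub> k) = (g \<otimes>\<^bsub>GP\<^esub> k) \<otimes>\<^bsub>GP\<^esub> h" if h: "h \<in> carrier GP" for h
    proof -
      have "h \<otimes>\<^bsub>GP\<^esub> (g \<otimes>\<^bsub>GP\<^esub> k) = (g \<otimes>\<^bsub>GP\<^esub> h) \<otimes>\<^bsub>GP\<^esub> k"
        using center_commute[OF gk(1) h] c h by (simp add: GP.m_assoc[symmetric])
      also have "\<dots> = g \<otimes>\<^bsub>GP\<^esub> (k \<otimes>\<^bsub>GP\<^esub> h)"
        using center_commute[OF gk(2) h] c h by (simp add: GP.m_assoc)
      finally show ?thesis using c h by (simp add: GP.m_assoc)
    qed
    then show ?thesis using c by (simp add: GP_center_def)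
  qed
qed (auto simp: center_closed)

lemma gen_int_pow_cong:
  assumes "v \<in> V" "int (ord v) dvd a - b"
  shows "gen v [^]\<^bsub>GP\<^esub> a = gen v [^]\<^bsub>GP\<^esub> (b :: int)"
proof -
  have gv: "gen v \<in> carrier GP" using assms(1) by simp
  obtain k where k: "a - b = int (ord v) * k" using assms(2) by (auto elim: dvdE)
  have "a = b + int (ord v) * k" using k by simp
  then have "gen v [^]\<^bsub>GP\<^esub> a = gen v [^]\<^bsub>GP\<^esub> b \<otimes>\<^bsub>GP\<^esub> (gen v [^]\<^bsub>GP\<^esub> int (ord v)) [^]\<^bsub>GP\<^esub> k"
    using gv by (simp add: GP.int_pow_mult GP.int_pow_pow)
  also have "gen v [^]\<^bsub>GP\<^esub> int (ord v) = \<one>\<^bsub>GP\<^esub>"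
    using gen_pow_ord[OF assms(1)] by (simp add: int_pow_int)
  finally show ?thesis using gv by (simp add: GP.int_pow_one)
qed

lemma words_filter [simp]: "w \<in> words S \<Longrightarrow> filter P w \<in> words S"
  by (auto simp: words_iff)

text \<open>All occurrences of a central letter can be moved to the front. Repeated for each letter,
  this reduces words in central letters to their exponent sums.\<close>

lemma cls_split_letter:
  assumes v: "v \<in> central" and w: "w \<in> words V"
  shows "cls w = gen v [^]\<^bsub>GP\<^esub> exp_sum v w \<otimes>\<^bsub>GP\<^esub> cls (filter (\<lambda>x. fst x \<noteq> v) w)"
  using w
proof (induction w)
  case Nil show ?case by (simp add: cls_Nil)
next
  case (Cons x w)
  obtain a b where x: "x = (a, b)" by (cases x)
  have aV: "a \<in> V" and wV: "w \<in> words V" using Cons.prems x by simp_all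
  have vV: "v \<in> V" using v by (simp add: central_def)
  let ?w' = "filter (\<lambda>x. fst x \<noteq> v) w"
  define h where "h = (if b then gen a else inv\<^bsub>GP\<^esub> gen a)"
  define u where "u = gen v [^]\<^bsub>GP\<^esub> exp_sum v w"
  have h: "h \<in> carrier GP" using aV by (simp add: h_def)
  have c': "cls ?w' \<in> carrier GP" using wV by simp
  have gv: "gen v \<in> carrier GP" using vV by simp
  have u: "u \<in> GP_center" unfolding u_def
    by (rule GP.subgroup_int_pow_closed[OF center_subgroup gen_in_center[OF v]])
  have uc: "u \<in> carrier GP" using u by (rule center_closed)
  have "cls (x # w) = h \<otimes>\<^bsub>GP\<^esub> cls w" unfolding x h_def by (rule cls_Cons[OF aV wV])
  also have "\<dots> = (h \<otimes>\<^bsub>GP\<^esub> u) \<otimes>\<^bsub>GP\<^esub> cls ?w'"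
    using Cons.IH[OF wV] h uc c' by (simp add: u_def GP.m_assoc)
  finally have eq: "cls (x # w) = (h \<otimes>\<^bsub>GP\<^esub> u) \<otimes>\<^bsub>GP\<^esub> cls ?w'" .
  show ?case
  proof (cases "a = v")
    case True
    have "h \<otimes>\<^bsub>GP\<^esub> u = gen v [^]\<^bsub>GP\<^esub> exp_sum v (x # w)"
    proof (cases b)
      case True
      have "gen v [^]\<^bsub>GP\<^esub> (1 + exp_sum v w) = gen v [^]\<^bsub>GP\<^esub> (1::int) \<otimes>\<^bsub>GP\<^esub> u"
        unfolding u_def by (rule GP.int_pow_mult[OF gv])
      then show ?thesis using True \<open>a = v\<close> gv by (simp add: h_def x GP.int_pow_1)
    next
      case False
      have "gen v [^]\<^bsub>GP\<^esub> (-1 + exp_sum v w) = gen v [^]\<^bsub>GP\<^esub> (-1::int) \<otimes>\<^bsub>GP\<^esub> u"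
        unfolding u_def by (rule GP.int_pow_mult[OF gv])
      moreover have "gen v [^]\<^bsub>GP\<^esub> (-1::int) = inv\<^bsub>GP\<^esub> gen v"
        using GP.int_pow_neg[OF gv, of 1] gv by (simp add: GP.int_pow_1)
      ultimately show ?thesis using False \<open>a = v\<close> by (simp add: h_def x)
    qed
    then show ?thesis using eq True by (simp add: x)
  next
    case False
    have "cls (x # w) = u \<otimes>\<^bsub>GP\<^esub> (h \<otimes>\<^bsub>GP\<^esub> cls ?w')"
      unfolding eq center_commute[OF u h] using uc h c' by (simp add: GP.m_assoc)
    also have "h \<otimes>\<^bsub>GP\<^esub> cls ?w' = cls (x # ?w')"
      unfolding x h_def by (rule cls_Cons[symmetric, OF aV]) (use wV in simp)
    finally show ?thesis using False by (simp add: x u_def)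
  qed
qed

lemma cls_central_closed: "w \<in> words central \<Longrightarrow> cls w \<in> GP_center"
proof (induction w)
  case Nil show ?case using subgroup.one_closed[OF center_subgroup] by (simp add: cls_Nil)
next
  case (Cons x w)
  obtain a b where x: "x = (a, b)" by (cases x)
  have a: "a \<in> central" and w: "w \<in> words central" using Cons.prems x by simp_all
  have "central \<subseteq> V" by (auto simp: central_def)
  then have "a \<in> V" "w \<in> words V" using a w by (auto simp: words_iff)
  then have "cls (x # w) = (if b then gen a else inv\<^bsub>GP\<^esub> gen a) \<otimes>\<^bsub>GP\<^esub> cls w"
    unfolding x by (rule cls_Cons)
  moreover have "(if b then gen a else inv\<^bsub>GP\<^esub> gen a) \<in> GP_center"
    using gen_in_center[OF a] subgroup.m_inv_closed[OF center_subgroup] by simp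
  ultimately show ?case using Cons.IH[OF w] subgroup.m_closed[OF center_subgroup] by simp
qed

lemma cls_split_central:
  assumes w: "w \<in> words V" and B: "\<And>x. x \<in> set w \<Longrightarrow> \<not> P x \<Longrightarrow> fst x \<in> central"
  shows "cls w = cls (filter P w) \<otimes>\<^bsub>GP\<^esub> cls (filter (\<lambda>x. \<not> P x) w)"
  using assms
proof (induction w)
  case Nil show ?case by (simp add: cls_Nil)
next
  case (Cons x w)
  obtain a b where x: "x = (a, b)" by (cases x)
  have aV: "a \<in> V" and wV: "w \<in> words V" using Cons.prems x by simp_all
  let ?u = "filter P w" and ?v = "filter (\<lambda>x. \<not> P x) w"
  have uv: "?u \<in> words V" "?v \<in> words V" using wV by simp_all
  then have uvc: "cls ?u \<in> carrier GP" "cls ?v \<in> carrier GP" by simp_all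
  define h where "h = (if b then gen a else inv\<^bsub>GP\<^esub> gen a)"
  have h: "h \<in> carrier GP" using aV by (simp add: h_def)
  have IH: "cls w = cls ?u \<otimes>\<^bsub>GP\<^esub> cls ?v" by (rule Cons.IH[OF wV]) (use Cons.prems(2) in simp)
  have cons: "cls (x # z) = h \<otimes>\<^bsub>GP\<^esub> cls z" if "z \<in> words V" for z
    unfolding x h_def by (rule cls_Cons[OF aV that])
  show ?case
  proof (cases "P x")
    case True
    then show ?thesis using cons[OF wV] cons[OF uv(1)] IH h uvc by (simp add: GP.m_assoc)
  next
    case False
    then have a: "a \<in> central" using Cons.prems(2)[of x] x by simp
    have hZ: "h \<in> GP_center" unfolding h_def
      using gen_in_center[OF a] subgroup.m_inv_closed[OF center_subgroup] by simp
    have "cls (x # w) = (h \<otimes>\<^bsub>GP\<^esub> cls ?u) \<otimes>\<^bsub>GP\<^esub> cls ?v"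
      using cons[OF wV] IH h uvc by (simp add: GP.m_assoc)
    also have "\<dots> = cls ?u \<otimes>\<^bsub>GP\<^esub> (h \<otimes>\<^bsub>GP\<^esub> cls ?v)"
      unfolding center_commute[OF hZ uvc(1), symmetric] using h uvc by (simp add: GP.m_assoc)
    finally show ?thesis using False cons[OF uv(2)] by simp
  qed
qed

end

text \<open>In a cyclic group of order \<open>r ^ k\<close>, consider the \<open>e\<close>-th power
  of a generator, killed by \<open>q ^ n\<close>. If \<open>r \<noteq> q\<close> it is trivial; if
  \<open>r = q\<close> and \<open>k < n\<close>, its \<open>q ^ (n - 1)\<close>-th power is trivial;
  if \<open>k > n\<close>, then \<open>q ^ (k - n)\<close> divides \<open>e\<close>, which supplies
  the missing factor \<open>q\<close>. The excluded case \<open>k = n\<close> fails, for instance at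
  \<open>e = 1\<close>.\<close>

lemma prime_power_quotient:
  fixes q r :: nat and e :: int
  assumes q: "prime q" "n \<ge> 1" and r: "prime r" "k \<ge> 1" and ne: "r ^ k \<noteq> q ^ n"
    and dvd: "int (r ^ k) dvd int (q ^ n) * e"
  shows "\<exists>f. int (r ^ k) dvd e * int (q ^ (n - 1)) - f * int (q ^ n)"
proof (cases "r = q")
  case False
  then have "coprime (r ^ k) (q ^ n)" using primes_coprime[OF r(1) q(1)] by (simp add: coprime_commute)
  then have "coprime (int (r ^ k)) (int (q ^ n))" by (simp only: coprime_int_iff)
  then have "int (r ^ k) dvd e" using dvd by (metis coprime_dvd_mult_right_iff)
  then show ?thesis by (intro exI[of _ 0]) simp
next
  case True
  then have kn: "k \<noteq> n" using ne by auto
  show ?thesis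
  proof (cases "k < n")
    case True
    then have "int (q ^ k) dvd int (q ^ (n - 1))" by (simp add: le_imp_power_dvd)
    then show ?thesis unfolding \<open>r = q\<close> by (intro exI[of _ 0]) simp
  next
    case False
    then have k: "n < k" using kn by simp
    have "int (q ^ n) * int (q ^ (k - n)) dvd int (q ^ n) * e"
      using dvd k unfolding \<open>r = q\<close> by (metis le_add_diff_inverse less_imp_le of_nat_mult power_add)
    then have "int (q ^ (k - n)) dvd e" using q(1) by (simp add: prime_gt_0_nat)
    then obtain g where g: "e = int (q ^ (k - n)) * g" by (auto elim: dvdE)
    have "int (q ^ (k - n)) * int (q ^ (n - 1)) = int (q ^ (k - 1 - n)) * int (q ^ n)"
      using k q(2) by (simp flip: of_nat_mult power_add)
    then have "e * int (q ^ (n - 1)) - (int (q ^ (k - 1 - n)) * g) * int (q ^ n) = 0"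
      unfolding g by (simp add: mult.commute mult.left_commute)
    then show ?thesis by (metis dvd_0_right)
  qed
qed

context colored_graph
begin

text \<open>
  Letters of colours other than \<open>q ^ n\<close> do not contribute to the quotient whose cosets are counted.
\<close>

lemma central_root:
  assumes q: "prime q" "n \<ge> 1" and F: "finite F"
    and u: "u \<in> words V" "fst ` set u \<subseteq> F" "F \<subseteq> central"
    and p: "\<And>v. v \<in> F \<Longrightarrow> p v \<noteq> enat (q ^ n) \<and> p v \<noteq> \<infinity>"
    and dvd: "\<And>v. v \<in> F \<Longrightarrow> int (ord v) dvd int (q ^ n) * exp_sum v u"
  shows "\<exists>z\<in>GP_center. cls u [^]\<^bsub>GP\<^esub> (q ^ (n - 1)) = z [^]\<^bsub>GP\<^esub> (q ^ n)"
  using F u p dvd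
proof (induction F arbitrary: u rule: finite_induct)
  case empty
  then have "u = []" by simp
  then show ?case using subgroup.one_closed[OF center_subgroup]
    by (intro bexI[of _ "\<one>\<^bsub>GP\<^esub>"]) (simp_all add: cls_Nil)
next
  case (insert v F)
  have vc: "v \<in> central" and vV: "v \<in> V" using insert.prems(3) by (auto simp: central_def)
  have gv: "gen v \<in> carrier GP" using vV by simp
  let ?u = "filter (\<lambda>x. fst x \<noteq> v) u"
  let ?e = "exp_sum v u"
  have uV: "?u \<in> words V" using insert.prems(1) by simp
  have exp: "exp_sum a ?u = exp_sum a u" if "a \<noteq> v" for a
    using that by (induction u) auto
  have "\<exists>z\<in>GP_center. cls ?u [^]\<^bsub>GP\<^esub> (q ^ (n - 1)) = z [^]\<^bsub>GP\<^esub> (q ^ n)"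
  proof (rule insert.IH[OF uV])
    show "fst ` set ?u \<subseteq> F" using insert.prems(2) by auto
    show "F \<subseteq> central" using insert.prems(3) by simp
    show "p a \<noteq> enat (q ^ n) \<and> p a \<noteq> \<infinity>" if "a \<in> F" for a using insert.prems(4)[of a] that by simp
    show "int (ord a) dvd int (q ^ n) * exp_sum a ?u" if "a \<in> F" for a
    proof -
      have "a \<noteq> v" using that insert.hyps(2) by auto
      then show ?thesis using insert.prems(5)[of a] that exp by simp
    qed
  qed
  then obtain z where z: "z \<in> GP_center" "cls ?u [^]\<^bsub>GP\<^esub> (q ^ (n - 1)) = z [^]\<^bsub>GP\<^esub> (q ^ n)" by blast
  have pv: "p v \<noteq> enat (q ^ n)" "p v \<noteq> \<infinity>" using insert.prems(4)[of v] by simp_all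
  have "p v \<in> colors" using colors vV by auto
  then obtain r k where rk: "p v = enat (r ^ k)" "prime r" "k \<ge> 1" using pv(2) by (auto simp: colors_def)
  have "\<exists>f. int (r ^ k) dvd ?e * int (q ^ (n - 1)) - f * int (q ^ n)"
    by (rule prime_power_quotient[OF q rk(2,3)]) (use pv rk insert.prems(5)[of v] in simp_all)
  then obtain f where f: "int (ord v) dvd ?e * int (q ^ (n - 1)) - f * int (q ^ n)" using rk(1) by auto
  \<comment> \<open>The exponent \<open>f\<close> is the contribution of \<open>v\<close> to the
    root; the other letters contribute \<open>z\<close>.\<close>
  have root: "(gen v [^]\<^bsub>GP\<^esub> ?e) [^]\<^bsub>GP\<^esub> (q ^ (n - 1)) = (gen v [^]\<^bsub>GP\<^esub> f) [^]\<^bsub>GP\<^esub> (q ^ n)"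
  proof -
    have "(gen v [^]\<^bsub>GP\<^esub> ?e) [^]\<^bsub>GP\<^esub> (q ^ (n - 1)) = gen v [^]\<^bsub>GP\<^esub> (?e * int (q ^ (n - 1)))"
      using GP.int_pow_pow[OF gv, of "?e" "int (q ^ (n - 1))"] by (metis int_pow_int)
    also have "\<dots> = gen v [^]\<^bsub>GP\<^esub> (f * int (q ^ n))" by (rule gen_int_pow_cong[OF vV f])
    also have "\<dots> = (gen v [^]\<^bsub>GP\<^esub> f) [^]\<^bsub>GP\<^esub> (q ^ n)"
      using GP.int_pow_pow[OF gv, of f "int (q ^ n)"] by (metis int_pow_int)
    finally show ?thesis .
  qed
  have gZ: "gen v [^]\<^bsub>GP\<^esub> i \<in> GP_center" for i :: int
    by (rule GP.subgroup_int_pow_closed[OF center_subgroup gen_in_center[OF vc]])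
  have pow: "(x \<otimes>\<^bsub>GP\<^esub> y) [^]\<^bsub>GP\<^esub> (m::nat) = x [^]\<^bsub>GP\<^esub> m \<otimes>\<^bsub>GP\<^esub> y [^]\<^bsub>GP\<^esub> m"
    if "x \<in> GP_center" "y \<in> carrier GP" for x y m
    by (rule GP.pow_mult_distrib) (use that center_commute center_closed in auto)
  have "cls u [^]\<^bsub>GP\<^esub> (q ^ (n - 1)) = (gen v [^]\<^bsub>GP\<^esub> ?e \<otimes>\<^bsub>GP\<^esub> cls ?u) [^]\<^bsub>GP\<^esub> (q ^ (n - 1))"
    using cls_split_letter[OF vc insert.prems(1)] by (rule arg_cong)
  also have "\<dots> = (gen v [^]\<^bsub>GP\<^esub> ?e) [^]\<^bsub>GP\<^esub> (q ^ (n - 1)) \<otimes>\<^bsub>GP\<^esub> cls ?u [^]\<^bsub>GP\<^esub> (q ^ (n - 1))"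
    by (rule pow[OF gZ]) (use uV in simp)
  also have "\<dots> = (gen v [^]\<^bsub>GP\<^esub> f) [^]\<^bsub>GP\<^esub> (q ^ n) \<otimes>\<^bsub>GP\<^esub> z [^]\<^bsub>GP\<^esub> (q ^ n)"
    unfolding root z(2) ..
  also have "\<dots> = (gen v [^]\<^bsub>GP\<^esub> f \<otimes>\<^bsub>GP\<^esub> z) [^]\<^bsub>GP\<^esub> (q ^ n)"
    by (rule pow[symmetric, OF gZ center_closed[OF z(1)]])
  finally show ?case using subgroup.m_closed[OF center_subgroup gZ z(1)] by blast
qed

end

section \<open>Uncountable colour classes have the size of the continuum\<close>

context colored_graph
begin

lemma color_prime_power:
  assumes "v \<in> V" "p v \<noteq> \<infinity>"
  obtains q n where "prime q" "n \<ge> 1" "p v = enat (q ^ n)"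
  using assms colors by (auto simp: colors_def Pi_iff)

text \<open>
  In \<open>n - 1\<close> the subtraction is only meant for \<open>n \<ge> 1\<close>. The first projection of \<open>root_pairs q n\<close> is the
  subgroup of \<open>torsion_center (q ^ n)\<close> whose index is counted; the pairs form a closed set, while the
  projection need not be closed.
\<close>

definition torsion_center :: "nat \<Rightarrow> 'v word set set" where
  "torsion_center m = {x \<in> GP_center. x [^]\<^bsub>GP\<^esub> m = \<one>\<^bsub>GP\<^esub>}"

definition root_pairs :: "nat \<Rightarrow> nat \<Rightarrow> ('v word set \<times> 'v word set) set" where
  "root_pairs q n = {(y, z). y \<in> torsion_center (q ^ n) \<and> z \<in> GP_center \<and>
     y [^]\<^bsub>GP\<^esub> (q ^ (n - 1)) = z [^]\<^bsub>GP\<^esub> (q ^ n)}"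

lemma center_pow_mult:
  assumes "x \<in> GP_center" "y \<in> GP_center"
  shows "(x \<otimes>\<^bsub>GP\<^esub> y) [^]\<^bsub>GP\<^esub> (m::nat) = x [^]\<^bsub>GP\<^esub> m \<otimes>\<^bsub>GP\<^esub> y [^]\<^bsub>GP\<^esub> m"
  by (rule GP.pow_mult_distrib) (use assms center_commute center_closed in auto)

lemma subgroup_torsion_center: "subgroup (torsion_center m) GP"
proof (rule GP.subgroupI)
  show "torsion_center m \<subseteq> carrier GP" by (auto simp: torsion_center_def center_closed)
  show "torsion_center m \<noteq> {}"
    using subgroup.one_closed[OF center_subgroup] by (auto simp: torsion_center_def intro!: exI[of _ "\<one>\<^bsub>GP\<^esub>"])
  show "inv\<^bsub>GP\<^esub> x \<in> torsion_center m" if "x \<in> torsion_center m" for x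
  proof -
    have x: "x \<in> GP_center" "x [^]\<^bsub>GP\<^esub> m = \<one>\<^bsub>GP\<^esub>" using that by (simp_all add: torsion_center_def)
    have "(inv\<^bsub>GP\<^esub> x) [^]\<^bsub>GP\<^esub> m = \<one>\<^bsub>GP\<^esub>"
      using GP.nat_pow_inv[OF center_closed[OF x(1)], of m] x(2) by simp
    then show ?thesis using subgroup.m_inv_closed[OF center_subgroup x(1)] by (simp add: torsion_center_def)
  qed
  show "x \<otimes>\<^bsub>GP\<^esub> y \<in> torsion_center m" if "x \<in> torsion_center m" "y \<in> torsion_center m" for x y
    using that subgroup.m_closed[OF center_subgroup] center_pow_mult by (simp add: torsion_center_def)
qed

lemma subgroup_root_pairs: "subgroup (root_pairs q n) (GP \<times>\<times> GP)"
proof (rule group.subgroupI[OF DirProd_group[OF GP.is_group GP.is_group]])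
  note tc = subgroup_torsion_center[of "q ^ n"]
  have tZ: "y \<in> GP_center" if "y \<in> torsion_center (q ^ n)" for y using that by (simp add: torsion_center_def)
  show "root_pairs q n \<subseteq> carrier (GP \<times>\<times> GP)"
    using tZ center_closed by (auto simp: root_pairs_def)
  have "(\<one>\<^bsub>GP\<^esub>, \<one>\<^bsub>GP\<^esub>) \<in> root_pairs q n"
    using subgroup.one_closed[OF tc] subgroup.one_closed[OF center_subgroup] by (simp add: root_pairs_def)
  then show "root_pairs q n \<noteq> {}" by blast
  show "inv\<^bsub>GP \<times>\<times> GP\<^esub> w \<in> root_pairs q n" if "w \<in> root_pairs q n" for w
  proof -
    obtain y z where w: "w = (y, z)" by (cases w)
    have yz: "y \<in> torsion_center (q ^ n)" "z \<in> GP_center" "y [^]\<^bsub>GP\<^esub> (q ^ (n - 1)) = z [^]\<^bsub>GP\<^esub> (q ^ n)"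
      using that by (simp_all add: root_pairs_def w)
    have yc: "y \<in> carrier GP" and zc: "z \<in> carrier GP" using yz tZ center_closed by blast+
    have "inv\<^bsub>GP \<times>\<times> GP\<^esub> w = (inv\<^bsub>GP\<^esub> y, inv\<^bsub>GP\<^esub> z)"
      unfolding w by (rule inv_DirProd[OF GP.is_group GP.is_group yc zc])
    moreover have "(inv\<^bsub>GP\<^esub> y) [^]\<^bsub>GP\<^esub> (q ^ (n - 1)) = (inv\<^bsub>GP\<^esub> z) [^]\<^bsub>GP\<^esub> (q ^ n)"
      using yz(3) GP.nat_pow_inv[OF yc] GP.nat_pow_inv[OF zc] by simp
    ultimately show ?thesis
      using subgroup.m_inv_closed[OF tc yz(1)] subgroup.m_inv_closed[OF center_subgroup yz(2)]
      by (simp add: root_pairs_def)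
  qed
  show "v \<otimes>\<^bsub>GP \<times>\<times> GP\<^esub> w \<in> root_pairs q n" if vw: "v \<in> root_pairs q n" "w \<in> root_pairs q n" for v w
  proof -
    obtain a b where v: "v = (a, b)" by (cases v)
    obtain y z where w: "w = (y, z)" by (cases w)
    have ab: "a \<in> torsion_center (q ^ n)" "b \<in> GP_center" "a [^]\<^bsub>GP\<^esub> (q ^ (n - 1)) = b [^]\<^bsub>GP\<^esub> (q ^ n)"
      and yz: "y \<in> torsion_center (q ^ n)" "z \<in> GP_center" "y [^]\<^bsub>GP\<^esub> (q ^ (n - 1)) = z [^]\<^bsub>GP\<^esub> (q ^ n)"
      using vw by (simp_all add: root_pairs_def v w)
    have "(a \<otimes>\<^bsub>GP\<^esub> y) [^]\<^bsub>GP\<^esub> (q ^ (n - 1)) = (b \<otimes>\<^bsub>GP\<^esub> z) [^]\<^bsub>GP\<^esub> (q ^ n)"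
      using ab yz tZ center_pow_mult by simp
    then show ?thesis using subgroup.m_closed[OF tc ab(1) yz(1)] subgroup.m_closed[OF center_subgroup ab(2) yz(2)]
      by (simp add: root_pairs_def v w)
  qed
qed

lemma cls_inverse_word:
  assumes "u \<in> words V"
  shows "rev (map (apsnd Not) u) \<in> words V" "cls (rev (map (apsnd Not) u)) = inv\<^bsub>GP\<^esub> cls u"
proof -
  show w: "rev (map (apsnd Not) u) \<in> words V" using words_inverse[OF assms] by blast
  have "cls (rev (map (apsnd Not) u) @ u) = \<one>\<^bsub>GP\<^esub>"
    using words_inverse[OF assms] cls_eqI cls_Nil by metis
  then have "cls (rev (map (apsnd Not) u)) \<otimes>\<^bsub>GP\<^esub> cls u = \<one>\<^bsub>GP\<^esub>"
    using cls_append[OF w assms] by simp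
  then show "cls (rev (map (apsnd Not) u)) = inv\<^bsub>GP\<^esub> cls u"
    using GP.inv_equality[symmetric] w assms by simp
qed

end

context polish_colored_graph
begin

lemma closedin_equalizer:
  assumes "continuous_map X P.mtopology f" "continuous_map X P.mtopology g"
  shows "closedin X {x \<in> topspace X. f x = g x}"
  by (rule closedin_continuous_maps_eq[OF P.Hausdorff_space_mtopology assms])

lemma closedin_center: "closedin P.mtopology GP_center"
proof -
  have "closedin P.mtopology (\<Inter>h\<in>carrier GP. {g \<in> topspace P.mtopology. h \<otimes>\<^bsub>GP\<^esub> g = g \<otimes>\<^bsub>GP\<^esub> h})"
  proof (rule closedin_Inter)
    show "(\<lambda>h. {g \<in> topspace P.mtopology. h \<otimes>\<^bsub>GP\<^esub> g = g \<otimes>\<^bsub>GP\<^esub> h}) ` carrier GP \<noteq> {}" using GP.one_closed by blast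
    fix S assume "S \<in> (\<lambda>h. {g \<in> topspace P.mtopology. h \<otimes>\<^bsub>GP\<^esub> g = g \<otimes>\<^bsub>GP\<^esub> h}) ` carrier GP"
    then obtain h where h: "h \<in> carrier GP" "S = {g \<in> topspace P.mtopology. h \<otimes>\<^bsub>GP\<^esub> g = g \<otimes>\<^bsub>GP\<^esub> h}" by blast
    show "closedin P.mtopology S" unfolding h(2)
      by (rule closedin_equalizer; intro P.continuous_map_mult P.continuous_map_to_carrier h(1); simp)
  qed
  also have "(\<Inter>h\<in>carrier GP. {g \<in> topspace P.mtopology. h \<otimes>\<^bsub>GP\<^esub> g = g \<otimes>\<^bsub>GP\<^esub> h}) = GP_center"
    using GP.one_closed by (auto simp: GP_center_def)
  finally show ?thesis .
qed

lemma closedin_torsion_center: "closedin P.mtopology (torsion_center m)"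
proof -
  have "closedin P.mtopology (GP_center \<inter> {x \<in> topspace P.mtopology. x [^]\<^bsub>GP\<^esub> m = \<one>\<^bsub>GP\<^esub>})"
    by (rule closedin_Int[OF closedin_center closedin_equalizer])
      (intro P.continuous_map_pow, simp, simp)
  also have "GP_center \<inter> {x \<in> topspace P.mtopology. x [^]\<^bsub>GP\<^esub> m = \<one>\<^bsub>GP\<^esub>} = torsion_center m"
    by (auto simp: torsion_center_def center_closed)
  finally show ?thesis .
qed

lemma closedin_root_pairs: "closedin (prod_topology P.mtopology P.mtopology) (root_pairs q n)"
proof -
  let ?P = "prod_topology P.mtopology P.mtopology"
  let ?E = "{w \<in> topspace ?P. fst w [^]\<^bsub>GP\<^esub> (q ^ (n - 1)) = snd w [^]\<^bsub>GP\<^esub> (q ^ n)}"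
  have "closedin ?P ((torsion_center (q ^ n) \<times> GP_center) \<inter> ?E)"
    by (rule closedin_Int[OF _ closedin_equalizer])
      (simp_all add: closedin_prod_Times_iff closedin_torsion_center closedin_center
        P.continuous_map_pow continuous_map_fst continuous_map_snd)
  also have "(torsion_center (q ^ n) \<times> GP_center) \<inter> ?E = root_pairs q n"
    by (auto simp: root_pairs_def torsion_center_def center_closed)
  finally show ?thesis .
qed

text \<open>Distinct letters are distinct elements of a Polish group, which bounds the class from
  above. For the lower bound, continuum many elements in different cosets are told apart by the
  parts of their words over the letters of the colour and countably many others; there are no more
  such words than letters of the colour.\<close>

lemma uncountable_color_continuum:
  assumes c: "c \<in> p ` V" and unc: "uncountable (color_class V p c)"
  shows "color_class V p c \<approx> (UNIV :: nat set set)"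
proof (rule lepoll_antisym)
  let ?C = "color_class V p c"
  have CV: "?C \<subseteq> V" by (auto simp: color_class_def)
  have "?C \<lesssim> carrier GP"
    unfolding lepoll_def
    by (rule exI[of _ gen]) (use CV gen_inj in \<open>auto intro: inj_on_subset\<close>)
  also have "\<dots> \<lesssim> (UNIV :: nat set set)" by (rule P.carrier_lepoll_continuum)
  finally show "?C \<lesssim> (UNIV :: nat set set)" .
next
  let ?C = "color_class V p c"
  have "c \<noteq> \<infinity>"
  proof
    assume "c = \<infinity>"
    then show False using unc countable_infinite_color by simp
  qed
  moreover obtain v where "v \<in> V" "c = p v" using c by blast
  ultimately obtain q n where q: "prime q" "n \<ge> 1" "c = enat (q ^ n)"
    using color_prime_power[of v] by metis
  have q0: "q > 1" using q(1) by (rule prime_gt_1_nat)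
  obtain A where A: "A \<subseteq> V" "countable A" "\<forall>a\<in>V. \<forall>b\<in>V - A. a \<noteq> b \<longrightarrow> (a, b) \<in> E"
    using few_nonadjacent by blast
  have central: "v \<in> central" if "v \<in> V" "v \<notin> A" for v
    using A(3) that by (simp add: central_def)
  define X where "X = ?C - A"
  have X: "uncountable X" using unc A(2) by (simp add: X_def uncountable_minus_countable)
  have XV: "v \<in> V" "p v = enat (q ^ n)" "v \<in> central" if "v \<in> X" for v
    using that q(3) central by (auto simp: X_def color_class_def)
  let ?P = "GP\<lparr>carrier := torsion_center (q ^ n)\<rparr>"
  let ?K = "(GP \<times>\<times> GP)\<lparr>carrier := root_pairs q n\<rparr>"
  note sP = subgroup_torsion_center[of "q ^ n"] and sK = subgroup_root_pairs[of q n]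
  have gP: "group ?P" by (rule GP.subgroup_imp_group[OF sP])
  have gGG: "group (GP \<times>\<times> GP)" by (rule DirProd_group[OF GP.is_group GP.is_group])
  have gK: "group ?K" by (rule group.subgroup_imp_group[OF gGG sK])
  let ?TP = "subtopology P.mtopology (torsion_center (q ^ n))"
  let ?TK = "subtopology (prod_topology P.mtopology P.mtopology) (root_pairs q n)"
  have "polish_group_topology ?P ?TP"
    by (rule polish_group_topology_subgroup[OF GP.is_group P.polish_group_topology_mtopology sP closedin_torsion_center])
  then obtain dP where dP: "polish_grp ?P dP" "Metric_space.mtopology (carrier ?P) dP = ?TP"
    by (rule polish_group_topologyE[OF gP])
  have "polish_group_topology ?K ?TK"
    by (rule polish_group_topology_subgroup[OF gGG _ sK closedin_root_pairs])
      (intro polish_group_topology_DirProd GP.is_group P.polish_group_topology_mtopology)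
  then obtain dK where dK: "polish_grp ?K dK" "Metric_space.mtopology (carrier ?K) dK = ?TK"
    by (rule polish_group_topologyE[OF gK])
  have fst_tc: "fst w \<in> torsion_center (q ^ n)" if "w \<in> root_pairs q n" for w
    using that by (auto simp: root_pairs_def)
  have hom: "fst \<in> hom ?K ?P"
    by (rule homI) (use fst_tc in \<open>auto simp: mult_DirProd'\<close>)
  have cont: "continuous_map ?TK ?TP fst"
    by (rule continuous_map_into_subtopology[OF continuous_map_from_subtopology[OF continuous_map_fst]])
      (use fst_tc in auto)
  interpret H: polish_grp_hom ?K dK ?P dP fst
    by (intro polish_grp_hom.intro dP(1) dK(1) group_hom.intro gP gK group_hom_axioms.intro hom
        polish_grp_hom_axioms.intro) (simp only: dP(2) dK(2) cont)
  have tcZ: "x \<in> GP_center" "x \<in> carrier GP" "x [^]\<^bsub>GP\<^esub> (q ^ n) = \<one>\<^bsub>GP\<^esub>" if "x \<in> torsion_center (q ^ n)" for x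
    using that center_closed by (simp_all add: torsion_center_def)
  have commP: "comm_group ?P"
    by (rule group.group_comm_groupI[OF gP]) (use tcZ center_commute in simp)
  have invP: "inv\<^bsub>?P\<^esub> x = inv\<^bsub>GP\<^esub> x" if "x \<in> torsion_center (q ^ n)" for x
    by (rule GP.m_inv_consistent[OF sP that])
  have gen_tc: "gen v \<in> torsion_center (q ^ n)" if "v \<in> X" for v
    using gen_pow_ord[OF XV(1)[OF that]] XV[OF that] gen_in_center by (simp add: torsion_center_def)
  \<comment> \<open>Modulo \<open>q ^ n\<close> the exponent of \<open>a\<close> in the quotient is
    \<open>1\<close>, so in its \<open>q ^ (n - 1)\<close>-th power it is nonzero, whereas in a
    \<open>q ^ n\<close>-th power it is \<open>0\<close>.\<close>
  have ineq: "gen a \<otimes>\<^bsub>?P\<^esub> inv\<^bsub>?P\<^esub> gen b \<notin> fst ` carrier ?K" if ab: "a \<in> X" "b \<in> X" "a \<noteq> b" for a b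
  proof
    assume "gen a \<otimes>\<^bsub>?P\<^esub> inv\<^bsub>?P\<^esub> gen b \<in> fst ` carrier ?K"
    then obtain w where w: "w \<in> root_pairs q n" "gen a \<otimes>\<^bsub>GP\<^esub> inv\<^bsub>GP\<^esub> gen b = fst w"
      using invP[OF gen_tc[OF ab(2)]] by auto
    define z where "z = snd w"
    have z: "z \<in> GP_center" "fst w [^]\<^bsub>GP\<^esub> (q ^ (n - 1)) = z [^]\<^bsub>GP\<^esub> (q ^ n)"
      using w(1) by (auto simp: root_pairs_def z_def)
    have aV: "a \<in> V" and bV: "b \<in> V" and orda: "ord a = q ^ n" using XV ab by auto
    let ?Z = "integer_mod_group (ord a)"
    obtain \<theta> where \<theta>: "\<theta> \<in> hom GP ?Z" "\<And>w. w \<in> words V \<Longrightarrow> \<theta> (cls w) = exp_sum a w mod int (ord a)"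
      using exponent_hom[OF aV] by blast
    interpret Z: group ?Z by simp
    interpret h: group_hom GP ?Z \<theta> by unfold_locales (rule \<theta>(1))
    have big: "1 < q ^ n" by (rule one_less_power) (use q0 q(2) in simp_all)
    then have "1 < int (q ^ n)" by linarith
    then have one_mod: "1 mod int (q ^ n) = 1" by (intro mod_pos_pos_trivial) simp_all
    have ga: "\<theta> (gen a) = 1" using \<theta>(2)[of "[(a, True)]"] aV one_mod unfolding orda by simp
    have gb: "\<theta> (gen b) = \<one>\<^bsub>?Z\<^esub>" using \<theta>(2)[of "[(b, True)]"] bV ab(3) by simp
    have "\<theta> (fst w) = \<theta> (gen a) \<otimes>\<^bsub>?Z\<^esub> inv\<^bsub>?Z\<^esub> \<theta> (gen b)"
      using w(2) aV bV by (metis h.hom_mult h.hom_inv GP.inv_closed cls_closed fst_conv words_simps(1,2))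
    also have "\<dots> = \<theta> (gen a)" unfolding gb Z.inv_one by (rule Z.r_one, rule h.hom_closed) (use aV in simp)
    finally have 1: "\<theta> (fst w) = 1" using ga by simp
    have fw: "fst w \<in> carrier GP" using fst_tc[OF w(1)] tcZ(2) by blast
    have "\<theta> (fst w [^]\<^bsub>GP\<^esub> (q ^ (n - 1))) = \<theta> (z [^]\<^bsub>GP\<^esub> (q ^ n))" using z(2) by simp
    then have "\<theta> (fst w) [^]\<^bsub>?Z\<^esub> (q ^ (n - 1)) = \<theta> z [^]\<^bsub>?Z\<^esub> (q ^ n)"
      using fw center_closed[OF z(1)] by (simp only: h.hom_nat_pow)
    then have "int (q ^ (n - 1)) mod int (q ^ n) = (int (q ^ n) * \<theta> z) mod int (q ^ n)"
      unfolding 1 orda by (simp only: pow_integer_mod_group mult_1_right)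
    then have "int (q ^ n) dvd int (q ^ (n - 1))" by (simp add: mod_eq_0_iff_dvd)
    then have "q ^ n dvd q ^ (n - 1)" by (simp only: int_dvd_int_iff)
    then have "q ^ n \<le> q ^ (n - 1)" by (rule dvd_imp_le) (use q0 in simp)
    moreover have "q ^ (n - 1) < q ^ n" by (rule power_strict_increasing) (use q0 q(2) in simp_all)
    ultimately show False by simp
  qed
  obtain x :: "nat set \<Rightarrow> 'v word set" where x: "\<And>S. x S \<in> carrier ?P"
    "\<And>S R. S \<noteq> R \<Longrightarrow> x S \<otimes>\<^bsub>?P\<^esub> inv\<^bsub>?P\<^esub> x R \<notin> fst ` carrier ?K"
  proof (rule H.uncountable_index_imp_continuum[OF commP X])
    show "gen i \<in> carrier ?P" if "i \<in> X" for i using gen_tc[OF that] by simp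
  qed (rule ineq, assumption+, rule that)
  have x_tc: "x S \<in> torsion_center (q ^ n)" for S using x(1) by simp
  \<comment> \<open>There are only countably many colours, so all countable colour classes together
    can be added to the exceptional set. The remaining letters are central and of finite
    colour.\<close>
  define A' where "A' = A \<union> (\<Union>c'\<in>{c' \<in> p ` V. countable (color_class V p c')}. color_class V p c')"
  have A': "countable A'"
    unfolding A'_def using A(2) by (intro countable_Un countable_UN) auto
  have "\<exists>w. w \<in> words V \<and> x S = cls w" for S using GP_cases[OF tcZ(2)[OF x_tc[of S]]] by blast
  then obtain w where w: "\<And>S. w S \<in> words V" "\<And>S. x S = cls (w S)" by metis
  \<comment> \<open>The letters kept by \<open>Q\<close> stay in \<open>\<tau> S\<close>; the others
    are central, of a finite colour different from \<open>q ^ n\<close>, and are collected in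
    \<open>\<sigma> S\<close>.\<close>
  define Q where "Q y \<longleftrightarrow> fst y \<in> A' \<union> ?C" for y :: "'v \<times> bool"
  define \<tau> where "\<tau> S = filter Q (w S)" for S
  define \<sigma> where "\<sigma> S = filter (\<lambda>y. \<not> Q y) (w S)" for S
  have \<tau>: "\<tau> S \<in> words (A' \<union> ?C)" for S
    by (auto simp: words_iff \<tau>_def Q_def)
  have other: "v \<in> central" "p v \<noteq> enat (q ^ n) \<and> p v \<noteq> \<infinity>" if "v \<in> V" "v \<notin> A' \<union> ?C" for v
  proof -
    show "v \<in> central" using that central by (auto simp: A'_def)
    have "p v \<noteq> c" using that by (auto simp: color_class_def)
    moreover have "p v \<noteq> \<infinity>"
    proof
      assume "p v = \<infinity>"
      then have "v \<in> A'" using that(1) countable_infinite_color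
        unfolding A'_def by (auto simp: color_class_def image_iff intro!: bexI[of _ v])
      then show False using that(2) by blast
    qed
    ultimately show "p v \<noteq> enat (q ^ n) \<and> p v \<noteq> \<infinity>" using q(3) by simp
  qed
  have \<sigma>: "\<sigma> S \<in> words V" "fst y \<in> central" "p (fst y) \<noteq> enat (q ^ n) \<and> p (fst y) \<noteq> \<infinity>"
    if "y \<in> set (\<sigma> S)" for S y
    using that w(1)[of S] other[of "fst y"] by (auto simp: \<sigma>_def Q_def words_iff)
  have \<sigma>V: "\<sigma> S \<in> words V" for S using w(1) by (simp add: \<sigma>_def)
  have split: "x S = cls (\<tau> S) \<otimes>\<^bsub>GP\<^esub> cls (\<sigma> S)" for S
    unfolding w(2) \<tau>_def \<sigma>_def
    by (rule cls_split_central[OF w(1)]) (use w(1)[of S] other in \<open>auto simp: Q_def words_iff\<close>)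
  \<comment> \<open>If the kept parts agree, they cancel, since what lies between them is central.
    The quotient is then a word in letters of other finite colours, and \<open>central_root\<close>
    places it in the subgroup, so the two cosets coincide.\<close>
  have "inj \<tau>"
  proof (rule injI, rule ccontr)
    fix S R assume eq: "\<tau> S = \<tau> R" "S \<noteq> R"
    define u where "u = \<sigma> S @ rev (map (apsnd Not) (\<sigma> R))"
    have u: "u \<in> words V" using \<sigma>V cls_inverse_word(1) by (simp add: u_def)
    have letters: "fst ` set u \<subseteq> fst ` (set (\<sigma> S) \<union> set (\<sigma> R))" by (force simp: u_def)
    have \<tau>V: "\<tau> S \<in> words V" using w(1) by (simp add: \<tau>_def)
    have "x S \<otimes>\<^bsub>GP\<^esub> inv\<^bsub>GP\<^esub> x R = cls (\<tau> S) \<otimes>\<^bsub>GP\<^esub> (cls (\<sigma> S) \<otimes>\<^bsub>GP\<^esub> inv\<^bsub>GP\<^esub> cls (\<sigma> R)) \<otimes>\<^bsub>GP\<^esub> inv\<^bsub>GP\<^esub> cls (\<tau> S)"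
      unfolding split[of S] split[of R] eq(1)[symmetric]
      using \<sigma>V \<tau>V by (simp add: GP.inv_mult_group GP.m_assoc)
    also have "cls (\<sigma> S) \<otimes>\<^bsub>GP\<^esub> inv\<^bsub>GP\<^esub> cls (\<sigma> R) = cls u"
      using \<sigma>V by (simp add: u_def cls_append cls_inverse_word)
    finally have xu: "x S \<otimes>\<^bsub>GP\<^esub> inv\<^bsub>GP\<^esub> x R = cls (\<tau> S) \<otimes>\<^bsub>GP\<^esub> cls u \<otimes>\<^bsub>GP\<^esub> inv\<^bsub>GP\<^esub> cls (\<tau> S)" .
    have "fst ` (set (\<sigma> S) \<union> set (\<sigma> R)) \<subseteq> central"
      by (rule image_subsetI, erule UnE) (rule \<sigma>(2), assumption)+
    with letters have letters_central: "fst ` set u \<subseteq> central" by (rule order_trans)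
    then have "u \<in> words central" unfolding words_iff .
    then have uZ: "cls u \<in> GP_center" by (rule cls_central_closed)
    have xu: "x S \<otimes>\<^bsub>GP\<^esub> inv\<^bsub>GP\<^esub> x R = cls u"
      unfolding xu using center_commute[OF uZ] \<tau>V u by (simp add: GP.m_assoc)
    have "x S \<otimes>\<^bsub>GP\<^esub> inv\<^bsub>GP\<^esub> x R \<in> torsion_center (q ^ n)"
      using subgroup.m_closed[OF sP] subgroup.m_inv_closed[OF sP] x_tc by blast
    then have u_tc: "cls u \<in> torsion_center (q ^ n)" using xu by simp
    have "\<exists>z\<in>GP_center. cls u [^]\<^bsub>GP\<^esub> (q ^ (n - 1)) = z [^]\<^bsub>GP\<^esub> (q ^ n)"
    proof (rule central_root[OF q(1,2) _ u order_refl])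
      show "finite (fst ` set u)" by simp
      show "fst ` set u \<subseteq> central" by (rule letters_central)
      show "p v \<noteq> enat (q ^ n) \<and> p v \<noteq> \<infinity>" if "v \<in> fst ` set u" for v
      proof -
        obtain y where "y \<in> set (\<sigma> S) \<union> set (\<sigma> R)" "v = fst y"
          using subsetD[OF letters \<open>v \<in> fst ` set u\<close>] by (elim imageE)
        then show ?thesis using \<sigma>(3)[of y S] \<sigma>(3)[of y R] by (elim UnE) simp_all
      qed
      show "int (ord v) dvd int (q ^ n) * exp_sum v u" if "v \<in> fst ` set u" for v
      proof -
        have vV: "v \<in> V" using that u by (auto simp: words_iff)
        let ?Z = "integer_mod_group (ord v)"
        obtain \<theta> where \<theta>: "\<theta> \<in> hom GP ?Z" "\<And>w. w \<in> words V \<Longrightarrow> \<theta> (cls w) = exp_sum v w mod int (ord v)"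
          using exponent_hom[OF vV] by blast
        interpret Z: group ?Z by simp
        interpret h: group_hom GP ?Z \<theta> by unfold_locales (rule \<theta>(1))
        have "\<theta> (cls u [^]\<^bsub>GP\<^esub> (q ^ n)) = \<one>\<^bsub>?Z\<^esub>" unfolding tcZ(3)[OF u_tc] by (rule h.hom_one)
        then have "\<theta> (cls u) [^]\<^bsub>?Z\<^esub> (q ^ n) = \<one>\<^bsub>?Z\<^esub>" using u by (simp only: h.hom_nat_pow cls_closed)
        then have "(int (q ^ n) * (exp_sum v u mod int (ord v))) mod int (ord v) = 0"
          unfolding \<theta>(2)[OF u] pow_integer_mod_group one_integer_mod_group .
        then show ?thesis by (simp only: mod_mult_right_eq mod_eq_0_iff_dvd)
      qed
    qed
    then obtain z where z: "z \<in> GP_center" "cls u [^]\<^bsub>GP\<^esub> (q ^ (n - 1)) = z [^]\<^bsub>GP\<^esub> (q ^ n)" by blast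
    then have "(cls u, z) \<in> root_pairs q n" using u_tc by (simp add: root_pairs_def)
    then have "cls u \<in> fst ` root_pairs q n" by (metis fst_conv image_eqI)
    moreover have "x S \<otimes>\<^bsub>?P\<^esub> inv\<^bsub>?P\<^esub> x R = cls u" using xu invP[OF x_tc] by simp
    ultimately show False using x(2)[OF eq(2)] by simp
  qed
  then have "(UNIV :: nat set set) \<lesssim> words (A' \<union> ?C)"
    unfolding lepoll_def using \<tau> by blast
  also have "\<dots> \<lesssim> ?C"
    by (rule words_lepoll[OF _ A']) (use unc countable_finite in blast)
  finally show "(UNIV :: nat set set) \<lesssim> ?C" .
qed

lemma polish_conditions: "polish_conditions V E p"
  unfolding polish_conditions_def
  by (intro conjI few_nonadjacent finite_uncountable_colors countable_infinite_color ballI impI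
      uncountable_color_continuum)

end

section \<open>A basis of the countable power of a cyclic group\<close>

text \<open>Elements of the countable power of the cyclic group of order \<open>m\<close> are
  represented by integer functions. Unless \<open>m\<close> is a unit, independence also makes
  distinct members of \<open>B\<close> incongruent.\<close>

definition independent_mod :: "int \<Rightarrow> (nat \<Rightarrow> int) set \<Rightarrow> bool" where
  "independent_mod m B \<longleftrightarrow> (\<forall>S c. finite S \<longrightarrow> S \<subseteq> B \<longrightarrow> (\<forall>j. m dvd (\<Sum>b\<in>S. c b * b j)) \<longrightarrow> (\<forall>b\<in>S. m dvd c b))"

definition spanning_mod :: "int \<Rightarrow> (nat \<Rightarrow> int) set \<Rightarrow> bool" where
  "spanning_mod m B \<longleftrightarrow> (\<forall>f. \<exists>S c. finite S \<and> S \<subseteq> B \<and> (\<forall>j. m dvd f j - (\<Sum>b\<in>S. c b * b j)))"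

text \<open>
  The indicator function of the branch of the binary tree given by a set of naturals; finitely many
  branches are separated at some level, which makes these functions independent.
\<close>

definition branch :: "nat set \<Rightarrow> nat \<Rightarrow> int" where
  "branch X j = (if set_encode (X \<inter> {..<fst (prod_decode j)}) = snd (prod_decode j) then 1 else 0)"

lemma branch_separation:
  fixes \<X> :: "nat set set"
  assumes "finite \<X>"
  shows "\<exists>n. \<forall>X\<in>\<X>. \<forall>Y\<in>\<X>. X \<inter> {..<n} = Y \<inter> {..<n} \<longrightarrow> X = Y"
proof -
  have "\<exists>k. \<forall>X Y. z = (X, Y) \<longrightarrow> X \<noteq> Y \<longrightarrow> \<not> (k \<in> X \<longleftrightarrow> k \<in> Y)" for z :: "nat set \<times> nat set"
    by (cases z) auto
  then obtain k where k: "\<And>X Y :: nat set. X \<noteq> Y \<Longrightarrow> \<not> (k (X, Y) \<in> X \<longleftrightarrow> k (X, Y) \<in> Y)" by metis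
  have fin: "finite (k ` (\<X> \<times> \<X>))" using assms by simp
  obtain n where n: "\<And>i. i \<in> k ` (\<X> \<times> \<X>) \<Longrightarrow> i < n"
    using fin unfolding finite_nat_set_iff_bounded by blast
  have "X = Y" if "X \<in> \<X>" "Y \<in> \<X>" "X \<inter> {..<n} = Y \<inter> {..<n}" for X Y
  proof (rule ccontr)
    assume "X \<noteq> Y"
    then have "\<not> (k (X, Y) \<in> X \<longleftrightarrow> k (X, Y) \<in> Y)" by (rule k)
    moreover have "k (X, Y) < n" using n that by blast
    ultimately show False using that(3) by blast
  qed
  then show ?thesis by blast
qed

text \<open>The coordinate codes a node of the tree: a level at which all the given branches are
  separated, together with the initial segment of \<open>X\<close> at that level.\<close>

lemma branch_dual:
  assumes "finite \<X>" "X \<in> \<X>"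
  shows "\<exists>j. branch X j = 1 \<and> (\<forall>Y\<in>\<X>. Y \<noteq> X \<longrightarrow> branch Y j = 0)"
proof -
  obtain n where n: "\<forall>X\<in>\<X>. \<forall>Y\<in>\<X>. X \<inter> {..<n} = Y \<inter> {..<n} \<longrightarrow> X = Y"
    using branch_separation[OF assms(1)] by blast
  let ?j = "prod_encode (n, set_encode (X \<inter> {..<n}))"
  have "branch Y ?j = 0" if "Y \<in> \<X>" "Y \<noteq> X" for Y
  proof -
    have "Y \<inter> {..<n} \<noteq> X \<inter> {..<n}" using n that assms(2) by blast
    then have "set_encode (Y \<inter> {..<n}) \<noteq> set_encode (X \<inter> {..<n})"
      using set_encode_eq[of "Y \<inter> {..<n}" "X \<inter> {..<n}"] by simp
    then show ?thesis by (simp add: branch_def)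
  qed
  moreover have "branch X ?j = 1" by (simp add: branch_def)
  ultimately show ?thesis by blast
qed

lemma inj_branch: "inj branch"
proof (rule injI, rule ccontr)
  fix X Y assume "branch X = branch Y" "X \<noteq> Y"
  then show False using branch_dual[of "{X, Y}" X] by auto
qed

text \<open>Evaluation at a dual coordinate isolates a single coefficient, whatever the
  modulus.\<close>

lemma independent_branches: "independent_mod m (range branch)"
  unfolding independent_mod_def
proof (intro allI impI ballI)
  fix S :: "(nat \<Rightarrow> int) set" and c b
  assume S: "finite S" "S \<subseteq> range branch" and dvd: "\<forall>j. m dvd (\<Sum>b\<in>S. c b * b j)" and b: "b \<in> S"
  define \<X> where "\<X> = {X. branch X \<in> S}"
  have S_eq: "S = branch ` \<X>" using S(2) by (auto simp: \<X>_def)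
  have "finite \<X>" unfolding \<X>_def using finite_vimageI[OF S(1) inj_branch] by (simp add: vimage_def)
  obtain X where X: "X \<in> \<X>" "b = branch X" using b S_eq by blast
  obtain j where j: "branch X j = 1" "\<forall>Y\<in>\<X>. Y \<noteq> X \<longrightarrow> branch Y j = 0"
    using branch_dual[OF \<open>finite \<X>\<close> X(1)] by blast
  have "(\<Sum>b\<in>S. c b * b j) = (\<Sum>Y\<in>\<X>. c (branch Y) * branch Y j)"
    unfolding S_eq by (rule sum.reindex_cong[OF inj_on_subset[OF inj_branch]]) auto
  also have "\<dots> = (\<Sum>Y\<in>\<X>. if Y = X then c b else 0)"
    by (rule sum.cong) (use j X in auto)
  also have "\<dots> = c b" using \<open>finite \<X>\<close> X(1) by simp
  finally show "m dvd c b" using dvd by metis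
qed

text \<open>If \<open>f\<close> cannot be added, some dependence relation involves \<open>f\<close>
  with a coefficient not divisible by \<open>q\<close>. As \<open>q\<close> is prime this
  coefficient is invertible, and the relation can be solved for \<open>f\<close>.\<close>

lemma maximal_independent_spanning:
  fixes q :: int
  assumes q: "prime q" and ind: "independent_mod q B"
    and max: "\<And>f. independent_mod q (insert f B) \<Longrightarrow> f \<in> B"
  shows "spanning_mod q B"
  unfolding spanning_mod_def
proof
  fix f
  show "\<exists>S c. finite S \<and> S \<subseteq> B \<and> (\<forall>j. q dvd f j - (\<Sum>b\<in>S. c b * b j))"
  proof (cases "f \<in> B")
    case True
    then show ?thesis by (intro exI[of _ "{f}"] exI[of _ "\<lambda>_. 1"]) simp
  next
    case False
    then have "\<not> independent_mod q (insert f B)" using max by blast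
    then obtain S c b where S: "finite S" "S \<subseteq> insert f B" "\<forall>j. q dvd (\<Sum>b\<in>S. c b * b j)" "b \<in> S" "\<not> q dvd c b"
      unfolding independent_mod_def by meson
    define R where "R = S - {f}"
    have R: "finite R" "R \<subseteq> B" using S by (auto simp: R_def)
    have ind': "q dvd c b" if "\<forall>j. q dvd (\<Sum>b\<in>R. c b * b j)" "b \<in> R" for b
      using ind R that unfolding independent_mod_def by meson
    have fS: "f \<in> S"
    proof (rule ccontr)
      assume "f \<notin> S"
      then have "R = S" by (simp add: R_def)
      then show False using ind' S by metis
    qed
    have sum: "(\<Sum>b\<in>S. c b * b j) = c f * f j + (\<Sum>b\<in>R. c b * b j)" for j
      unfolding R_def by (rule sum.remove[OF S(1) fS])
    have cf: "\<not> q dvd c f"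
    proof
      assume cf: "q dvd c f"
      have "q dvd (\<Sum>b\<in>R. c b * b j)" for j
      proof -
        have "q dvd c f * f j + (\<Sum>b\<in>R. c b * b j)" using S(3) sum[of j] by metis
        moreover have "q dvd c f * f j" using cf by simp
        ultimately show ?thesis using dvd_add_right_iff by blast
      qed
      then have "q dvd c b" if "b \<in> R" for b using ind' that by blast
      then have "q dvd c b" using S(4) cf by (cases "b = f") (auto simp: R_def)
      then show False using S(5) by contradiction
    qed
    have "coprime (c f) q" using prime_imp_coprime[OF q cf] by (simp add: coprime_commute)
    then obtain u where u: "[c f * u = 1] (mod q)" using cong_solve_coprime_int by blast
    have "q dvd f j - (\<Sum>b\<in>R. (- u * c b) * b j)" for j
    proof -
      have "(\<Sum>b\<in>R. (- u * c b) * b j) = - u * (\<Sum>b\<in>R. c b * b j)"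
        by (simp add: sum_distrib_left mult.assoc)
      then have "f j - (\<Sum>b\<in>R. (- u * c b) * b j) = u * (c f * f j + (\<Sum>b\<in>R. c b * b j)) - (c f * u - 1) * f j"
        by (simp add: algebra_simps)
      moreover have "q dvd c f * f j + (\<Sum>b\<in>R. c b * b j)" using S(3) sum[of j] by metis
      moreover have "q dvd c f * u - 1" using u by (simp add: cong_iff_dvd_diff)
      ultimately show ?thesis by (simp only: dvd_diff dvd_mult dvd_mult2)
    qed
    then show ?thesis using R by (intro exI[of _ R] exI[of _ "\<lambda>b. - u * c b"]) blast
  qed
qed

text \<open>A relation modulo a higher power is in particular one modulo \<open>q\<close>, so all
  coefficients are multiples of \<open>q\<close>; dividing by \<open>q\<close> leaves a relation
  modulo the previous power.\<close>

lemma independent_mod_power: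
  assumes "independent_mod q B" "q \<noteq> 0"
  shows "independent_mod (q ^ n) B"
proof (induction n)
  case 0 show ?case by (simp add: independent_mod_def)
next
  case (Suc n)
  show ?case unfolding independent_mod_def
  proof (intro allI impI)
    fix S :: "(nat \<Rightarrow> int) set" and c
    assume S: "finite S" "S \<subseteq> B" and dvd: "\<forall>j. q ^ Suc n dvd (\<Sum>b\<in>S. c b * b j)"
    have "\<forall>j. q dvd (\<Sum>b\<in>S. c b * b j)" using dvd by (meson dvd_trans dvd_triv_left power_Suc dvd_power_same
          dvd_refl le_imp_power_dvd power_one_right Suc_leI zero_less_Suc dvd_power)
    then have "\<forall>b\<in>S. q dvd c b" using assms(1) S unfolding independent_mod_def by meson
    then have c: "c b = q * (c b div q)" if "b \<in> S" for b using that by simp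
    have "\<forall>j. q ^ n dvd (\<Sum>b\<in>S. (c b div q) * b j)"
    proof
      fix j
      have "(\<Sum>b\<in>S. c b * b j) = (\<Sum>b\<in>S. q * ((c b div q) * b j))"
        by (rule sum.cong) (use c in \<open>simp_all add: mult.assoc[symmetric]\<close>)
      then have "(\<Sum>b\<in>S. c b * b j) = q * (\<Sum>b\<in>S. (c b div q) * b j)"
        by (simp only: sum_distrib_left)
      then have "q * q ^ n dvd q * (\<Sum>b\<in>S. (c b div q) * b j)" using dvd by (metis power_Suc)
      then show "q ^ n dvd (\<Sum>b\<in>S. (c b div q) * b j)" using assms(2) by (simp only: dvd_mult_cancel_left) simp
    qed
    then have "\<forall>b\<in>S. q ^ n dvd c b div q" using Suc S unfolding independent_mod_def by meson
    then show "\<forall>b\<in>S. q ^ Suc n dvd c b" using c by (metis mult_dvd_mono dvd_refl power_Suc)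
  qed
qed

text \<open>The error of an expansion modulo \<open>q ^ n\<close> has the form
  \<open>q ^ n * g\<close>. Expanding \<open>g\<close> modulo \<open>q\<close> improves it by one
  power.\<close>

lemma spanning_mod_power:
  assumes "spanning_mod q B"
  shows "spanning_mod (q ^ n) B"
proof (induction n)
  case 0 show ?case by (auto simp: spanning_mod_def)
next
  case (Suc n)
  show ?case unfolding spanning_mod_def
  proof
    fix f
    obtain S c where S: "finite S" "S \<subseteq> B" "\<forall>j. q ^ n dvd f j - (\<Sum>b\<in>S. c b * b j)"
      using Suc unfolding spanning_mod_def by meson
    define g where "g j = (f j - (\<Sum>b\<in>S. c b * b j)) div q ^ n" for j
    have g: "f j - (\<Sum>b\<in>S. c b * b j) = q ^ n * g j" for j using S(3) by (simp add: g_def)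
    obtain R e where R: "finite R" "R \<subseteq> B" "\<forall>j. q dvd g j - (\<Sum>b\<in>R. e b * b j)"
      using assms unfolding spanning_mod_def by meson
    \<comment> \<open>The two finite supports may overlap, so both coefficient functions are
      extended by zero and added.\<close>
    define h where "h b = (if b \<in> S then c b else 0) + q ^ n * (if b \<in> R then e b else 0)" for b
    have "q ^ Suc n dvd f j - (\<Sum>b\<in>S \<union> R. h b * b j)" for j
    proof -
      have "(\<Sum>b\<in>S \<union> R. h b * b j) = (\<Sum>b\<in>S \<union> R. (if b \<in> S then c b * b j else 0) + q ^ n * (if b \<in> R then e b * b j else 0))"
        by (rule sum.cong) (auto simp: h_def algebra_simps)
      also have "\<dots> = (\<Sum>b\<in>S \<union> R. if b \<in> S then c b * b j else 0) + q ^ n * (\<Sum>b\<in>S \<union> R. if b \<in> R then e b * b j else 0)"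
        by (simp only: sum.distrib sum_distrib_left)
      also have "(\<Sum>b\<in>S \<union> R. if b \<in> S then c b * b j else 0) = (\<Sum>b\<in>S. c b * b j)"
        using S(1) R(1) by (simp add: sum.If_cases Int_absorb1)
      also have "(\<Sum>b\<in>S \<union> R. if b \<in> R then e b * b j else 0) = (\<Sum>b\<in>R. e b * b j)"
        using S(1) R(1) by (simp add: sum.If_cases Int_absorb1)
      finally have "f j - (\<Sum>b\<in>S \<union> R. h b * b j) = q ^ n * (g j - (\<Sum>b\<in>R. e b * b j))"
        using g[of j] by (simp add: algebra_simps)
      moreover have "q ^ n * q dvd q ^ n * (g j - (\<Sum>b\<in>R. e b * b j))" by (rule mult_dvd_mono) (use R(3) in simp_all)
      ultimately show ?thesis by (simp add: mult.commute)
    qed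
    then show "\<exists>S c. finite S \<and> S \<subseteq> B \<and> (\<forall>j. q ^ Suc n dvd f j - (\<Sum>b\<in>S. c b * b j))"
      using S R by (intro exI[of _ "S \<union> R"] exI[of _ h]) simp
  qed
qed

text \<open>
  A basis modulo the prime \<open>q\<close> is, by nilpotency of \<open>q\<close>, a basis modulo each of its powers; thus the
  countable power of the cyclic group of order \<open>q ^ n\<close> is a direct sum of continuum many copies.
\<close>

lemma continuum_basis:
  assumes q: "prime (q :: nat)"
  obtains B where "B \<approx> (UNIV :: nat set set)"
    "\<And>n. independent_mod (int (q ^ n)) B" "\<And>n. spanning_mod (int (q ^ n)) B"
proof -
  have q': "prime (int q)" using q by simp
  \<comment> \<open>Starting from the branches gives every set considered at least continuum many
    elements.\<close>
  let ?\<A> = "{B. range branch \<subseteq> B \<and> independent_mod (int q) B}"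
  have "\<exists>M\<in>?\<A>. \<forall>X\<in>?\<A>. M \<subseteq> X \<longrightarrow> X = M"
  proof (rule subset_Zorn_nonempty)
    show "?\<A> \<noteq> {}" using independent_branches by blast
    fix C assume C: "C \<noteq> {}" "subset.chain ?\<A> C"
    have sub: "C \<subseteq> ?\<A>" using C(2) by (simp add: subset_chain_def)
    have "independent_mod (int q) (\<Union>C)" unfolding independent_mod_def
    proof (intro allI impI)
      fix S :: "(nat \<Rightarrow> int) set" and c assume S: "finite S" "S \<subseteq> \<Union>C" and dvd: "\<forall>j. int q dvd (\<Sum>b\<in>S. c b * b j)"
      obtain D where D: "D \<in> C" "S \<subseteq> D" by (rule finite_subset_Union_chain[OF S C])
      then have "independent_mod (int q) D" using sub by blast
      then show "\<forall>b\<in>S. int q dvd c b" using S D dvd unfolding independent_mod_def by meson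
    qed
    moreover have "range branch \<subseteq> \<Union>C" using C(1) sub by blast
    ultimately show "\<Union>C \<in> ?\<A>" by simp
  qed
  then obtain B where B: "B \<in> ?\<A>" "\<forall>X\<in>?\<A>. B \<subseteq> X \<longrightarrow> X = B" by (rule bexE)
  have B1: "range branch \<subseteq> B" "independent_mod (int q) B" using B(1) by simp_all
  have "f \<in> B" if "independent_mod (int q) (insert f B)" for f
  proof -
    have "insert f B \<in> ?\<A>" using that B1(1) by auto
    then have "insert f B = B" using B(2) by (meson subset_insertI)
    then show ?thesis by auto
  qed
  then have span: "spanning_mod (int q) B" by (rule maximal_independent_spanning[OF q' B1(2)])
  have "B \<approx> (UNIV :: nat set set)"
  proof (rule lepoll_antisym)
    \<comment> \<open>A function is coded by its graph, a set of naturals; this gives the upper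
      bound on the size of \<open>B\<close>.\<close>
    let ?g = "\<lambda>f :: nat \<Rightarrow> int. range (\<lambda>j. prod_encode (j, int_encode (f j)))"
    have "inj ?g"
    proof (rule injI)
      fix f h assume eq: "?g f = ?g h"
      have "f j = h j" for j
      proof -
        have "prod_encode (j, int_encode (f j)) \<in> ?g h" using eq by blast
        then obtain i where "prod_encode (j, int_encode (f j)) = prod_encode (i, int_encode (h i))" by blast
        then show ?thesis by (auto simp: prod_encode_eq int_encode_eq)
      qed
      then show "f = h" by blast
    qed
    then show "B \<lesssim> (UNIV :: nat set set)" unfolding lepoll_def using inj_on_subset by blast
    show "(UNIV :: nat set set) \<lesssim> B" unfolding lepoll_def using inj_branch B1(1) by blast
  qed
  moreover have "independent_mod (int (q ^ n)) B" for n
    using independent_mod_power[OF B1(2)] q' by (simp add: prime_gt_0_nat q)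
  moreover have "spanning_mod (int (q ^ n)) B" for n
    using spanning_mod_power[OF span] by simp
  ultimately show ?thesis using that by blast
qed

section \<open>Countable products of countable groups\<close>

lemma nat_pow_product_group:
  assumes "\<And>i. i \<in> I \<Longrightarrow> group (K i)"
  shows "x [^]\<^bsub>product_group I K\<^esub> (n::nat) = (\<lambda>i\<in>I. x i [^]\<^bsub>K i\<^esub> n)"
proof (induction n)
  case 0 show ?case by (simp add: nat_pow_def)
next
  case (Suc n)
  then show ?case by (simp add: nat_pow_def cong: restrict_cong)
qed

text \<open>Such a function is determined by the finite set of pairs at which it differs from
  \<open>u\<close>.\<close>

lemma countable_finite_support:
  assumes I: "countable I" and C: "\<And>i. i \<in> I \<Longrightarrow> countable (C i)"
  shows "countable {x \<in> (\<Pi>\<^sub>E i\<in>I. C i). finite {i \<in> I. x i \<noteq> u i}}"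
proof -
  let ?S = "{F. finite F \<and> F \<subseteq> (SIGMA i:I. C i)}"
  define g where "g F = (\<lambda>i\<in>I. if \<exists>k. (i, k) \<in> F then SOME k. (i, k) \<in> F else u i)" for F
  have "countable (SIGMA i:I. C i)" using I C by (rule countable_SIGMA)
  then have "countable (g ` ?S)" by (intro countable_image countable_Collect_finite_subset)
  moreover have "{x \<in> (\<Pi>\<^sub>E i\<in>I. C i). finite {i \<in> I. x i \<noteq> u i}} \<subseteq> g ` ?S"
  proof
    fix x assume x: "x \<in> {x \<in> (\<Pi>\<^sub>E i\<in>I. C i). finite {i \<in> I. x i \<noteq> u i}}"
    define F where "F = (\<lambda>i. (i, x i)) ` {i \<in> I. x i \<noteq> u i}"
    have F: "F \<in> ?S" using x by (auto simp: F_def PiE_iff)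
    have mem: "(i, k) \<in> F \<longleftrightarrow> i \<in> I \<and> x i \<noteq> u i \<and> k = x i" for i k by (auto simp: F_def)
    have "x \<in> extensional I" using x by (simp add: PiE_iff)
    then have "x = g F"
      unfolding g_def by (intro extensionalityI[of x I]) (auto simp: mem)
    then show "x \<in> g ` ?S" using F by blast
  qed
  ultimately show ?thesis by (rule countable_subset[rotated])
qed

lemma polish_group_topology_product_group:
  assumes I: "countable I" and K: "\<And>i. i \<in> I \<Longrightarrow> group (K i)" "\<And>i. i \<in> I \<Longrightarrow> countable (carrier (K i))"
  shows "polish_group_topology (product_group I K) (product_topology (\<lambda>i. discrete_topology (carrier (K i))) I)"
proof -
  let ?D = "\<lambda>i. discrete_topology (carrier (K i))"
  let ?T = "product_topology ?D I" and ?G = "product_group I K"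
  have ts: "topspace ?T = carrier ?G" by simp
  have proj: "continuous_map ?T (?D i) (\<lambda>x. x i)" if "i \<in> I" for i
    by (rule continuous_map_product_projection[OF that])
  have 1: "continuous_map (prod_topology ?T ?T) ?T (\<lambda>(x, y). x \<otimes>\<^bsub>?G\<^esub> y)"
    unfolding continuous_map_componentwise
  proof (intro conjI ballI)
    show "(\<lambda>(x, y). x \<otimes>\<^bsub>?G\<^esub> y) ` topspace (prod_topology ?T ?T) \<subseteq> extensional I" by auto
    fix i assume i: "i \<in> I"
    interpret group "K i" by (rule K(1)[OF i])
    have m: "continuous_map (prod_topology (?D i) (?D i)) (?D i) (\<lambda>(x, y). x \<otimes>\<^bsub>K i\<^esub> y)"
      unfolding prod_topology_discrete_topology[symmetric] by auto
    have "continuous_map (prod_topology ?T ?T) (prod_topology (?D i) (?D i))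
        (\<lambda>z. (((\<lambda>x. x i) \<circ> fst) z, ((\<lambda>x. x i) \<circ> snd) z))"
      by (rule continuous_map_pairedI;
          rule continuous_map_compose[OF continuous_map_fst proj[OF i]] continuous_map_compose[OF continuous_map_snd proj[OF i]])
    from continuous_map_compose[OF this m]
    show "continuous_map (prod_topology ?T ?T) (?D i) (\<lambda>z. (case z of (x, y) \<Rightarrow> x \<otimes>\<^bsub>?G\<^esub> y) i)"
      by (rule continuous_map_eq) (use i in auto)
  qed
  have 2: "continuous_map ?T ?T (\<lambda>x. inv\<^bsub>?G\<^esub> x)"
  proof (rule continuous_map_eq)
    show "continuous_map ?T ?T (\<lambda>x. \<lambda>i\<in>I. inv\<^bsub>K i\<^esub> x i)"
      unfolding continuous_map_componentwise
    proof (intro conjI ballI)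
      show "(\<lambda>x. \<lambda>i\<in>I. inv\<^bsub>K i\<^esub> x i) ` topspace ?T \<subseteq> extensional I" by auto
      fix i assume i: "i \<in> I"
      interpret group "K i" by (rule K(1)[OF i])
      have "continuous_map (?D i) (?D i) (\<lambda>x. inv\<^bsub>K i\<^esub> x)" by auto
      from continuous_map_compose[OF proj[OF i] this]
      show "continuous_map ?T (?D i) (\<lambda>x. (\<lambda>i\<in>I. inv\<^bsub>K i\<^esub> x i) i)"
        by (rule continuous_map_eq) (use i in auto)
    qed
    show "(\<lambda>i\<in>I. inv\<^bsub>K i\<^esub> x i) = inv\<^bsub>?G\<^esub> x" if "x \<in> topspace ?T" for x
      by (rule inv_product_group[symmetric]) (use that K(1) in simp_all)
  qed
  have 3: "Defs.separable_space ?T"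
  proof -
    define D where "D = {x \<in> (\<Pi>\<^sub>E i\<in>I. carrier (K i)). finite {i \<in> I. x i \<noteq> \<one>\<^bsub>K i\<^esub>}}"
    have "countable D" unfolding D_def by (rule countable_finite_support[OF I K(2)])
    have "x \<in> ?T closure_of D" if x: "x \<in> topspace ?T" for x
      unfolding in_closure_of
    proof (intro conjI allI impI x)
      fix U assume U: "x \<in> U \<and> openin ?T U"
      then obtain X where X: "x \<in> Pi\<^sub>E I X" "finite {i. X i \<noteq> topspace (?D i)}" "Pi\<^sub>E I X \<subseteq> U"
        using product_topology_open_contains_basis[of ?D I U x] by blast
      \<comment> \<open>On the coordinates that the basic open set leaves free, \<open>x\<close> is
        replaced by the identity. The result has finite support and stays in the same basic
        set.\<close>
      define y where "y = (\<lambda>i\<in>I. if X i = carrier (K i) then \<one>\<^bsub>K i\<^esub> else x i)"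
      have one: "\<one>\<^bsub>K i\<^esub> \<in> carrier (K i)" if "i \<in> I" for i
        using K(1)[OF that] by (simp add: group.is_monoid monoid.one_closed)
      have xi: "x i \<in> X i" "x i \<in> carrier (K i)" if "i \<in> I" for i using X(1) x that by auto
      have "y \<in> Pi\<^sub>E I X" using one xi by (simp add: y_def)
      moreover have "{i \<in> I. y i \<noteq> \<one>\<^bsub>K i\<^esub>} \<subseteq> {i. X i \<noteq> topspace (?D i)}" by (auto simp: y_def)
      then have "finite {i \<in> I. y i \<noteq> \<one>\<^bsub>K i\<^esub>}" using X(2) by (rule finite_subset)
      moreover have "y \<in> (\<Pi>\<^sub>E i\<in>I. carrier (K i))" using one xi by (simp add: y_def)
      ultimately show "\<exists>y. y \<in> D \<and> y \<in> U" using X(3) by (intro exI[of _ y]) (auto simp: D_def)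
    qed
    then have "?T closure_of D = topspace ?T" using closure_of_subset_topspace[of ?T D] by (intro equalityI subsetI) auto
    then show ?thesis unfolding Defs.separable_space_def
      using \<open>countable D\<close> by (intro exI[of _ D]) (auto simp: D_def)
  qed
  have "countable {i \<in> I. \<nexists>a. topspace (?D i) \<subseteq> {a}}" using I by (rule countable_subset[rotated]) blast
  then have 4: "completely_metrizable_space ?T"
    unfolding completely_metrizable_space_product_topology
    using completely_metrizable_space_discrete_topology by blast
  show ?thesis using ts 1 2 3 4 by (simp only: polish_group_topology_def group_topology_def)
qed

text \<open>The pullback topology turns the isomorphism into a homeomorphism, and separability and
  complete metrizability are invariant under homeomorphisms.\<close>

lemma polish_group_topology_iso:
  assumes G: "group G" and H: "group H" and \<phi>: "\<phi> \<in> iso G H" and T: "polish_group_topology H T"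
  shows "\<exists>S. polish_group_topology G S"
proof -
  interpret h: group_hom G H \<phi>
    using G H \<phi> by (simp add: group_hom_def group_hom_axioms_def iso_def)
  have bij: "bij_betw \<phi> (carrier G) (carrier H)" using \<phi> by (simp add: iso_def)
  have ts: "topspace T = carrier H" and mult: "continuous_map (prod_topology T T) T (\<lambda>(x, y). x \<otimes>\<^bsub>H\<^esub> y)"
    and inv: "continuous_map T T (\<lambda>x. inv\<^bsub>H\<^esub> x)"
    and sep: "Defs.separable_space T" and cm: "completely_metrizable_space T"
    using T by (simp_all add: polish_group_topology_def group_topology_def)
  define S where "S = pullback_topology (carrier G) \<phi> T"
  have S_ts: "topspace S = carrier G"
    unfolding S_def topspace_pullback_topology using ts by auto
  have S_open: "openin S U \<longleftrightarrow> (\<exists>W. openin T W \<and> U = \<phi> -` W \<inter> carrier G)" for U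
    unfolding S_def openin_pullback_topology by blast
  define \<psi> where "\<psi> = the_inv_into (carrier G) \<phi>"
  have \<psi>: "\<psi> y \<in> carrier G" "\<phi> (\<psi> y) = y" if "y \<in> carrier H" for y
    using bij that unfolding \<psi>_def bij_betw_def
    by (auto simp: the_inv_into_into f_the_inv_into_f)
  have \<psi>\<phi>: "\<psi> (\<phi> x) = x" if "x \<in> carrier G" for x
    using bij that unfolding \<psi>_def bij_betw_def by (simp add: the_inv_into_f_f)
  have c\<phi>: "continuous_map S T \<phi>"
    using continuous_map_pullback[of T T id "carrier G" \<phi>] by (simp add: S_def)
  have c\<psi>: "continuous_map T S \<psi>"
    unfolding continuous_map_def
  proof (intro conjI allI impI)
    show "\<psi> \<in> topspace T \<rightarrow> topspace S" using \<psi>(1) ts S_ts by auto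
    fix U assume "openin S U"
    then obtain W where W: "openin T W" "U = \<phi> -` W \<inter> carrier G" using S_open by blast
    have "{x \<in> topspace T. \<psi> x \<in> U} = W"
      using \<psi> W openin_subset[OF W(1)] ts by auto
    then show "openin T {x \<in> topspace T. \<psi> x \<in> U}" using W(1) by simp
  qed
  have homeo: "homeomorphic_maps S T \<phi> \<psi>"
    unfolding homeomorphic_maps_def using c\<phi> c\<psi> \<psi>\<phi> \<psi>(2) ts S_ts by simp
  then have hs: "S homeomorphic_space T" unfolding homeomorphic_space_def by blast
  have "continuous_map (prod_topology S S) S (\<lambda>(x, y). x \<otimes>\<^bsub>G\<^esub> y)"
  proof (rule continuous_map_eq)
    have "continuous_map (prod_topology S S) (prod_topology T T) (\<lambda>z. ((\<phi> \<circ> fst) z, (\<phi> \<circ> snd) z))"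
      by (rule continuous_map_pairedI;
          rule continuous_map_compose[OF continuous_map_fst c\<phi>] continuous_map_compose[OF continuous_map_snd c\<phi>])
    from continuous_map_compose[OF continuous_map_compose[OF this mult] c\<psi>]
    show "continuous_map (prod_topology S S) S (\<psi> \<circ> ((\<lambda>(x, y). x \<otimes>\<^bsub>H\<^esub> y) \<circ> (\<lambda>z. ((\<phi> \<circ> fst) z, (\<phi> \<circ> snd) z))))" .
    show "(\<psi> \<circ> ((\<lambda>(x, y). x \<otimes>\<^bsub>H\<^esub> y) \<circ> (\<lambda>z. ((\<phi> \<circ> fst) z, (\<phi> \<circ> snd) z)))) z = (case z of (x, y) \<Rightarrow> x \<otimes>\<^bsub>G\<^esub> y)"
      if z: "z \<in> topspace (prod_topology S S)" for z
    proof -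
      obtain a b where ab: "z = (a, b)" "a \<in> carrier G" "b \<in> carrier G" using z S_ts by (cases z) auto
      then have "\<psi> (\<phi> a \<otimes>\<^bsub>H\<^esub> \<phi> b) = a \<otimes>\<^bsub>G\<^esub> b" using \<psi>\<phi>[of "a \<otimes>\<^bsub>G\<^esub> b"] by simp
      then show ?thesis by (simp add: ab(1))
    qed
  qed
  moreover have "continuous_map S S (\<lambda>x. inv\<^bsub>G\<^esub> x)"
  proof (rule continuous_map_eq)
    show "continuous_map S S (\<psi> \<circ> ((\<lambda>x. inv\<^bsub>H\<^esub> x) \<circ> \<phi>))"
      by (rule continuous_map_compose[OF continuous_map_compose[OF c\<phi> inv] c\<psi>])
    show "(\<psi> \<circ> ((\<lambda>x. inv\<^bsub>H\<^esub> x) \<circ> \<phi>)) x = inv\<^bsub>G\<^esub> x" if "x \<in> topspace S" for x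
    proof -
      have x: "x \<in> carrier G" using that S_ts by simp
      then show ?thesis using \<psi>\<phi>[of "inv\<^bsub>G\<^esub> x"] by simp
    qed
  qed
  moreover have "Defs.separable_space S"
    using sep homeomorphic_separable_space[OF hs]
    unfolding Defs.separable_space_def Abstract_Topological_Spaces.separable_space_def by blast
  moreover have "completely_metrizable_space S"
    using cm homeomorphic_completely_metrizable_space[OF hs] by simp
  ultimately show ?thesis using S_ts
    by (intro exI[of _ S]) (simp add: polish_group_topology_def group_topology_def)
qed

text \<open>
  The structure is the disjoint union of the groups; each group acts on itself by right
  multiplications, whose commuting bijections are the left multiplications.
\<close>

lemma product_group_iso_automorphism_group:
  assumes I: "countable I" "I \<noteq> {}" and K: "\<And>i. i \<in> I \<Longrightarrow> group (K i)" "\<And>i. i \<in> I \<Longrightarrow> countable (carrier (K i))"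
  shows "\<exists>M :: (nat, nat, nat) fo_structure. is_fo_structure M \<and> countable (universe M) \<and>
    product_group I K \<cong> automorphism_group M"
proof -
  define S where "S = (SIGMA i:I. carrier (K i))"
  have "countable S" unfolding S_def using I(1) K(2) by (rule countable_SIGMA)
  then obtain e :: "'a \<times> 'b \<Rightarrow> nat" where e: "inj_on e S" unfolding countable_def by blast
  define d where "d = the_inv_into S e"
  have d: "d (e z) = z" if "z \<in> S" for z unfolding d_def by (rule the_inv_into_f_f[OF e that])
  have S: "(i, x) \<in> S \<longleftrightarrow> i \<in> I \<and> x \<in> carrier (K i)" for i x by (simp add: S_def)
  define D where "D = e ` S"
  have D_cases: "\<exists>i x. i \<in> I \<and> x \<in> carrier (K i) \<and> y = e (i, x)" if "y \<in> D" for y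
    using that unfolding D_def S_def by blast
  have eD: "e (i, x) \<in> D" if "i \<in> I" "x \<in> carrier (K i)" for i x using that by (simp add: D_def S)
  have de: "d (e (i, x)) = (i, x)" if "i \<in> I" "x \<in> carrier (K i)" for i x using that by (simp add: d S)
  have e_eq: "e (i, x) = e (j, y) \<longleftrightarrow> i = j \<and> x = y"
    if "i \<in> I" "x \<in> carrier (K i)" "j \<in> I" "y \<in> carrier (K j)" for i j x y
    using de[OF that(1,2)] de[OF that(3,4)] by (metis prod.inject)
  have one: "\<one>\<^bsub>K i\<^esub> \<in> carrier (K i)" if "i \<in> I" for i
    using K(1)[OF that] by (simp add: group.is_monoid monoid.one_closed)
  have mcl: "x \<otimes>\<^bsub>K i\<^esub> y \<in> carrier (K i)" if "i \<in> I" "x \<in> carrier (K i)" "y \<in> carrier (K i)" for i x y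
    using K(1)[OF that(1)] that by (simp add: group.is_monoid monoid.m_closed)
  have assoc: "x \<otimes>\<^bsub>K i\<^esub> y \<otimes>\<^bsub>K i\<^esub> z = x \<otimes>\<^bsub>K i\<^esub> (y \<otimes>\<^bsub>K i\<^esub> z)"
    if "i \<in> I" "x \<in> carrier (K i)" "y \<in> carrier (K i)" "z \<in> carrier (K i)" for i x y z
    using K(1)[OF that(1)] that by (simp add: group.is_monoid monoid.m_assoc)
  have units: "\<one>\<^bsub>K i\<^esub> \<otimes>\<^bsub>K i\<^esub> x = x" "x \<otimes>\<^bsub>K i\<^esub> \<one>\<^bsub>K i\<^esub> = x" if "i \<in> I" "x \<in> carrier (K i)" for i x
    using K(1)[OF that(1)] that by (simp_all add: group.is_monoid monoid.l_one monoid.r_one)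
  \<comment> \<open>A function symbol has to be interpreted everywhere, so an element acts as the
    identity on the factors other than its own.\<close>
  define act where "act s y = e (fst (d y), if fst (d s) = fst (d y) then snd (d y) \<otimes>\<^bsub>K (fst (d y))\<^esub> snd (d s) else snd (d y))"
    for s y :: nat
  have act: "act (e (i, g)) (e (j, x)) = (if i = j then e (j, x \<otimes>\<^bsub>K j\<^esub> g) else e (j, x))"
    if "i \<in> I" "g \<in> carrier (K i)" "j \<in> I" "x \<in> carrier (K j)" for i g j x
    unfolding act_def de[OF that(1,2)] de[OF that(3,4)] by simp
  \<comment> \<open>The unary relations single out the factors; without them an automorphism could
    permute isomorphic factors.\<close>
  define M :: "(nat, nat, nat) fo_structure" where
    "M = \<lparr>universe = D, fun_syms = D, rel_syms = D, fun_arity = (\<lambda>_. 1), rel_arity = (\<lambda>_. 1),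
      fun_interp = (\<lambda>s xs. act s (hd xs)), rel_interp = (\<lambda>s. {[y] | y. y \<in> D \<and> fst (d y) = fst (d s)})\<rparr>"
  have tup: "tuples D (Suc 0) = {[y] | y. y \<in> D}"
    by (auto simp: tuples_def length_Suc_conv)
  have tup_ball: "(\<forall>xs\<in>tuples D (Suc 0). Q xs) \<longleftrightarrow> (\<forall>y\<in>D. Q [y])" for Q by (auto simp: tup)
  have actD: "act s y \<in> D" if sy: "s \<in> D" "y \<in> D" for s y
  proof -
    obtain i g where s: "i \<in> I" "g \<in> carrier (K i)" "s = e (i, g)" using D_cases[OF sy(1)] by blast
    obtain j x where y: "j \<in> I" "x \<in> carrier (K j)" "y = e (j, x)" using D_cases[OF sy(2)] by blast
    show ?thesis unfolding s(3) y(3) act[OF s(1,2) y(1,2)]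
      using eD[OF y(1,2)] eD[OF y(1) mcl[OF y(1,2)]] s by auto
  qed
  have "D \<noteq> {}" using I(2) eD one by blast
  have M: "is_fo_structure M"
    unfolding is_fo_structure_def M_def using \<open>D \<noteq> {}\<close> actD by (auto simp: tup)
  have aut: "h \<in> automorphisms M \<longleftrightarrow> h \<in> Bij D \<and> (\<forall>s\<in>D. \<forall>y\<in>D. h (act s y) = act s (h y)) \<and>
      (\<forall>s\<in>D. \<forall>y\<in>D. fst (d y) = fst (d s) \<longleftrightarrow> fst (d (h y)) = fst (d s))" for h
  proof -
    have "h y \<in> D" if "h \<in> Bij D" "y \<in> D" for y
      using that by (metis Bij_imp_funcset funcset_mem)
    then show ?thesis unfolding automorphisms_def M_def by (auto simp: tup_ball)
  qed
  let ?G = "product_group I K"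
  have kc: "k i \<in> carrier (K i)" if "k \<in> carrier ?G" "i \<in> I" for k i using that by auto
  define \<Psi> where "\<Psi> k = (\<lambda>y\<in>D. e (fst (d y), k (fst (d y)) \<otimes>\<^bsub>K (fst (d y))\<^esub> snd (d y)))" for k
  have \<Psi>: "\<Psi> k (e (i, x)) = e (i, k i \<otimes>\<^bsub>K i\<^esub> x)" if "i \<in> I" "x \<in> carrier (K i)" for k i x
    using that by (simp add: \<Psi>_def eD de)
  have \<Psi>_mult: "\<Psi> (k \<otimes>\<^bsub>?G\<^esub> l) = compose D (\<Psi> k) (\<Psi> l)" if kl: "k \<in> carrier ?G" "l \<in> carrier ?G" for k l
  proof (rule extensionalityI[of _ D])
    show "\<Psi> (k \<otimes>\<^bsub>?G\<^esub> l) \<in> extensional D" by (simp add: \<Psi>_def)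
    show "compose D (\<Psi> k) (\<Psi> l) \<in> extensional D" by (rule compose_extensional)
    fix y assume y: "y \<in> D"
    obtain i x where ix: "i \<in> I" "x \<in> carrier (K i)" "y = e (i, x)" using D_cases[OF y] by blast
    have "compose D (\<Psi> k) (\<Psi> l) y = \<Psi> k (\<Psi> l y)" using y by (simp add: compose_def)
    also have "\<dots> = e (i, k i \<otimes>\<^bsub>K i\<^esub> (l i \<otimes>\<^bsub>K i\<^esub> x))"
      unfolding ix(3) \<Psi>[OF ix(1,2)] by (rule \<Psi>[OF ix(1) mcl[OF ix(1) kc[OF kl(2) ix(1)] ix(2)]])
    also have "\<dots> = e (i, (k i \<otimes>\<^bsub>K i\<^esub> l i) \<otimes>\<^bsub>K i\<^esub> x)"
      using assoc[OF ix(1) kc[OF kl(1) ix(1)] kc[OF kl(2) ix(1)] ix(2)] by simp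
    also have "\<dots> = \<Psi> (k \<otimes>\<^bsub>?G\<^esub> l) y" unfolding ix(3) \<Psi>[OF ix(1,2)] using ix(1) by simp
    finally show "\<Psi> (k \<otimes>\<^bsub>?G\<^esub> l) y = compose D (\<Psi> k) (\<Psi> l) y" by simp
  qed
  interpret G: group ?G by (rule product_group) (rule K(1))
  have \<Psi>_one: "\<Psi> \<one>\<^bsub>?G\<^esub> = (\<lambda>y\<in>D. y)"
  proof (rule extensionalityI[of _ D])
    fix y assume y: "y \<in> D"
    obtain i x where ix: "i \<in> I" "x \<in> carrier (K i)" "y = e (i, x)" using D_cases[OF y] by blast
    show "\<Psi> \<one>\<^bsub>?G\<^esub> y = (\<lambda>y\<in>D. y) y" using y ix units(1)[OF ix(1,2)] by (simp add: \<Psi>)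
  qed (simp_all add: \<Psi>_def)
  have \<Psi>_D: "\<Psi> k y \<in> D" if k: "k \<in> carrier ?G" and y: "y \<in> D" for k y
  proof -
    obtain i x where ix: "i \<in> I" "x \<in> carrier (K i)" "y = e (i, x)" using D_cases[OF y] by blast
    show ?thesis unfolding ix(3) \<Psi>[OF ix(1,2)] by (rule eD[OF ix(1) mcl[OF ix(1) kc[OF k ix(1)] ix(2)]])
  qed
  have \<Psi>_Bij: "\<Psi> k \<in> Bij D" if k: "k \<in> carrier ?G" for k
  proof -
    let ?l = "inv\<^bsub>?G\<^esub> k"
    have l: "?l \<in> carrier ?G" using k by (rule G.inv_closed)
    have "\<Psi> k (\<Psi> ?l y) = y" "\<Psi> ?l (\<Psi> k y) = y" if y: "y \<in> D" for y
    proof -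
      have "compose D (\<Psi> k) (\<Psi> ?l) y = (\<lambda>y\<in>D. y) y" using \<Psi>_mult[OF k l] \<Psi>_one G.r_inv[OF k] by metis
      then show "\<Psi> k (\<Psi> ?l y) = y" using y by (simp add: compose_def)
      have "compose D (\<Psi> ?l) (\<Psi> k) y = (\<lambda>y\<in>D. y) y" using \<Psi>_mult[OF l k] \<Psi>_one G.l_inv[OF k] by metis
      then show "\<Psi> ?l (\<Psi> k y) = y" using y by (simp add: compose_def)
    qed
    then have "bij_betw (\<Psi> k) D D"
      by (intro bij_betw_byWitness[where f' = "\<Psi> ?l"]) (use \<Psi>_D k l in auto)
    then show ?thesis by (simp add: Bij_def \<Psi>_def)
  qed
  have \<Psi>_aut: "\<Psi> k \<in> automorphisms M" if k: "k \<in> carrier ?G" for k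
    unfolding aut
  proof (intro conjI ballI \<Psi>_Bij[OF k])
    fix s y assume sy: "s \<in> D" "y \<in> D"
    obtain i g where s: "i \<in> I" "g \<in> carrier (K i)" "s = e (i, g)" using D_cases[OF sy(1)] by blast
    obtain j x where y: "j \<in> I" "x \<in> carrier (K j)" "y = e (j, x)" using D_cases[OF sy(2)] by blast
    have kj: "k j \<in> carrier (K j)" by (rule kc[OF k y(1)])
    have kx: "k j \<otimes>\<^bsub>K j\<^esub> x \<in> carrier (K j)" by (rule mcl[OF y(1) kj y(2)])
    show "\<Psi> k (act s y) = act s (\<Psi> k y)"
    proof (cases "i = j")
      case True
      have g: "g \<in> carrier (K j)" using s(2) True by simp
      have "\<Psi> k (act s y) = \<Psi> k (e (j, x \<otimes>\<^bsub>K j\<^esub> g))" using act[OF s(1,2) y(1,2)] s(3) y(3) True by simp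
      also have "\<dots> = e (j, k j \<otimes>\<^bsub>K j\<^esub> (x \<otimes>\<^bsub>K j\<^esub> g))" by (rule \<Psi>[OF y(1) mcl[OF y(1,2) g]])
      also have "\<dots> = e (j, (k j \<otimes>\<^bsub>K j\<^esub> x) \<otimes>\<^bsub>K j\<^esub> g)" using assoc[OF y(1) kj y(2) g] by simp
      also have "\<dots> = act s (\<Psi> k y)" using act[OF s(1,2) y(1) kx] s(3) y(3) True \<Psi>[OF y(1,2)] by simp
      finally show ?thesis .
    next
      case False
      then show ?thesis using act[OF s(1,2) y(1,2)] act[OF s(1,2) y(1) kx] s(3) y(3) \<Psi>[OF y(1,2)] by simp
    qed
    show "fst (d y) = fst (d s) \<longleftrightarrow> fst (d (\<Psi> k y)) = fst (d s)"
      using \<Psi>[OF y(1,2)] de[OF y(1,2)] de[OF y(1) kx] y(3) by simp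
  qed
  have surj: "\<exists>k\<in>carrier ?G. h = \<Psi> k" if h: "h \<in> automorphisms M" for h
  proof -
    have hB: "h \<in> Bij D" and hact: "\<And>s y. s \<in> D \<Longrightarrow> y \<in> D \<Longrightarrow> h (act s y) = act s (h y)"
      and hfst: "\<And>s y. s \<in> D \<Longrightarrow> y \<in> D \<Longrightarrow> fst (d y) = fst (d s) \<longleftrightarrow> fst (d (h y)) = fst (d s)"
      using h unfolding aut by simp_all
    have hD: "h y \<in> D" if "y \<in> D" for y using hB that by (metis Bij_imp_funcset funcset_mem)
    \<comment> \<open>An automorphism is determined by its values at the identities of the factors,
      from which right multiplications reach all other elements.\<close>
    define k where "k = (\<lambda>i\<in>I. snd (d (h (e (i, \<one>\<^bsub>K i\<^esub>)))))"
    have k: "k i \<in> carrier (K i)" "h (e (i, \<one>\<^bsub>K i\<^esub>)) = e (i, k i)" if i: "i \<in> I" for i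
    proof -
      let ?y = "e (i, \<one>\<^bsub>K i\<^esub>)"
      have y: "?y \<in> D" by (rule eD[OF i one[OF i]])
      obtain j x where jx: "j \<in> I" "x \<in> carrier (K j)" "h ?y = e (j, x)" using D_cases[OF hD[OF y]] by blast
      have "fst (d (h ?y)) = fst (d ?y)" using hfst[OF y y] by simp
      then have "j = i" using de[OF jx(1,2)] de[OF i one[OF i]] jx(3) by simp
      moreover have "k i = x" using i jx de[OF jx(1,2)] by (simp add: k_def)
      ultimately show "k i \<in> carrier (K i)" "h ?y = e (i, k i)" using jx by simp_all
    qed
    have kG: "k \<in> carrier ?G" using k(1) by (simp add: k_def)
    have "h = \<Psi> k"
    proof (rule extensionalityI[of _ D])
      show "h \<in> extensional D" using hB by (simp add: Bij_def)
      show "\<Psi> k \<in> extensional D" by (simp add: \<Psi>_def)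
      fix y assume y: "y \<in> D"
      obtain i x where ix: "i \<in> I" "x \<in> carrier (K i)" "y = e (i, x)" using D_cases[OF y] by blast
      have y1: "e (i, \<one>\<^bsub>K i\<^esub>) \<in> D" by (rule eD[OF ix(1) one[OF ix(1)]])
      have "y = act y (e (i, \<one>\<^bsub>K i\<^esub>))"
        using act[OF ix(1,2,1) one[OF ix(1)]] units(1)[OF ix(1,2)] ix(3) by simp
      then have "h y = act y (h (e (i, \<one>\<^bsub>K i\<^esub>)))" using hact[OF y y1] by metis
      also have "\<dots> = e (i, k i \<otimes>\<^bsub>K i\<^esub> x)"
        unfolding k(2)[OF ix(1)] ix(3) using act[OF ix(1,2,1) k(1)[OF ix(1)]] by simp
      finally show "h y = \<Psi> k y" using \<Psi>[OF ix(1,2)] ix(3) by simp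
    qed
    then show ?thesis using kG by blast
  qed
  have inj: "inj_on \<Psi> (carrier ?G)"
  proof (rule inj_onI)
    fix k l assume kl: "k \<in> carrier ?G" "l \<in> carrier ?G" "\<Psi> k = \<Psi> l"
    have "k i = l i" if i: "i \<in> I" for i
    proof -
      have "e (i, k i \<otimes>\<^bsub>K i\<^esub> \<one>\<^bsub>K i\<^esub>) = e (i, l i \<otimes>\<^bsub>K i\<^esub> \<one>\<^bsub>K i\<^esub>)"
        using \<Psi>[OF i one[OF i]] kl(3) by metis
      then have "e (i, k i) = e (i, l i)" using units(2)[OF i] kc[OF kl(1) i] kc[OF kl(2) i] by simp
      then show ?thesis using e_eq[OF i kc[OF kl(1) i] i kc[OF kl(2) i]] by simp
    qed
    then show "k = l" using kl(1,2) by (intro PiE_ext[of k I "\<lambda>i. carrier (K i)" l]) simp_all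
  qed
  have "\<Psi> \<in> iso ?G (automorphism_group M)"
  proof (rule isoI)
    show "\<Psi> \<in> hom ?G (automorphism_group M)"
    proof (rule homI)
      show "\<Psi> k \<in> carrier (automorphism_group M)" if "k \<in> carrier ?G" for k
        using \<Psi>_aut[OF that] by (simp add: automorphism_group_def)
      show "\<Psi> (k \<otimes>\<^bsub>?G\<^esub> l) = \<Psi> k \<otimes>\<^bsub>automorphism_group M\<^esub> \<Psi> l" if "k \<in> carrier ?G" "l \<in> carrier ?G" for k l
        unfolding \<Psi>_mult[OF that] using \<Psi>_Bij that
        by (simp add: automorphism_group_def BijGroup_def M_def)
    qed
    show "bij_betw \<Psi> (carrier ?G) (carrier (automorphism_group M))"
      unfolding bij_betw_def
    proof (intro conjI inj equalityI subsetI)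
      show "h \<in> carrier (automorphism_group M)" if "h \<in> \<Psi> ` carrier ?G" for h
        using that \<Psi>_aut by (auto simp: automorphism_group_def)
      show "h \<in> \<Psi> ` carrier ?G" if "h \<in> carrier (automorphism_group M)" for h
        using surj[of h] that by (auto simp: automorphism_group_def)
    qed
  qed
  then have "?G \<cong> automorphism_group M" by (rule is_isoI)
  moreover have "countable (universe M)" by simp
  ultimately show ?thesis using M by blast
qed

section \<open>Graph products satisfying the conditions\<close>

text \<open>The basis is indexed by the letters in \<open>X\<close>, and its entries are reduced
  modulo \<open>m\<close> so that they are elements of \<open>integer_mod_group\<close>.\<close>

lemma color_basis:
  fixes X :: "'v set" and n :: nat
  assumes q: "prime (q :: nat)" and X: "X \<approx> (UNIV :: nat set set)"
  defines "m \<equiv> int (q ^ n)"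
  obtains \<beta> :: "'v \<Rightarrow> nat \<Rightarrow> int" where "\<forall>v j. 0 \<le> \<beta> v j \<and> \<beta> v j < m"
    "\<forall>L k. finite L \<longrightarrow> L \<subseteq> X \<longrightarrow> (\<forall>j. m dvd (\<Sum>v\<in>L. k v * \<beta> v j)) \<longrightarrow> (\<forall>v\<in>L. m dvd k v)"
    "\<forall>f. \<exists>L k. finite L \<and> L \<subseteq> X \<and> (\<forall>j. m dvd f j - (\<Sum>v\<in>L. k v * \<beta> v j))"
proof -
  have m: "m > 0" using q by (simp add: m_def prime_gt_0_nat)
  obtain B where B: "B \<approx> (UNIV :: nat set set)" "independent_mod m B" "spanning_mod m B"
    unfolding m_def using continuum_basis[OF q] by metis
  have "X \<approx> B" using X B(1) by (meson eqpoll_sym eqpoll_trans)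
  then obtain g where g: "bij_betw g X B" unfolding eqpoll_def by blast
  define \<beta> where "\<beta> v j = g v j mod m" for v j
  have diff: "m dvd (\<Sum>v\<in>L. k v * g v j) - (\<Sum>v\<in>L. k v * \<beta> v j)" for L :: "'v set" and k j
  proof -
    have "(\<Sum>v\<in>L. k v * g v j) - (\<Sum>v\<in>L. k v * \<beta> v j) = (\<Sum>v\<in>L. k v * (g v j - g v j mod m))"
      by (simp add: \<beta>_def sum_subtractf[symmetric] right_diff_distrib)
    also have "m dvd \<dots>" by (intro dvd_sum dvd_mult) (simp add: dvd_minus_mod)
    finally show ?thesis .
  qed
  show ?thesis
  proof (rule that[of \<beta>]; intro allI impI ballI)
    show "0 \<le> \<beta> v j \<and> \<beta> v j < m" for v j using m by (simp add: \<beta>_def)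
    show "m dvd k v" if L: "finite L" "L \<subseteq> X" and dvd: "\<forall>j. m dvd (\<Sum>v\<in>L. k v * \<beta> v j)" and v: "v \<in> L" for L k v
    proof -
      have inj: "inj_on g L" using g L(2) by (meson bij_betw_imp_inj_on inj_on_subset)
      define c where "c b = k (the_inv_into L g b)" for b
      have c: "c (g v) = k v" if "v \<in> L" for v using the_inv_into_f_f[OF inj that] by (simp add: c_def)
      have "m dvd (\<Sum>b\<in>g ` L. c b * b j)" for j
      proof -
        have "(\<Sum>b\<in>g ` L. c b * b j) = (\<Sum>v\<in>L. k v * g v j)"
          by (subst sum.reindex[OF inj]) (use c in \<open>simp cong: sum.cong\<close>)
        then show ?thesis using diff[where L = L and k = k and j = j] dvd[rule_format, of j] by (metis diff_add_cancel dvd_add)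
      qed
      moreover have "g ` L \<subseteq> B" using g L(2) by (auto simp: bij_betw_def)
      ultimately have "\<forall>b\<in>g ` L. m dvd c b"
        using B(2) finite_imageI[OF L(1), of g] unfolding independent_mod_def by meson
      then show ?thesis using c[OF v] v by auto
    qed
    show "\<exists>L k. finite L \<and> L \<subseteq> X \<and> (\<forall>j. m dvd f j - (\<Sum>v\<in>L. k v * \<beta> v j))" for f
    proof -
      obtain S c where S: "finite S" "S \<subseteq> B" "\<forall>j. m dvd f j - (\<Sum>b\<in>S. c b * b j)"
        using B(3) unfolding spanning_mod_def by meson
      have "S \<subseteq> g ` X" using S(2) g by (auto simp: bij_betw_def)
      then obtain L where L: "L \<subseteq> X" "finite L" "S = g ` L" using S(1) by (meson finite_subset_image)
      have inj: "inj_on g L" using g L(1) by (meson bij_betw_imp_inj_on inj_on_subset)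
      have "m dvd f j - (\<Sum>v\<in>L. c (g v) * \<beta> v j)" for j
      proof -
        have eq: "(\<Sum>b\<in>S. c b * b j) = (\<Sum>v\<in>L. c (g v) * g v j)"
          unfolding L(3) by (subst sum.reindex[OF inj]) simp
        have "m dvd f j - (\<Sum>v\<in>L. c (g v) * g v j)" using S(3)[rule_format, of j] unfolding eq .
        from dvd_add[OF this diff[where L = L and k = "\<lambda>v. c (g v)" and j = j]]
        show ?thesis by simp
      qed
      then show ?thesis using L by (intro exI[of _ L] exI[of _ "\<lambda>v. c (g v)"]) simp
    qed
  qed
qed

lemma continuum_Diff_countable:
  assumes "X \<approx> (UNIV :: nat set set)" "uncountable X" "countable C"
  shows "X - C \<approx> (UNIV :: nat set set)"
proof (rule lepoll_antisym)
  have "X - C \<lesssim> X" by (rule subset_imp_lepoll) blast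
  then show "X - C \<lesssim> (UNIV :: nat set set)" using assms(1) by (rule lepoll_trans2)
  have "uncountable (X - C)" using assms(2,3) by (simp add: uncountable_minus_countable)
  then have inf: "infinite (X - C)" using countable_finite by blast
  have "(UNIV :: nat set set) \<approx> X" using assms(1) by (rule eqpoll_sym)
  also have "X \<lesssim> C \<union> (X - C)" by (rule subset_imp_lepoll) blast
  also have "\<dots> \<lesssim> X - C" by (rule countable_Un_lepoll[OF inf assms(3)])
  finally show "(UNIV :: nat set set) \<lesssim> X - C" .
qed

lemma eval_word_product_group:
  assumes K: "\<And>i. i \<in> I \<Longrightarrow> group (K i)" and f: "f \<in> S \<rightarrow> carrier (product_group I K)"
    and w: "w \<in> words S" and i: "i \<in> I"
  shows "eval_word (product_group I K) f w i = eval_word (K i) (\<lambda>v. f v i) w"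
  using w
proof (induction w)
  case Nil show ?case using i by simp
next
  case (Cons x w)
  obtain a b where x: "x = (a, b)" by (cases x)
  have fa: "f a \<in> carrier (product_group I K)" using Cons.prems f x by auto
  have "inv\<^bsub>product_group I K\<^esub> f a = (\<lambda>i\<in>I. inv\<^bsub>K i\<^esub> f a i)"
    by (rule inv_product_group) (use fa K in simp_all)
  then show ?case using Cons i by (simp add: x)
qed

lemma eval_word_integer_mod_group:
  assumes g: "g \<in> S \<rightarrow> carrier (integer_mod_group m)" and w: "w \<in> words S"
  shows "eval_word (integer_mod_group m) g w = (\<Sum>(v, b)\<leftarrow>w. if b then g v else - g v) mod int m"
  using w
proof (induction w)
  case (Cons x w)
  obtain a b where x: "x = (a, b)" by (cases x)
  have inv: "inv\<^bsub>integer_mod_group m\<^esub> g a = (- g a) mod int m"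
    by (rule inv_integer_mod_group) (use g Cons.prems x in auto)
  have "eval_word (integer_mod_group m) g (x # w) =
      ((if b then g a else (- g a) mod int m) + (\<Sum>(v, b)\<leftarrow>w. if b then g v else - g v) mod int m) mod int m"
    using Cons by (simp add: x inv)
  also have "\<dots> = (\<Sum>(v, b)\<leftarrow>x # w. if b then g v else - g v) mod int m" by (simp add: x mod_simps)
  finally show ?case .
qed simp

lemma letter_sum_eq_exp_sum:
  assumes L: "finite L" and g: "\<And>v. v \<in> fst ` set w \<Longrightarrow> v \<notin> L \<Longrightarrow> g v = 0"
  shows "(\<Sum>(v, b)\<leftarrow>w. if b then g v else - g v :: int) = (\<Sum>v\<in>L. exp_sum v w * g v)"
  using g
proof (induction w)
  case (Cons x w)
  obtain a b where x: "x = (a, b)" by (cases x)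
  define s where "s = (if b then 1 else -1 :: int)"
  have "(\<Sum>v\<in>L. exp_sum v (x # w) * g v) = (\<Sum>v\<in>L. (if v = a then s * g a else 0) + exp_sum v w * g v)"
    by (rule sum.cong) (auto simp: x s_def algebra_simps)
  also have "\<dots> = (if a \<in> L then s * g a else 0) + (\<Sum>v\<in>L. exp_sum v w * g v)"
    using L by (simp add: sum.distrib)
  also have "(if a \<in> L then s * g a else 0) = (if b then g a else - g a)"
    using Cons.prems[of a] by (simp add: x s_def)
  also have "(\<Sum>v\<in>L. exp_sum v w * g v) = (\<Sum>(v, b)\<leftarrow>w. if b then g v else - g v)"
    using Cons by simp
  finally show ?case by (simp add: x)
qed simp

text \<open>This transfers triviality of a word from the graph product of an induced subgraph to the
  whole graph product.\<close>

lemma pres_rel_mono: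
  assumes "S \<subseteq> S'" "R \<subseteq> R'"
  shows "pres_rel S R \<subseteq> pres_rel S' R'"
proof (rule subsetI)
  have w: "words S \<subseteq> words S'" using assms(1) by (auto simp: words_iff)
  fix z assume "z \<in> pres_rel S R"
  moreover obtain u v where "z = (u, v)" by (cases z)
  ultimately have "(u, v) \<in> pres_rel S R" by simp
  then have "(u, v) \<in> pres_rel S' R'"
  proof (induction rule: pres_rel.induct)
    case (refl w) then show ?case using subsetD[OF \<open>words S \<subseteq> words S'\<close>] by (intro pres_rel.refl)
  next
    case (sym u v) show ?case by (rule pres_rel.sym) (rule sym.IH)
  next
    case (trans u v w) show ?case by (rule pres_rel.trans) (rule trans.IH)+
  next
    case (append u u' v v') show ?case by (rule pres_rel.append) (rule append.IH)+
  next
    case (cancel x b) then show ?case using assms(1) by (intro pres_rel.cancel) blast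
  next
    case (defining u v) then show ?case using assms(2) subsetD[OF w] by (intro pres_rel.defining) blast+
  qed
  then show "z \<in> pres_rel S' R'" using \<open>z = (u, v)\<close> by simp
qed

lemma exp_sum_replicate [simp]: "exp_sum v (replicate n (v, True)) = int n"
  by (induction n) simp_all

text \<open>Natural exponents are enough, since the coefficients to be realised later are residues
  modulo a finite order.\<close>

lemma word_with_exponents:
  assumes "finite S"
  shows "\<exists>w. fst ` set w \<subseteq> S \<and> (\<forall>v\<in>S. exp_sum v w = int (k v))"
  using assms
proof (induction S rule: finite_induct)
  case empty show ?case by (intro exI[of _ "[]"]) simp
next
  case (insert v S)
  obtain w where w: "fst ` set w \<subseteq> S" "\<forall>v\<in>S. exp_sum v w = int (k v)" using insert.IH by blast
  let ?w = "replicate (k v) (v, True) @ w"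
  have "exp_sum v w = 0" using w(1) insert.hyps(2) by (intro exp_sum_eq_0) blast
  moreover have "exp_sum u (replicate (k v) (v, True)) = 0" if "u \<in> S" for u
    using that insert.hyps(2) by (intro exp_sum_eq_0) auto
  ultimately have "\<forall>u\<in>insert v S. exp_sum u ?w = int (k u)" using w(2) by simp
  moreover have "fst ` set ?w \<subseteq> insert v S" using w(1) by auto
  ultimately show ?case by blast
qed

section \<open>The isomorphism with a countable product of countable groups\<close>

context colored_graph
begin

lemma central_word_trivial:
  assumes F: "finite F" and u: "u \<in> words V" "fst ` set u \<subseteq> F" "F \<subseteq> central"
    and dvd: "\<And>v. v \<in> F \<Longrightarrow> int (ord v) dvd exp_sum v u"
  shows "cls u = \<one>\<^bsub>GP\<^esub>"
  using F u dvd
proof (induction F arbitrary: u rule: finite_induct)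
  case empty
  then show ?case by (simp add: cls_Nil)
next
  case (insert v F)
  have vc: "v \<in> central" and vV: "v \<in> V" using insert.prems(3) by (auto simp: central_def)
  let ?u = "filter (\<lambda>x. fst x \<noteq> v) u"
  have exp: "exp_sum a ?u = exp_sum a u" if "a \<noteq> v" for a
    using that by (induction u) auto
  have "cls ?u = \<one>\<^bsub>GP\<^esub>"
  proof (rule insert.IH)
    show "?u \<in> words V" using insert.prems(1) by simp
    show "fst ` set ?u \<subseteq> F" using insert.prems(2) by auto
    show "F \<subseteq> central" using insert.prems(3) by simp
    show "int (ord a) dvd exp_sum a ?u" if "a \<in> F" for a
    proof -
      have "a \<noteq> v" using that insert.hyps(2) by auto
      then show ?thesis using insert.prems(4)[of a] that exp by simp
    qed
  qed
  moreover have "gen v [^]\<^bsub>GP\<^esub> exp_sum v u = gen v [^]\<^bsub>GP\<^esub> (0::int)"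
    by (rule gen_int_pow_cong[OF vV]) (use insert.prems(4)[of v] in simp)
  ultimately show ?case using cls_split_letter[OF vc insert.prems(1)] by simp
qed

text \<open>The coordinate \<open>None\<close> carries the graph product of a countable induced
  subgraph. The coordinate \<open>Some (c, j)\<close> carries the \<open>j\<close>-th entries of the
  basis vectors assigned to the remaining letters of colour \<open>c\<close>. Injectivity comes from
  independence of the basis, surjectivity from spanning.\<close>

lemma polish_conditions_imp_product:
  assumes pc: "polish_conditions V E p"
  obtains I :: "(enat \<times> nat) option set" and K :: "(enat \<times> nat) option \<Rightarrow> int monoid"
  where "countable I" "I \<noteq> {}" "\<And>i. i \<in> I \<Longrightarrow> group (K i)" "\<And>i. i \<in> I \<Longrightarrow> countable (carrier (K i))"
    "GP \<cong> product_group I K"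
proof -
  obtain A where A: "A \<subseteq> V" "countable A" "\<forall>a\<in>V. \<forall>b\<in>V - A. a \<noteq> b \<longrightarrow> (a, b) \<in> E"
    using pc unfolding polish_conditions_def by (elim conjE exE)
  define F where "F = {c \<in> p ` V. uncountable (color_class V p c)}"
  note pc' = conjunct2[OF pc[unfolded polish_conditions_def]]
  have F: "finite F" unfolding F_def by (rule conjunct1[OF pc'])
  note inf_count = conjunct1[OF conjunct2[OF pc']] and cont' = conjunct2[OF conjunct2[OF pc']]
  have cont: "color_class V p c \<approx> (UNIV :: nat set set)" if "c \<in> F" for c
    using cont' that unfolding F_def by blast
  \<comment> \<open>Letters of colours used only countably often also go into the countable part, so
    each remaining letter is central and has a colour in \<open>F\<close>.\<close>
  define A' where "A' = A \<union> (\<Union>c\<in>{c \<in> p ` V. countable (color_class V p c)}. color_class V p c)"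
  have A'_count: "countable A'" unfolding A'_def using A(2) by (intro countable_Un countable_UN) auto
  have A'V: "A' \<subseteq> V" using A(1) by (auto simp: A'_def color_class_def)
  have central: "v \<in> central" if "v \<in> V" "v \<notin> A'" for v
    using A(3) that by (simp add: central_def A'_def)
  have inF: "p v \<in> F" if "v \<in> V" "v \<notin> A'" for v
  proof (rule ccontr)
    assume "p v \<notin> F"
    then have "v \<in> A'" using that(1) unfolding A'_def F_def
      by (auto simp: color_class_def intro!: bexI[of _ v])
    then show False using that(2) by contradiction
  qed
  define X where "X c = color_class V p c - A'" for c
  have XV: "v \<in> V" "v \<notin> A'" "p v = c" if "v \<in> X c" for v c
    using that by (auto simp: X_def color_class_def)
  have mem_X: "v \<in> X (p v)" if "v \<in> V" "v \<notin> A'" for v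
    using that by (auto simp: X_def color_class_def)
  define m where "m c = int (color_order c)" for c
  define good where "good c \<beta> \<longleftrightarrow> (\<forall>v j. 0 \<le> \<beta> v j \<and> \<beta> v j < m c) \<and>
      (\<forall>L k. finite L \<longrightarrow> L \<subseteq> X c \<longrightarrow> (\<forall>j. m c dvd (\<Sum>v\<in>L. k v * \<beta> v j)) \<longrightarrow> (\<forall>v\<in>L. m c dvd k v)) \<and>
      (\<forall>f. \<exists>L k. finite L \<and> L \<subseteq> X c \<and> (\<forall>j. m c dvd f j - (\<Sum>v\<in>L. k v * \<beta> v j)))"
    for c and \<beta> :: "'v \<Rightarrow> nat \<Rightarrow> int"
  have "\<exists>\<beta>. good c \<beta>" if c: "c \<in> F" for c
  proof -
    have unc: "uncountable (color_class V p c)" using c by (simp add: F_def)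
    have "c \<noteq> \<infinity>"
    proof
      assume "c = \<infinity>"
      then show False using unc inf_count by simp
    qed
    moreover obtain v where "v \<in> V" "c = p v" using c unfolding F_def by blast
    ultimately obtain q n where q: "prime q" "n \<ge> 1" "c = enat (q ^ n)"
      using color_prime_power[of v] by metis
    have mc: "m c = int (q ^ n)" by (simp add: m_def q(3))
    have XU: "X c \<approx> (UNIV :: nat set set)" unfolding X_def
      by (rule continuum_Diff_countable[OF cont[OF c] unc A'_count])
    obtain \<beta> :: "'v \<Rightarrow> nat \<Rightarrow> int" where "\<forall>v j. 0 \<le> \<beta> v j \<and> \<beta> v j < int (q ^ n)"
      "\<forall>L k. finite L \<longrightarrow> L \<subseteq> X c \<longrightarrow> (\<forall>j. int (q ^ n) dvd (\<Sum>v\<in>L. k v * \<beta> v j)) \<longrightarrow> (\<forall>v\<in>L. int (q ^ n) dvd k v)"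
      "\<forall>f. \<exists>L k. finite L \<and> L \<subseteq> X c \<and> (\<forall>j. int (q ^ n) dvd f j - (\<Sum>v\<in>L. k v * \<beta> v j))"
      by (rule color_basis[OF q(1) XU, where n = n])
    then have "good c \<beta>" unfolding good_def mc by (intro conjI)
    then show ?thesis by (intro exI[of _ \<beta>])
  qed
  then obtain \<beta> where \<beta>: "\<And>c. c \<in> F \<Longrightarrow> good c (\<beta> c)" by metis
  define bv where "bv v j = \<beta> (p v) v j" for v j

  define E' where "E' = E \<inter> A' \<times> A'"
  interpret A: colored_graph A' E' p
  proof
    show "simple_graph A' E'" using graph
      by (auto simp: E'_def simple_graph_def sym_def irrefl_def)
    show "p \<in> A' \<rightarrow> colors" using colors A'V by auto
  qed
  have "countable (carrier A.GP)" unfolding A.carrier_GP words_def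
    using A'_count by (intro countable_image countable_lists countable_SIGMA) simp_all
  \<comment> \<open>All factors must share one type; the countable group is therefore copied into
    the integers, where the cyclic groups already live.\<close>
  then obtain \<iota>0 :: "'v word set \<Rightarrow> nat" where \<iota>0: "inj_on \<iota>0 (carrier A.GP)" unfolding countable_def by blast
  define \<iota> where "\<iota> g = int (\<iota>0 g)" for g
  have \<iota>: "inj_on \<iota> (carrier A.GP)" using \<iota>0 by (simp add: inj_on_def \<iota>_def)
  let ?K0 = "image_group \<iota> A.GP"
  have K0: "group ?K0" by (rule A.GP.inj_imp_image_group_is_group[OF \<iota>])
  have \<iota>_iso: "\<iota> \<in> iso A.GP ?K0" by (rule inj_imp_image_group_iso[OF \<iota>])
  interpret K0: group ?K0 by (rule K0)
  interpret \<iota>: group_hom A.GP ?K0 \<iota>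
    by unfold_locales (use \<iota>_iso in \<open>simp add: iso_def\<close>)

  define I where "I = insert None (Some ` (F \<times> (UNIV :: nat set)))"
  define K where "K i = (case i of None \<Rightarrow> ?K0 | Some (c, j) \<Rightarrow> integer_mod_group (color_order c))" for i :: "(enat \<times> nat) option"
  have K_simps: "K None = ?K0" "K (Some (c, j)) = integer_mod_group (color_order c)" for c j
    by (simp_all add: K_def)
  have I_mem: "None \<in> I" "Some (c, j) \<in> I \<longleftrightarrow> c \<in> F" for c j by (auto simp: I_def)
  have I_cases: "i = None \<or> (\<exists>c j. i = Some (c, j) \<and> c \<in> F)" if "i \<in> I" for i using that by (auto simp: I_def)
  have I_count: "countable I" unfolding I_def using F by (intro countable_insert countable_image countable_SIGMA) (simp_all add: countable_finite)
  have K_group: "group (K i)" if "i \<in> I" for i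
    using I_cases[OF that] K0 by (auto simp: K_simps)
  have K_count: "countable (carrier (K i))" if "i \<in> I" for i
    by simp
  let ?H = "product_group I K"
  interpret H: group ?H by (rule product_group) (rule K_group)

  \<comment> \<open>A letter of \<open>A'\<close> is visible only at \<open>None\<close>; any other
    letter is its basis vector, spread over the coordinates of its own colour.\<close>
  define f where "f v = (\<lambda>i\<in>I. case i of None \<Rightarrow> (if v \<in> A' then \<iota> (A.gen v) else \<iota> \<one>\<^bsub>A.GP\<^esub>)
      | Some (c, j) \<Rightarrow> (if v \<notin> A' \<and> p v = c then bv v j else 0))" for v
  have f_None: "f v None = (if v \<in> A' then \<iota> (A.gen v) else \<iota> \<one>\<^bsub>A.GP\<^esub>)" for v
    using I_mem by (simp add: f_def)
  have f_Some: "f v (Some (c, j)) = (if v \<notin> A' \<and> p v = c then bv v j else 0)" if "c \<in> F" for v c j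
    using I_mem(2)[of c j] that by (simp add: f_def)
  have bv_range: "0 \<le> bv v j \<and> bv v j < m (p v)" if "p v \<in> F" for v j
    using \<beta>[OF that] unfolding good_def bv_def by (elim conjE) simp
  have fS_carrier: "f v (Some (c, j)) \<in> carrier (integer_mod_group (color_order c))" if "c \<in> F" for v c j
    using bv_range[of v j] that unfolding f_Some[OF that] carrier_integer_mod_group by (auto simp: m_def)
  have fN_carrier: "f v None \<in> carrier ?K0" for v
    unfolding f_None by simp
  have f_carrier: "f \<in> V \<rightarrow> carrier ?H"
  proof (rule funcsetI)
    fix v
    have "f v i \<in> carrier (K i)" if "i \<in> I" for i
      using I_cases[OF that] fN_carrier fS_carrier by (auto simp: K_simps)
    then show "f v \<in> carrier ?H" by (simp add: PiE_iff f_def)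
  qed
  obtain \<phi> where \<phi>: "\<phi> \<in> hom GP ?H" "\<And>w. w \<in> words V \<Longrightarrow> \<phi> (cls w) = eval_word ?H f w"
  proof (rule GP_hom[OF H.is_group f_carrier])
    fix v assume v: "v \<in> V"
    have "f v i [^]\<^bsub>K i\<^esub> ord v = \<one>\<^bsub>K i\<^esub>" if i: "i \<in> I" for i
    proof (cases i)
      case None
      show ?thesis
      proof (cases "v \<in> A'")
        case True
        have "\<iota> (A.gen v) [^]\<^bsub>?K0\<^esub> ord v = \<iota> (A.gen v [^]\<^bsub>A.GP\<^esub> ord v)"
          by (rule \<iota>.hom_nat_pow[symmetric]) (use True in simp)
        also have "\<dots> = \<one>\<^bsub>?K0\<^esub>" unfolding A.gen_pow_ord[OF True] by (rule \<iota>.hom_one)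
        finally show ?thesis using True unfolding None f_None K_simps by simp
      next
        case False
        then show ?thesis unfolding None f_None K_simps by simp
      qed
    next
      case (Some cj)
      obtain c j where cj: "cj = (c, j)" by (cases cj)
      have c: "c \<in> F" using i I_mem(2) by (simp add: Some cj)
      have "f v (Some (c, j)) [^]\<^bsub>integer_mod_group (color_order c)\<^esub> ord v = (int (ord v) * f v (Some (c, j))) mod int (color_order c)"
        by simp
      also have "\<dots> = 0" unfolding f_Some[OF c] by simp
      finally show ?thesis unfolding Some cj K_simps by simp
    qed
    then have "(\<lambda>i\<in>I. f v i [^]\<^bsub>K i\<^esub> ord v) = \<one>\<^bsub>?H\<^esub>"
      unfolding one_product_group by (intro restrict_ext)
    moreover have "f v [^]\<^bsub>?H\<^esub> ord v = (\<lambda>i\<in>I. f v i [^]\<^bsub>K i\<^esub> ord v)"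
      by (rule nat_pow_product_group) (rule K_group)
    ultimately show "f v [^]\<^bsub>?H\<^esub> ord v = \<one>\<^bsub>?H\<^esub>" by (simp only:)
  next
    fix a b assume ab: "(a, b) \<in> E"
    have "f a i \<otimes>\<^bsub>K i\<^esub> f b i = f b i \<otimes>\<^bsub>K i\<^esub> f a i" if i: "i \<in> I" for i
    proof (cases i)
      case None
      show ?thesis
      proof (cases "a \<in> A' \<and> b \<in> A'")
        case True
        then have e: "(a, b) \<in> E'" using ab by (simp add: E'_def)
        have "\<iota> (A.gen a) \<otimes>\<^bsub>?K0\<^esub> \<iota> (A.gen b) = \<iota> (A.gen b) \<otimes>\<^bsub>?K0\<^esub> \<iota> (A.gen a)"
          using True A.gen_commute[OF e] by (simp flip: \<iota>.hom_mult)
        then show ?thesis using True unfolding None f_None K_simps by simp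
      next
        case False
        then have "f a None = \<one>\<^bsub>?K0\<^esub> \<or> f b None = \<one>\<^bsub>?K0\<^esub>" unfolding f_None by auto
        then show ?thesis unfolding None K_simps using fN_carrier[of a] fN_carrier[of b]
          by (elim disjE) simp_all
      qed
    next
      case (Some cj)
      obtain c j where cj: "cj = (c, j)" by (cases cj)
      show ?thesis unfolding Some cj K_simps by (simp add: add.commute)
    qed
    then show "f a \<otimes>\<^bsub>?H\<^esub> f b = f b \<otimes>\<^bsub>?H\<^esub> f a"
      unfolding mult_product_group by (intro restrict_ext)
  qed (rule that)
  interpret \<phi>: group_hom GP ?H \<phi> by unfold_locales (rule \<phi>(1))
  have \<phi>_comp: "\<phi> (cls w) i = eval_word (K i) (\<lambda>v. f v i) w" if "w \<in> words V" "i \<in> I" for w i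
    unfolding \<phi>(2)[OF that(1)] by (rule eval_word_product_group[OF K_group f_carrier that])
  let ?P = "\<lambda>x :: 'v \<times> bool. fst x \<in> A'"
  have \<phi>_None: "\<phi> (cls w) None = \<iota> (A.cls (filter ?P w))" if "w \<in> words V" for w
  proof -
    have "eval_word ?K0 (\<lambda>v. f v None) w = \<iota> (A.cls (filter ?P w))"
    proof (induction w)
      case Nil show ?case using \<iota>.hom_one by (simp add: A.cls_Nil)
    next
      case (Cons x w)
      obtain a b where x: "x = (a, b)" by (cases x)
      have fw: "filter ?P w \<in> words A'" by (auto simp: words_iff)
      have cw: "A.cls (filter ?P w) \<in> carrier A.GP" using fw by simp
      show ?case
      proof (cases "a \<in> A'")
        case True
        have ga: "A.gen a \<in> carrier A.GP" using True by simp
        have "eval_word ?K0 (\<lambda>v. f v None) (x # w) =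
            (if b then \<iota> (A.gen a) else inv\<^bsub>?K0\<^esub> \<iota> (A.gen a)) \<otimes>\<^bsub>?K0\<^esub> \<iota> (A.cls (filter ?P w))"
          using Cons True by (simp add: x f_None)
        also have "(if b then \<iota> (A.gen a) else inv\<^bsub>?K0\<^esub> \<iota> (A.gen a)) = \<iota> (if b then A.gen a else inv\<^bsub>A.GP\<^esub> A.gen a)"
          using ga by simp
        also have "\<dots> \<otimes>\<^bsub>?K0\<^esub> \<iota> (A.cls (filter ?P w)) = \<iota> ((if b then A.gen a else inv\<^bsub>A.GP\<^esub> A.gen a) \<otimes>\<^bsub>A.GP\<^esub> A.cls (filter ?P w))"
          by (rule \<iota>.hom_mult[symmetric]) (use ga cw in simp_all)
        also have "(if b then A.gen a else inv\<^bsub>A.GP\<^esub> A.gen a) \<otimes>\<^bsub>A.GP\<^esub> A.cls (filter ?P w) = A.cls ((a, b) # filter ?P w)"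
          by (rule A.cls_Cons[symmetric, OF True fw])
        finally show ?thesis using True by (simp add: x)
      next
        case False
        then have "f a None = \<one>\<^bsub>?K0\<^esub>" using \<iota>.hom_one by (simp add: f_None)
        then have "eval_word ?K0 (\<lambda>v. f v None) (x # w) = \<one>\<^bsub>?K0\<^esub> \<otimes>\<^bsub>?K0\<^esub> \<iota> (A.cls (filter ?P w))"
          using Cons by (simp add: x)
        also have "\<dots> = \<iota> (A.cls (filter ?P w))" by (rule K0.l_one) (rule \<iota>.hom_closed[OF cw])
        finally show ?thesis using False by (simp add: x)
      qed
    qed
    then show ?thesis using \<phi>_comp[OF that I_mem(1)] by (simp add: K_simps)
  qed
  \<comment> \<open>\<open>L\<close> may be larger than the set of relevant letters of
    \<open>w\<close>, as absent letters have exponent \<open>0\<close>; surjectivity uses this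
    freedom.\<close>
  have \<phi>_Some: "\<phi> (cls w) (Some (c, j)) = (\<Sum>v\<in>L. exp_sum v w * bv v j) mod m c"
    if w: "w \<in> words V" and c: "c \<in> F" and L: "finite L" "L \<subseteq> X c"
      and rest: "\<And>v. v \<in> fst ` set w \<Longrightarrow> v \<in> X c \<Longrightarrow> v \<in> L" for w c j L
  proof -
    let ?g = "\<lambda>v. f v (Some (c, j))"
    have "\<phi> (cls w) (Some (c, j)) = eval_word (integer_mod_group (color_order c)) ?g w"
      using \<phi>_comp[OF w, of "Some (c, j)"] I_mem(2) c by (simp add: K_simps)
    also have "\<dots> = (\<Sum>(v, b)\<leftarrow>w. if b then ?g v else - ?g v) mod int (color_order c)"
      by (rule eval_word_integer_mod_group[OF _ w]) (use fS_carrier[OF c] in simp)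
    also have "(\<Sum>(v, b)\<leftarrow>w. if b then ?g v else - ?g v) = (\<Sum>v\<in>L. exp_sum v w * ?g v)"
    proof (rule letter_sum_eq_exp_sum[OF L(1)])
      fix v assume v: "v \<in> fst ` set w" "v \<notin> L"
      have "v \<in> V" using v(1) w by (auto simp: words_iff)
      then show "?g v = 0" using rest[OF v(1)] v(2) mem_X[of v] unfolding f_Some[OF c] by auto
    qed
    also have "\<dots> = (\<Sum>v\<in>L. exp_sum v w * bv v j)"
    proof (rule sum.cong)
      fix v assume "v \<in> L"
      then have "v \<in> X c" using L(2) by blast
      then show "exp_sum v w * ?g v = exp_sum v w * bv v j" using XV(2,3)[of v c] by (simp add: f_Some[OF c])
    qed simp
    finally show ?thesis by (simp add: m_def)
  qed
  \<comment> \<open>The word splits into its part over \<open>A'\<close>, which the coordinate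
    \<open>None\<close> forces to be trivial, and a central part, whose exponents vanish modulo the
    orders by independence.\<close>
  have \<phi>_inj: "x = \<one>\<^bsub>GP\<^esub>" if x: "x \<in> carrier GP" "\<phi> x = \<one>\<^bsub>?H\<^esub>" for x
  proof -
    obtain w where w: "w \<in> words V" "x = cls w" using GP_cases[OF x(1)] .
    let ?u = "filter ?P w" and ?v = "filter (\<lambda>x. \<not> ?P x) w"
    have "\<iota> (A.cls ?u) = \<one>\<^bsub>?K0\<^esub>"
      using \<phi>_None[OF w(1)] x(2) w(2) I_mem(1) by (simp add: K_simps)
    then have "\<iota> (A.cls ?u) = \<iota> (A.cls [])" using \<iota>.hom_one by (simp add: A.cls_Nil)
    moreover have uA: "?u \<in> words A'" by (auto simp: words_iff)
    ultimately have "A.cls ?u = A.cls []" by (intro inj_onD[OF \<iota>]) simp_all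
    then have "(?u, []) \<in> pres_rel A' (graph_product_relations A' E' p)" by (rule A.cls_eqD) simp
    moreover have "graph_product_relations A' E' p \<subseteq> graph_product_relations V E p"
      using A'V by (auto simp: graph_product_relations_def E'_def)
    ultimately have "(?u, []) \<in> pres_rel V (graph_product_relations V E p)"
      using pres_rel_mono[OF A'V] by blast
    then have cu: "cls ?u = \<one>\<^bsub>GP\<^esub>" using cls_eqI cls_Nil by metis
    have outside: "y \<in> V" "y \<notin> A'" if "y \<in> fst ` set ?v" for y
      using that w(1) by (auto simp: words_iff)
    have cv: "cls ?v = \<one>\<^bsub>GP\<^esub>"
    proof (rule central_word_trivial[where F = "fst ` set ?v"])
      show "finite (fst ` set ?v)" "fst ` set ?v \<subseteq> fst ` set ?v" by simp_all
      show "?v \<in> words V" using w(1) by simp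
      show "fst ` set ?v \<subseteq> central" using outside central by blast
      fix v assume v: "v \<in> fst ` set ?v"
      define c where "c = p v"
      have c: "c \<in> F" unfolding c_def by (rule inF[OF outside[OF v]])
      define L where "L = fst ` set ?v \<inter> X c"
      have L: "finite L" "L \<subseteq> X c" by (simp_all add: L_def)
      have exp: "exp_sum y w = exp_sum y ?v" if "y \<in> X c" for y
      proof -
        have "y \<notin> A'" using XV(2)[OF that] .
        then show ?thesis by (induction w) auto
      qed
      have "m c dvd (\<Sum>v\<in>L. exp_sum v w * \<beta> c v j)" for j
      proof -
        have "(\<Sum>v\<in>L. exp_sum v w * bv v j) mod m c = \<phi> (cls w) (Some (c, j))"
        proof (rule \<phi>_Some[OF w(1) c L, symmetric])
          show "y \<in> L" if "y \<in> fst ` set w" "y \<in> X c" for y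
            using that XV(2)[OF that(2)] by (force simp: L_def)
        qed
        also have "\<dots> = 0" using x(2) w(2) I_mem(2)[of c j] c by (simp add: K_simps)
        finally have "m c dvd (\<Sum>v\<in>L. exp_sum v w * bv v j)" by (simp only: mod_eq_0_iff_dvd)
        also have "(\<Sum>v\<in>L. exp_sum v w * bv v j) = (\<Sum>v\<in>L. exp_sum v w * \<beta> c v j)"
          by (rule sum.cong) (use L(2) XV(3) in \<open>auto simp: bv_def\<close>)
        finally show ?thesis .
      qed
      then have dvd: "\<forall>j. m c dvd (\<Sum>v\<in>L. exp_sum v w * \<beta> c v j)" by (rule allI)
      have indep: "\<forall>L k. finite L \<longrightarrow> L \<subseteq> X c \<longrightarrow> (\<forall>j. m c dvd (\<Sum>v\<in>L. k v * \<beta> c v j)) \<longrightarrow> (\<forall>v\<in>L. m c dvd k v)"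
        using \<beta>[OF c] unfolding good_def by (elim conjE)
      have "\<forall>v\<in>L. m c dvd exp_sum v w"
        by (rule indep[THEN spec[of _ L], THEN spec[of _ "\<lambda>v. exp_sum v w"], THEN mp, OF L(1), THEN mp, OF L(2), THEN mp, OF dvd])
      moreover have "v \<in> L" using v mem_X[OF outside[OF v]] by (simp add: L_def c_def)
      ultimately have "m c dvd exp_sum v w" by blast
      moreover have "v \<in> X c" using \<open>v \<in> L\<close> L(2) by blast
      ultimately show "int (ord v) dvd exp_sum v ?v" using exp by (simp add: m_def c_def)
    qed
    have "cls w = cls ?u \<otimes>\<^bsub>GP\<^esub> cls ?v"
      by (rule cls_split_central[OF w(1)]) (use w(1) central in \<open>auto simp: words_iff\<close>)
    then show ?thesis unfolding w(2) cu cv by simp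
  qed
  \<comment> \<open>For a fixed colour, spanning matches infinitely many coordinates by one finite
    combination. As \<open>F\<close> is finite, finitely many letters serve all colours
    simultaneously.\<close>
  have \<phi>_surj: "h \<in> \<phi> ` carrier GP" if h: "h \<in> carrier ?H" for h
  proof -
    have "h None \<in> carrier ?K0" using h I_mem(1) by (auto simp: PiE_iff K_simps dest: bspec)
    then obtain g where g: "g \<in> carrier A.GP" "h None = \<iota> g" unfolding image_group_carrier by blast
    obtain wA where wA: "wA \<in> words A'" "g = A.cls wA" using A.GP_cases[OF g(1)] .
    have hS: "0 \<le> h (Some (c, j)) \<and> h (Some (c, j)) < m c" if c: "c \<in> F" for c j
    proof -
      have "h (Some (c, j)) \<in> carrier (integer_mod_group (color_order c))"
        using h c I_mem(2)[of c j] by (auto simp: PiE_iff K_simps dest: bspec[of _ _ "Some (c, j)"])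
      moreover obtain v where "v \<in> V" "c = p v" using c unfolding F_def by blast
      have "color_order c \<noteq> 0"
      proof
        assume "color_order c = 0"
        moreover have "c \<in> colors" using \<open>v \<in> V\<close> \<open>c = p v\<close> colors by auto
        ultimately have "c = \<infinity>" by (auto simp: colors_def prime_gt_0_nat)
        then show False using c inf_count by (simp add: F_def)
      qed
      ultimately show ?thesis by (simp add: carrier_integer_mod_group m_def)
    qed
    have "\<exists>L k. finite L \<and> L \<subseteq> X c \<and> (\<forall>j. m c dvd h (Some (c, j)) - (\<Sum>v\<in>L. k v * \<beta> c v j))" if "c \<in> F" for c
      using \<beta>[OF that] unfolding good_def by (elim conjE allE[of _ "\<lambda>j. h (Some (c, j))"])
    then obtain L k where Lk: "\<And>c. c \<in> F \<Longrightarrow> finite (L c) \<and> L c \<subseteq> X c \<and>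
        (\<forall>j. m c dvd h (Some (c, j)) - (\<Sum>v\<in>L c. k c v * \<beta> c v j))" by metis
    define S where "S = (\<Union>c\<in>F. L c)"
    have "finite S" unfolding S_def using F Lk by simp
    \<comment> \<open>Reducing the coefficients modulo the orders makes them natural numbers without
      changing the values of the coordinates.\<close>
    then obtain u where u: "fst ` set u \<subseteq> S" "\<forall>v\<in>S. exp_sum v u = int (nat (k (p v) v mod m (p v)))"
      using word_with_exponents[of S "\<lambda>v. nat (k (p v) v mod m (p v))"] by blast
    have SX: "v \<in> L (p v)" "p v \<in> F" "v \<in> V" "v \<notin> A'" if v: "v \<in> S" for v
    proof -
      obtain c where c: "c \<in> F" "v \<in> L c" using v unfolding S_def by blast
      then have vX: "v \<in> X c" using Lk by blast
      show "v \<in> L (p v)" "p v \<in> F" "v \<in> V" "v \<notin> A'" using c XV[OF vX] by simp_all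
    qed
    define w where "w = wA @ u"
    have uV: "u \<in> words V" unfolding words_iff using u(1) SX(3) by blast
    have wAV: "wA \<in> words V" using wA(1) A'V by (auto simp: words_iff)
    have wV: "w \<in> words V" using uV wAV by (simp add: w_def)
    have "\<phi> (cls w) = h"
    proof (rule PiE_ext[of _ I "\<lambda>i. carrier (K i)"])
      show "\<phi> (cls w) \<in> (\<Pi>\<^sub>E i\<in>I. carrier (K i))" using \<phi>.hom_closed[OF cls_closed[OF wV]] by simp
      show "h \<in> (\<Pi>\<^sub>E i\<in>I. carrier (K i))" using h by simp
      fix i assume i: "i \<in> I"
      show "\<phi> (cls w) i = h i"
      proof (cases i)
        case None
        have "filter ?P wA = wA" using wA(1) by (intro filter_True) (auto simp: words_iff)
        moreover have "filter ?P u = []" using u(1) SX(4) by (intro filter_False) blast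
        ultimately have "filter ?P w = wA" by (simp add: w_def)
        then show ?thesis using \<phi>_None[OF wV] g(2) wA(2) None by simp
      next
        case (Some cj)
        obtain c j where cj: "cj = (c, j)" by (cases cj)
        have c: "c \<in> F" using i I_mem(2) by (simp add: Some cj)
        have L: "finite (L c)" "L c \<subseteq> X c" and dvd: "m c dvd h (Some (c, j)) - (\<Sum>v\<in>L c. k c v * \<beta> c v j)"
          using Lk[OF c] by simp_all
        have mc: "m c > 0" using hS[OF c, of j] by linarith
        have "\<phi> (cls w) (Some (c, j)) = (\<Sum>v\<in>L c. exp_sum v w * bv v j) mod m c"
        proof (rule \<phi>_Some[OF wV c L])
          fix v assume v: "v \<in> fst ` set w" "v \<in> X c"
          have "v \<notin> fst ` set wA" using wA(1) XV(2)[OF v(2)] by (auto simp: words_iff)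
          then have "v \<in> fst ` set u" using v(1) by (auto simp: w_def)
          then have "v \<in> S" using u(1) by blast
          then have "v \<in> L (p v)" by (rule SX(1))
          then show "v \<in> L c" using XV(3)[OF v(2)] by simp
        qed
        also have "(\<Sum>v\<in>L c. exp_sum v w * bv v j) = (\<Sum>v\<in>L c. (k c v mod m c) * \<beta> c v j)"
        proof (rule sum.cong)
          fix v assume v: "v \<in> L c"
          then have vX: "v \<in> X c" using L(2) by blast
          have "v \<in> S" using v c unfolding S_def by blast
          moreover have "exp_sum v wA = 0" using wA(1) XV(2)[OF vX] by (intro exp_sum_eq_0) (auto simp: words_iff)
          ultimately have "exp_sum v w = int (nat (k c v mod m c))" using u(2) XV(3)[OF vX] by (simp add: w_def)
          also have "\<dots> = k c v mod m c" using mc by simp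
          finally show "exp_sum v w * bv v j = (k c v mod m c) * \<beta> c v j" using XV(3)[OF vX] by (simp add: bv_def)
        qed simp
        also have "\<dots> mod m c = (\<Sum>v\<in>L c. ((k c v mod m c) * \<beta> c v j) mod m c) mod m c"
          by (rule mod_sum_eq[symmetric])
        also have "\<dots> = (\<Sum>v\<in>L c. (k c v * \<beta> c v j) mod m c) mod m c" by (simp only: mod_mult_left_eq)
        also have "\<dots> = (\<Sum>v\<in>L c. k c v * \<beta> c v j) mod m c" by (rule mod_sum_eq)
        also have "\<dots> = h (Some (c, j)) mod m c" using dvd by (simp add: mod_eq_dvd_iff dvd_diff_commute)
        also have "\<dots> = h (Some (c, j))" using hS[OF c, of j] by (intro mod_pos_pos_trivial) simp_all
        finally show ?thesis by (simp add: Some cj)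
      qed
    qed
    then show ?thesis using cls_closed[OF wV] by blast
  qed
  have "inj_on \<phi> (carrier GP)" using \<phi>.inj_on_one_iff \<phi>_inj by blast
  moreover have "\<phi> ` carrier GP = carrier ?H"
    by (intro equalityI subsetI \<phi>_surj) (auto simp del: carrier_product_group)
  ultimately have "\<phi> \<in> iso GP ?H" using \<phi>(1) by (simp add: iso_def bij_betw_def)
  then have "GP \<cong> ?H" by (rule is_isoI)
  moreover have "I \<noteq> {}" using I_mem(1) by blast
  ultimately show ?thesis using that I_count K_group K_count by blast
qed

end

theorem theorem1p3:
  fixes V :: "'v set" and E :: "'v rel" and p :: "'v \<Rightarrow> enat"
  assumes "simple_graph V E"
    and "p \<in> V \<rightarrow> colors"
  shows "((\<exists>T. polish_group_topology (graph_product V E p) T) \<longleftrightarrow> polish_conditions V E p) \<and>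
    (polish_conditions V E p \<longrightarrow>
      (\<exists>M :: (nat, nat, nat) fo_structure.
         is_fo_structure M \<and> countable (universe M) \<and>
         graph_product V E p \<cong> automorphism_group M))"
proof -
  interpret colored_graph V E p by (rule colored_graph.intro[OF assms])
  have suff: "(\<exists>T. polish_group_topology GP T) \<and> (\<exists>M :: (nat, nat, nat) fo_structure.
      is_fo_structure M \<and> countable (universe M) \<and> GP \<cong> automorphism_group M)"
    if pc: "polish_conditions V E p"
  proof -
    obtain I :: "(enat \<times> nat) option set" and K :: "(enat \<times> nat) option \<Rightarrow> int monoid"
      where IK: "countable I" "I \<noteq> {}" "\<And>i. i \<in> I \<Longrightarrow> group (K i)" "\<And>i. i \<in> I \<Longrightarrow> countable (carrier (K i))"
        and iso: "GP \<cong> product_group I K"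
      by (rule polish_conditions_imp_product[OF pc]) (rule that)
    obtain \<phi> where \<phi>: "\<phi> \<in> iso GP (product_group I K)" using iso by (auto simp: is_iso_def)
    have gH: "group (product_group I K)" by (rule product_group) (rule IK(3))
    have "\<exists>T. polish_group_topology GP T"
      by (rule polish_group_topology_iso[OF GP.is_group gH \<phi>],
          rule polish_group_topology_product_group[OF IK(1)]) (rule IK(3,4), assumption)+
    moreover have "\<exists>M :: (nat, nat, nat) fo_structure. is_fo_structure M \<and> countable (universe M) \<and>
        product_group I K \<cong> automorphism_group M"
      by (rule product_group_iso_automorphism_group[OF IK(1,2)]) (rule IK(3,4), assumption)+
    then obtain M :: "(nat, nat, nat) fo_structure"
      where M: "is_fo_structure M" "countable (universe M)" "product_group I K \<cong> automorphism_group M"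
      by (elim exE conjE)
    ultimately show ?thesis using iso_trans[OF iso M(3)] M(1,2) by blast
  qed
  have "polish_conditions V E p" if T: "polish_group_topology GP T" for T
  proof -
    obtain d where d: "polish_grp GP d" by (rule polish_group_topologyE[OF GP.is_group T])
    interpret polish_grp GP d by (rule d)
    interpret polish_colored_graph V E p d by unfold_locales
    show ?thesis by (rule polish_conditions)
  qed
  then show ?thesis using suff by blast
qed

end
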